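(* Let $\Theta$ be a real skew-symmetric $n\times n$ matrix, $n\ge2$. Suppose that for every $I=(i_1,\dots,i_l)$ with $1\le i_1<\dots<i_l\le n$ and even length $|I|=l=2m$, $2\le|I|\le2\lfloor n/2\rfloor$, one has $$\mathrm{pf}(F^j(M_I^\Theta)_{11})\in(0,1)\ \text{ for all } j=0,1,\dots,m-2,\qquad\text{and}\qquad \mathrm{pf}(F^{m-1}(M_I^\Theta)_{11})\notin\mathbb{Z}.$$ Then for every such $I$ there exists a projection $P_I\in\mathcal{A}_\Theta$ such that $$\tau_\Theta(P_I)=\mathrm{pf}(M_I^\Theta)+\sum_{0<|J|<l}\mathrm{pf}(M_J^\Theta)k_{I_J}+k_{I_0}$$ for some integers $k_{I_J},k_{I_0}$, where the sum is over the initial segments $J=(i_1,\dots,i_s)$ of $I$ with $s=2,4,\dots,2m-2$.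
   Context: For a real skew-symmetric $n\times n$ matrix $\Theta=(\theta_{jk})$, $\mathcal{A}_\Theta$ is the universal $C^*$-algebra generated by unitaries $\mathfrak{u}_1,\dots,\mathfrak{u}_n$ subject to $\mathfrak{u}_k\mathfrak{u}_j=e^{2\pi i\theta_{jk}}\mathfrak{u}_j\mathfrak{u}_k$, and $\tau_\Theta$ is its canonical tracial state: $\tau_\Theta(1)=1$ and $\tau_\Theta(\mathfrak{u}_1^{k_1}\cdots\mathfrak{u}_n^{k_n})=0$ for $(k_1,\dots,k_n)\ne0$. $\mathrm{pf}$ is the pfaffian of an even-size skew-symmetric matrix (normalized to be $1$ on the block diagonal matrix with blocks $\begin{pmatrix}0&1\\-1&0\end{pmatrix}$). For $I=(i_1<\dots<i_{2p})$, $|I|=2p$ and $M_I^\Theta$ is the submatrix of $\Theta$ with rows and columns indexed by $I$. For an even-size skew-symmetric $B=\begin{pmatrix}B_{11}&B_{12}\\ B_{21}&B_{22}\end{pmatrix}$ of size $>2$ with $B_{11}$ an invertible $2\times2$ block, $F(B)=B_{22}-B_{21}B_{11}^{-1}B_{12}$. $F^0(B)=B$ and $F^j$ is the $j$-fold iterate (defined as long as the successive upper left $2\times2$ blocks are invertible). $F^j(B)_{11}$ is the upper left $2\times2$ block of $F^j(B)$ (the whole matrix if $F^j(B)$ is $2\times2$). *)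

theory Defs
  imports
    Complex_Main
    "HOL-Algebra.Algebraic_Closure_Type"
    "HOL-Combinatorics.Permutations"
    "Jordan_Normal_Form.Matrix"
    "Jordan_Normal_Form.Gauss_Jordan_Elimination"
    "Jordan_Normal_Form.DL_Submatrix"
begin

section \<open>Unital C*-algebras\<close>

record 'a cstar = "(complex, 'a) module" +
  adj :: "'a \<Rightarrow> 'a"
  cnorm :: "'a \<Rightarrow> real"

text \<open>The zero algebra is not excluded. In every other case the norm of the unit is 1, by the
  C*-identity.\<close>

locale cstar_algebra = ring A + module "ring_of_type_algebra :: complex ring" A
  for A :: "'a cstar" (structure) +
  assumes smult_mult_left:
      "\<lbrakk>x \<in> carrier A; y \<in> carrier A\<rbrakk> \<Longrightarrow> (c \<odot> x) \<otimes> y = c \<odot> (x \<otimes> y)"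
    and smult_mult_right:
      "\<lbrakk>x \<in> carrier A; y \<in> carrier A\<rbrakk> \<Longrightarrow> x \<otimes> (c \<odot> y) = c \<odot> (x \<otimes> y)"
    and adj_closed: "x \<in> carrier A \<Longrightarrow> adj A x \<in> carrier A"
    and adj_adj: "x \<in> carrier A \<Longrightarrow> adj A (adj A x) = x"
    and adj_add:
      "\<lbrakk>x \<in> carrier A; y \<in> carrier A\<rbrakk> \<Longrightarrow> adj A (x \<oplus> y) = adj A x \<oplus> adj A y"
    and adj_smult: "x \<in> carrier A \<Longrightarrow> adj A (c \<odot> x) = cnj c \<odot> adj A x"
    and adj_mult:
      "\<lbrakk>x \<in> carrier A; y \<in> carrier A\<rbrakk> \<Longrightarrow> adj A (x \<otimes> y) = adj A y \<otimes> adj A x"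
    and cnorm_nonneg: "x \<in> carrier A \<Longrightarrow> 0 \<le> cnorm A x"
    and cnorm_eq_0: "x \<in> carrier A \<Longrightarrow> cnorm A x = 0 \<longleftrightarrow> x = \<zero>"
    and cnorm_triangle:
      "\<lbrakk>x \<in> carrier A; y \<in> carrier A\<rbrakk> \<Longrightarrow> cnorm A (x \<oplus> y) \<le> cnorm A x + cnorm A y"
    and cnorm_smult: "x \<in> carrier A \<Longrightarrow> cnorm A (c \<odot> x) = cmod c * cnorm A x"
    and cnorm_mult:
      "\<lbrakk>x \<in> carrier A; y \<in> carrier A\<rbrakk> \<Longrightarrow> cnorm A (x \<otimes> y) \<le> cnorm A x * cnorm A y"
    and cstar_identity: "x \<in> carrier A \<Longrightarrow> cnorm A (adj A x \<otimes> x) = (cnorm A x)\<^sup>2"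
    and complete:
      "\<lbrakk>\<And>i::nat. f i \<in> carrier A;
        \<And>e. e > 0 \<Longrightarrow> \<exists>N. \<forall>i\<ge>N. \<forall>j\<ge>N. cnorm A (f i \<ominus> f j) < e\<rbrakk>
       \<Longrightarrow> \<exists>x\<in>carrier A. (\<lambda>i. cnorm A (f i \<ominus> x)) \<longlonglongrightarrow> 0"

definition unitary :: "'a cstar \<Rightarrow> 'a \<Rightarrow> bool" where
  "unitary A x \<longleftrightarrow>
     x \<in> carrier A \<and> adj A x \<otimes>\<^bsub>A\<^esub> x = \<one>\<^bsub>A\<^esub> \<and> x \<otimes>\<^bsub>A\<^esub> adj A x = \<one>\<^bsub>A\<^esub>"

definition projection :: "'a cstar \<Rightarrow> 'a \<Rightarrow> bool" where
  "projection A p \<longleftrightarrow> p \<in> carrier A \<and> adj A p = p \<and> p \<otimes>\<^bsub>A\<^esub> p = p"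

text \<open>Elements of \<^const>\<open>Ring.ring_hom\<close> preserve the unit.\<close>

definition star_hom :: "'a cstar \<Rightarrow> 'b cstar \<Rightarrow> ('a \<Rightarrow> 'b) set" where
  "star_hom A B = {\<phi> \<in> Ring.ring_hom A B.
     (\<forall>c. \<forall>x\<in>carrier A. \<phi> (c \<odot>\<^bsub>A\<^esub> x) = c \<odot>\<^bsub>B\<^esub> \<phi> x) \<and>
     (\<forall>x\<in>carrier A. \<phi> (adj A x) = adj B (\<phi> x))}"

definition cstar_subalgebra :: "'a cstar \<Rightarrow> 'a set \<Rightarrow> bool" where
  "cstar_subalgebra A S \<longleftrightarrow>
     S \<subseteq> carrier A \<and> \<one>\<^bsub>A\<^esub> \<in> S \<and>
     (\<forall>x\<in>S. \<forall>y\<in>S. x \<oplus>\<^bsub>A\<^esub> y \<in> S \<and> x \<otimes>\<^bsub>A\<^esub> y \<in> S) \<and>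
     (\<forall>c. \<forall>x\<in>S. c \<odot>\<^bsub>A\<^esub> x \<in> S) \<and>
     (\<forall>x\<in>S. adj A x \<in> S) \<and>
     (\<forall>f. \<forall>x\<in>carrier A. (\<forall>i::nat. f i \<in> S) \<and> (\<lambda>i. cnorm A (f i \<ominus>\<^bsub>A\<^esub> x)) \<longlonglongrightarrow> 0 \<longrightarrow> x \<in> S)"

definition cstar_generated_by :: "'a cstar \<Rightarrow> 'a set \<Rightarrow> bool" where
  "cstar_generated_by A G \<longleftrightarrow> (\<forall>S. cstar_subalgebra A S \<and> G \<subseteq> S \<longrightarrow> S = carrier A)"

text \<open>\<open>\<tau> (x* x)\<close> is required to be a nonnegative real number.\<close>

definition tracial_state :: "'a cstar \<Rightarrow> ('a \<Rightarrow> complex) \<Rightarrow> bool" where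
  "tracial_state A \<tau> \<longleftrightarrow>
     (\<forall>x\<in>carrier A. \<forall>y\<in>carrier A. \<tau> (x \<oplus>\<^bsub>A\<^esub> y) = \<tau> x + \<tau> y) \<and>
     (\<forall>c. \<forall>x\<in>carrier A. \<tau> (c \<odot>\<^bsub>A\<^esub> x) = c * \<tau> x) \<and>
     (\<forall>x\<in>carrier A. Im (\<tau> (adj A x \<otimes>\<^bsub>A\<^esub> x)) = 0 \<and> 0 \<le> Re (\<tau> (adj A x \<otimes>\<^bsub>A\<^esub> x))) \<and>
     \<tau> \<one>\<^bsub>A\<^esub> = 1 \<and>
     (\<forall>x\<in>carrier A. \<forall>y\<in>carrier A. \<tau> (x \<otimes>\<^bsub>A\<^esub> y) = \<tau> (y \<otimes>\<^bsub>A\<^esub> x))"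


section \<open>Noncommutative tori\<close>

text \<open>All indices are shifted down by one: rows and columns of \<open>\<Theta>\<close>, and the unitary generators,
  are numbered \<open>0, \<dots>, n - 1\<close>.\<close>

definition nc_torus_relations :: "nat \<Rightarrow> real mat \<Rightarrow> 'a cstar \<Rightarrow> (nat \<Rightarrow> 'a) \<Rightarrow> bool" where
  "nc_torus_relations n \<Theta> A u \<longleftrightarrow>
     (\<forall>j<n. unitary A (u j)) \<and>
     (\<forall>j<n. \<forall>k<n. u k \<otimes>\<^bsub>A\<^esub> u j =
        exp (2 * complex_of_real pi * \<i> * complex_of_real (\<Theta> $$ (j, k)))
          \<odot>\<^bsub>A\<^esub> (u j \<otimes>\<^bsub>A\<^esub> u k))"

text \<open>The universal property is tested on C*-algebras whose carrier is a subset of the type \<open>'a\<close>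
  that also hosts \<open>A\<close>. This loses nothing: a C*-algebra generated by finitely many elements has at
  most the cardinality of the continuum, while \<open>'a\<close> has at least that cardinality as soon as \<open>A\<close>
  is nonzero, so the algebra generated by any unitaries satisfying the relations, on whatever type,
  has an isomorphic copy inside \<open>'a\<close>. The homomorphism is unique on the carrier
  because \<open>A\<close> is generated by the \<open>u j\<close>.\<close>

definition universal_nc_torus :: "nat \<Rightarrow> real mat \<Rightarrow> 'a cstar \<Rightarrow> (nat \<Rightarrow> 'a) \<Rightarrow> bool" where
  "universal_nc_torus n \<Theta> A u \<longleftrightarrow>
     cstar_algebra A \<and> nc_torus_relations n \<Theta> A u \<and> cstar_generated_by A (u ` {..<n}) \<and>
     (\<forall>(B :: 'a cstar) v. cstar_algebra B \<and> nc_torus_relations n \<Theta> B v \<longrightarrow>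
        (\<exists>\<phi>\<in>star_hom A B. \<forall>j<n. \<phi> (u j) = v j))"

text \<open>\<open>nc_monomial n A u k\<close> is the ordered product of the \<open>u j\<close> raised to the (possibly negative)
  power \<open>k j\<close>.\<close>

definition nc_monomial :: "nat \<Rightarrow> 'a cstar \<Rightarrow> (nat \<Rightarrow> 'a) \<Rightarrow> (nat \<Rightarrow> int) \<Rightarrow> 'a" where
  "nc_monomial n A u k = foldr (\<lambda>j x. (u j [^]\<^bsub>A\<^esub> k j) \<otimes>\<^bsub>A\<^esub> x) [0..<n] \<one>\<^bsub>A\<^esub>"

definition canonical_trace :: "nat \<Rightarrow> 'a cstar \<Rightarrow> (nat \<Rightarrow> 'a) \<Rightarrow> ('a \<Rightarrow> complex) \<Rightarrow> bool" where
  "canonical_trace n A u \<tau> \<longleftrightarrow>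
     tracial_state A \<tau> \<and>
     (\<forall>k. (\<exists>j<n. k j \<noteq> 0) \<longrightarrow> \<tau> (nc_monomial n A u k) = 0)"


section \<open>Pfaffians and the reduction map\<close>

definition pf :: "real mat \<Rightarrow> real" where
  "pf B = (let m = dim_row B div 2 in
     (\<Sum>p | p permutes {..<2 * m}.
        real_of_int (sign p) * (\<Prod>i<m. B $$ (p (2 * i), p (2 * i + 1)))) / (2 ^ m * fact m))"

text \<open>\<open>F\<close> is only meaningful if the upper left block is invertible; otherwise \<^const>\<open>mat_inverse\<close>
  yields \<^const>\<open>None\<close> and \<open>F B\<close> is unspecified. A skew-symmetric 2 x 2 block is
  invertible if and only if its pfaffian is nonzero.\<close>

definition F :: "real mat \<Rightarrow> real mat" where
  "F B = (case split_block B 2 2 of (B11, B12, B21, B22) \<Rightarrow>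
     B22 - B21 * the (mat_inverse B11) * B12)"

definition upper_left_block :: "real mat \<Rightarrow> real mat" where
  "upper_left_block B = fst (split_block B 2 2)"

text \<open>A multi-index is its strictly increasing list of entries, so \<open>take s I\<close> is the initial segment of
  length \<open>s\<close>.\<close>

definition even_multi_indices :: "nat \<Rightarrow> nat list set" where
  "even_multi_indices n = {I. sorted_wrt (<) I \<and> set I \<subseteq> {..<n} \<and> even (length I) \<and>
     2 \<le> length I \<and> length I \<le> 2 * (n div 2)}"

definition index_submatrix :: "real mat \<Rightarrow> nat list \<Rightarrow> real mat" where
  "index_submatrix \<Theta> I = submatrix \<Theta> (set I) (set I)"

end

theory Submission
  imports Defs "HOL-Analysis.Analysis"
begin

text \<open>The projections come from Rieffel's construction, applied inductively. Let \<open>\<theta>\<close> be the (0,1) entry of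
  the matrix, with \<open>0 < \<theta> < 1\<close>. The first two unitaries \<open>u\<close>, \<open>v\<close> act on functions on the line by
  multiplication by \<open>ex x\<close> and translation by \<open>\<theta>\<close>; in this picture a function \<open>\<eta>\<close> supported in the
  unit interval whose squared \<open>\<theta>\<close>-translates sum to 1 gives a projection \<open>e = \<eta> \<otimes> \<eta>*\<close> of trace \<open>\<theta>\<close>.
  Every other generator acts on the line by a translation and a modulation; comparing \<open>\<eta>\<close> with its
  image turns the generator into a unitary of the corner of \<open>e\<close>. The curvature of these operators
  corrects the commutation phases, and the new unitaries satisfy the relations of \<open>F \<Theta>\<close>, with
  vanishing normalized trace on nontrivial monomials. Iterating down to a 2 x 2 matrix with non-integral
  entry \<open>t\<close>, where the Rieffel projection has trace \<open>frac t\<close>, yields the trace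
  \<open>\<theta>\<^sub>0 \<theta>\<^sub>1 \<dots> frac t\<close>, and \<open>pf B = pf B\<^sub>1\<^sub>1 * pf (F B)\<close> rewrites this product.\<close>

section \<open>C*-algebras and unitaries\<close>

text \<open>The line serves only to find the formulas; every identity is verified inside
  \<open>A\<close>, through functional calculus of \<open>u\<close> and powers of \<open>v\<close>.
  Let W be the line operator with the same commutation phases against \<open>u\<close> and
  \<open>v\<close> as a further generator U. The \<open>A\<close>-valued inner product of \<eta>
  with W \<eta>, times U, lies in the corner of \<open>e\<close>. Such elements multiply up to the
  phases \<open>ex (a * b' / \<theta>)\<close>, which measure how W and W' fail to compose exactly;
  comparing the two orders leaves \<open>(a * b' - a' * b) / \<theta>\<close>, the correction term
  of the Schur complement.

  This term depends on the real number \<theta>, not on its class modulo integers, and the trace of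
  \<open>e\<close> is \<theta> for \<theta> between 0 and 1: hence the strict bounds on all pivots
  but the last. After the last pivot nothing is transported, so there an integer may be split off,
  and it becomes the integer coefficient in the trace formula.

  The corner is not presented as a noncommutative torus again. The induction therefore carries only
  what passes to corners: the commutation relations and the vanishing of the trace on words of
  nonzero degree.\<close>

context cstar_algebra
begin

text \<open>The scalar ring of \<^locale>\<open>module\<close> brings its own copies of the ring laws into scope, under the
  same unqualified names.\<close>

lemma ring_A: "ring A" and monoid_A: "monoid A" and semiring_A: "semiring A"
  and abelian_group_A: "abelian_group A" and abelian_monoid_A: "abelian_monoid A"
  by unfold_locales

lemmas m_assoc = monoid.m_assoc[OF monoid_A]
  and l_distr = semiring.l_distr[OF semiring_A]
  and r_distr = semiring.r_distr[OF semiring_A]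
  and a_assoc = abelian_monoid.a_assoc[OF abelian_monoid_A]
  and a_comm = abelian_monoid.a_comm[OF abelian_monoid_A]
  and a_lcomm = abelian_monoid.a_lcomm[OF abelian_monoid_A]
  and minus_equality = abelian_group.minus_equality[OF abelian_group_A]
  and finsum_addf = abelian_monoid.finsum_addf[OF abelian_monoid_A]
  and finsum_closed = abelian_monoid.finsum_closed[OF abelian_monoid_A]
  and finsum_cong' = abelian_monoid.finsum_cong'[OF abelian_monoid_A]
  and finsum_reindex = abelian_monoid.finsum_reindex[OF abelian_monoid_A]
  and finsum_Un_disjoint = abelian_monoid.finsum_Un_disjoint[OF abelian_monoid_A]
  and finsum_zero = abelian_monoid.finsum_zero[OF abelian_monoid_A]
  and finsum_insert = abelian_monoid.finsum_insert[OF abelian_monoid_A]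
  and finsum_singleton = abelian_monoid.finsum_singleton[OF abelian_monoid_A]
  and finsum_ldistr = semiring.finsum_ldistr[OF semiring_A]
  and finsum_rdistr = semiring.finsum_rdistr[OF semiring_A]

lemma smult_carrier [simp, intro]: "x \<in> carrier A \<Longrightarrow> c \<odot> x \<in> carrier A"
  using smult_closed[of c x] by (simp add: ring_of_type_algebra_def)

lemma smult_add_left: "x \<in> carrier A \<Longrightarrow> (c + d) \<odot> x = c \<odot> x \<oplus> d \<odot> x"
  using smult_l_distr[of c d x] by (simp add: ring_of_type_algebra_def)

lemma smult_add_right:
  "\<lbrakk>x \<in> carrier A; y \<in> carrier A\<rbrakk> \<Longrightarrow> c \<odot> (x \<oplus> y) = c \<odot> x \<oplus> c \<odot> y"
  using smult_r_distr[of c x y] by (simp add: ring_of_type_algebra_def)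

lemma smult_smult [simp]: "x \<in> carrier A \<Longrightarrow> c \<odot> (d \<odot> x) = (c * d) \<odot> x"
  using smult_assoc1[of c d x] by (simp add: ring_of_type_algebra_def)

lemma smult_1 [simp]: "x \<in> carrier A \<Longrightarrow> 1 \<odot> x = x"
  using smult_one[of x] by (simp add: ring_of_type_algebra_def)

lemma smult_0 [simp]: "x \<in> carrier A \<Longrightarrow> 0 \<odot> x = \<zero>"
  using smult_add_left[of x 0 0] by simp

lemma smult_zero [simp]: "c \<odot> \<zero> = \<zero>"
  using smult_add_right[of \<zero> \<zero> c] by simp

lemma minus_eq_smult: "x \<in> carrier A \<Longrightarrow> \<ominus> x = (-1) \<odot> x"
  using smult_add_left[of x "-1" 1] by (intro minus_equality) simp_all

lemma diff_eq_smult: "\<lbrakk>x \<in> carrier A; y \<in> carrier A\<rbrakk> \<Longrightarrow> x \<ominus> y = x \<oplus> (-1) \<odot> y"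
  by (simp add: a_minus_def minus_eq_smult)

lemmas smult_mult = smult_mult_left smult_mult_right

declare adj_closed [simp, intro] adj_adj [simp]

lemma adj_zero [simp]: "adj A \<zero> = \<zero>"
  using adj_smult[of \<zero> 0] by simp

lemma adj_one [simp]: "adj A \<one> = \<one>"
  using adj_mult[of "adj A \<one>" \<one>] by simp

lemma cnorm_zero [simp]: "cnorm A \<zero> = 0"
  by (simp add: cnorm_eq_0)

lemma cnorm_adj [simp]:
  assumes x: "x \<in> carrier A"
  shows "cnorm A (adj A x) = cnorm A x"
proof -
  have le: "cnorm A y \<le> cnorm A (adj A y)" if y: "y \<in> carrier A" for y
  proof (cases "cnorm A y = 0")
    case False
    then have pos: "cnorm A y > 0" using cnorm_nonneg[OF y] by simp
    have "cnorm A y * cnorm A y \<le> cnorm A (adj A y) * cnorm A y"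
      using cstar_identity[OF y] cnorm_mult[of "adj A y" y] y by (simp add: power2_eq_square)
    then show ?thesis using pos by simp
  qed (use y cnorm_nonneg[of "adj A y"] in simp)
  from le[OF x] le[of "adj A x"] x show ?thesis by simp
qed

lemma cnorm_one_le: "cnorm A \<one> \<le> 1"
proof -
  have "(cnorm A \<one>)\<^sup>2 = cnorm A \<one>" using cstar_identity[of \<one>] by simp
  then have "cnorm A \<one> = 0 \<or> cnorm A \<one> = 1" by (auto simp: power2_eq_square)
  then show ?thesis by auto
qed

lemma cnorm_diff_commute:
  assumes "x \<in> carrier A" "y \<in> carrier A"
  shows "cnorm A (x \<ominus> y) = cnorm A (y \<ominus> x)"
proof -
  have "(-1) \<odot> (x \<ominus> y) = y \<ominus> x"
    using assms by (simp add: diff_eq_smult smult_add_right a_comm[of y])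
  then show ?thesis using cnorm_smult[of "x \<ominus> y" "-1"] assms by simp
qed

lemma diff_add_diff:
  assumes "x \<in> carrier A" "y \<in> carrier A" "z \<in> carrier A"
  shows "(x \<ominus> y) \<oplus> (y \<ominus> z) = x \<ominus> z"
proof -
  have "(-1) \<odot> y \<oplus> (y \<oplus> (-1) \<odot> z) = ((-1) \<odot> y \<oplus> 1 \<odot> y) \<oplus> (-1) \<odot> z"
    using assms by (simp add: a_assoc)
  also have "\<dots> = (-1) \<odot> z"
    using assms smult_add_left[of y "-1" 1] by simp
  finally show ?thesis using assms by (simp add: diff_eq_smult a_assoc)
qed

lemma cnorm_diff_triangle:
  assumes "x \<in> carrier A" "y \<in> carrier A" "z \<in> carrier A"
  shows "cnorm A (x \<ominus> z) \<le> cnorm A (x \<ominus> y) + cnorm A (y \<ominus> z)"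
  using cnorm_triangle[of "x \<ominus> y" "y \<ominus> z"] assms by (simp add: diff_add_diff)

lemma cnorm_eq_diff:
  "\<lbrakk>x \<in> carrier A; y \<in> carrier A\<rbrakk> \<Longrightarrow> cnorm A (x \<ominus> y) = 0 \<longleftrightarrow> x = y"
  by (simp add: cnorm_eq_0)

lemma smult_finsum:
  assumes "finite S" "f \<in> S \<rightarrow> carrier A"
  shows "c \<odot> (\<Oplus>i\<in>S. f i) = (\<Oplus>i\<in>S. c \<odot> f i)"
  using assms
proof (induction S rule: finite_induct)
  case (insert i S)
  then have "f \<in> S \<rightarrow> carrier A" "f i \<in> carrier A" by auto
  moreover have "(\<lambda>i. c \<odot> f i) \<in> S \<rightarrow> carrier A" using insert by auto
  ultimately show ?case using insert by (simp add: smult_add_right)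
qed simp

lemma adj_finsum:
  assumes "finite S" "f \<in> S \<rightarrow> carrier A"
  shows "adj A (\<Oplus>i\<in>S. f i) = (\<Oplus>i\<in>S. adj A (f i))"
  using assms
proof (induction S rule: finite_induct)
  case (insert i S)
  then have "f \<in> S \<rightarrow> carrier A" "f i \<in> carrier A" by auto
  moreover have "(\<lambda>i. adj A (f i)) \<in> S \<rightarrow> carrier A" using insert by auto
  ultimately show ?case using insert by (simp add: adj_add)
qed simp

lemma cnorm_finsum_le:
  assumes "finite S" "f \<in> S \<rightarrow> carrier A"
  shows "cnorm A (\<Oplus>i\<in>S. f i) \<le> (\<Sum>i\<in>S. cnorm A (f i))"
  using assms
proof (induction S rule: finite_induct)
  case (insert i S)
  then have f: "f \<in> S \<rightarrow> carrier A" "f i \<in> carrier A" by auto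
  then have "cnorm A (f i \<oplus> finsum A f S) \<le> cnorm A (f i) + (\<Sum>i\<in>S. cnorm A (f i))"
    using insert.IH[OF f(1)] cnorm_triangle[of "f i" "finsum A f S"] by simp
  then show ?case using insert f by simp
qed simp

lemma unitary_carrier [simp]: "unitary A u \<Longrightarrow> u \<in> carrier A"
  and unitary_adj_mult [simp]: "unitary A u \<Longrightarrow> adj A u \<otimes> u = \<one>"
  and unitary_mult_adj [simp]: "unitary A u \<Longrightarrow> u \<otimes> adj A u = \<one>"
  unfolding unitary_def by blast+

lemma unitaryI:
  "\<lbrakk>u \<in> carrier A; adj A u \<otimes> u = \<one>; u \<otimes> adj A u = \<one>\<rbrakk> \<Longrightarrow> unitary A u"
  unfolding unitary_def by blast

lemma unitary_one [simp]: "unitary A \<one>"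
  by (rule unitaryI) simp_all

lemma unitary_adj [simp]: "unitary A u \<Longrightarrow> unitary A (adj A u)"
  by (rule unitaryI) simp_all

lemma unitary_adj_mult_cancel [simp]:
  "\<lbrakk>unitary A u; x \<in> carrier A\<rbrakk> \<Longrightarrow> adj A u \<otimes> (u \<otimes> x) = x"
  by (subst m_assoc[symmetric]) simp_all

lemma unitary_mult_adj_cancel [simp]:
  "\<lbrakk>unitary A u; x \<in> carrier A\<rbrakk> \<Longrightarrow> u \<otimes> (adj A u \<otimes> x) = x"
  by (subst m_assoc[symmetric]) simp_all

lemma unitary_mult:
  assumes "unitary A u" "unitary A v"
  shows "unitary A (u \<otimes> v)"
  using assms by (intro unitaryI) (simp_all add: adj_mult m_assoc)

lemma cnorm_unitary_le:
  assumes "unitary A u"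
  shows "cnorm A u \<le> 1"
proof -
  have "(cnorm A u)\<^sup>2 \<le> 1" using cstar_identity[of u] assms cnorm_one_le by simp
  then show ?thesis using cnorm_nonneg[of u] assms
    by (simp add: abs_square_le_1)
qed

lemma cnorm_mult_le:
  "\<lbrakk>x \<in> carrier A; y \<in> carrier A; cnorm A x \<le> a; cnorm A y \<le> b\<rbrakk> \<Longrightarrow> cnorm A (x \<otimes> y) \<le> a * b"
  by (meson cnorm_mult cnorm_nonneg mult_mono order_trans)

end

section \<open>The character of the circle and integer powers of a unitary\<close>

definition ex :: "real \<Rightarrow> complex" where
  "ex t = cis (2 * pi * t)"

lemma ex_add: "ex (s + t) = ex s * ex t"
  by (simp add: ex_def cis_mult distrib_left)

lemma ex_0 [simp]: "ex 0 = 1"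
  by (simp add: ex_def)

lemma ex_minus: "ex (- t) = cnj (ex t)"
  by (simp add: ex_def cis_cnj)

lemma norm_ex [simp]: "cmod (ex t) = 1"
  by (simp add: ex_def)

lemma ex_nonzero [simp]: "ex t \<noteq> 0"
  using norm_ex[of t] by (metis norm_zero zero_neq_one)

lemma ex_mult_cnj [simp]: "ex t * cnj (ex t) = 1" "cnj (ex t) * ex t = 1"
  using ex_add[of t "-t"] ex_add[of "-t" t] by (simp_all add: ex_minus)

lemma ex_of_int [simp]: "ex (of_int k) = 1"
  by (simp add: ex_def cis_multiple_2pi)

lemma ex_add_int [simp]: "ex (t + of_int k) = ex t"
  by (simp add: ex_add)

lemma continuous_on_ex [continuous_intros]:
  "continuous_on S f \<Longrightarrow> continuous_on S (\<lambda>x. ex (f x))"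
  unfolding ex_def by (intro continuous_intros)

text \<open>Negative exponents are powers of the adjoint, so the power laws follow from unitarity
  alone; \<open>int_pow_eq_upow\<close> later matches this with the group power in
  \<open>nc_monomial\<close>.\<close>

definition upow :: "'a cstar \<Rightarrow> 'a \<Rightarrow> int \<Rightarrow> 'a" where
  "upow A u k = (if 0 \<le> k then u [^]\<^bsub>A\<^esub> nat k else adj A u [^]\<^bsub>A\<^esub> nat (- k))"

context cstar_algebra
begin

lemma unitary_pow: "unitary A u \<Longrightarrow> unitary A (u [^] (n::nat))"
  by (induction n) (auto simp: unitary_mult)

lemma unitary_upow [simp]: "unitary A u \<Longrightarrow> unitary A (upow A u k)"
  by (simp add: upow_def unitary_pow del: pow_nat)

lemma upow_carrier [simp]: "unitary A u \<Longrightarrow> upow A u k \<in> carrier A"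
  by simp

lemma upow_0 [simp]: "upow A u 0 = \<one>"
  by (simp add: upow_def)

lemma upow_1 [simp]: "unitary A u \<Longrightarrow> upow A u 1 = u"
  by (simp add: upow_def)

lemma upow_add_1:
  assumes u: "unitary A u"
  shows "upow A u (k + 1) = upow A u k \<otimes> u"
proof (cases "k \<ge> 0")
  case True
  then have "nat (k + 1) = Suc (nat k)" by simp
  then show ?thesis using True by (simp add: upow_def)
next
  case False
  define n where "n = nat (- (k + 1))"
  have k: "nat (- k) = Suc n" using False by (simp add: n_def)
  have "upow A u k \<otimes> u = adj A u [^] n"
    using False u unitary_pow[of "adj A u" n] by (simp add: upow_def k m_assoc)
  also have "\<dots> = upow A u (k + 1)"
    using False by (cases "k = -1") (auto simp: upow_def n_def)
  finally show ?thesis by simp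
qed

lemma upow_diff_1:
  assumes u: "unitary A u"
  shows "upow A u (k - 1) = upow A u k \<otimes> adj A u"
  using upow_add_1[OF u, of "k - 1"] u by (simp add: m_assoc)

lemma upow_add:
  assumes u: "unitary A u"
  shows "upow A u (j + k) = upow A u j \<otimes> upow A u k"
proof (induction k rule: int_induct[where k = 0])
  case base
  then show ?case using u by simp
next
  case (step1 i)
  then show ?case using u upow_add_1[OF u, of "j + i"] upow_add_1[OF u, of i]
    by (simp add: m_assoc add.assoc)
next
  case (step2 i)
  then show ?case using u upow_diff_1[OF u, of "j + i"] upow_diff_1[OF u, of i]
    by (simp add: m_assoc add_diff_eq)
qed

lemma adj_pow: "x \<in> carrier A \<Longrightarrow> adj A (x [^] (n::nat)) = adj A x [^] n"
proof (induction n)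
  case (Suc n)
  have "adj A (x [^] Suc n) = adj A x \<otimes> adj A x [^] n" using Suc by (simp add: adj_mult)
  then show ?case using Suc monoid.nat_pow_Suc2[OF monoid_A, of "adj A x" n] by simp
qed simp

lemma adj_upow:
  assumes u: "unitary A u"
  shows "adj A (upow A u k) = upow A u (- k)"
  using u by (auto simp: upow_def adj_pow simp del: pow_nat)

lemma upow_commute:
  assumes u: "unitary A u" and v: "v \<in> carrier A" and comm: "v \<otimes> u = ex a \<odot> (u \<otimes> v)"
  shows "v \<otimes> upow A u k = ex (of_int k * a) \<odot> (upow A u k \<otimes> v)"
proof -
  \<comment> \<open>Multiplying the relation by \<open>adj A u\<close> on both sides exchanges the
    roles of its two terms and so inverts the phase.\<close>
  have comm': "v \<otimes> adj A u = ex (- a) \<odot> (adj A u \<otimes> v)"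
  proof -
    have "adj A u \<otimes> (v \<otimes> u) \<otimes> adj A u = ex a \<odot> (v \<otimes> adj A u)"
      using u v by (simp add: comm smult_mult m_assoc)
    also have "adj A u \<otimes> (v \<otimes> u) \<otimes> adj A u = adj A u \<otimes> v"
      using u v by (simp add: m_assoc)
    finally have "ex (- a) \<odot> (adj A u \<otimes> v) = ex (- a) \<odot> (ex a \<odot> (v \<otimes> adj A u))" by simp
    then show ?thesis using u v by (simp add: ex_minus)
  qed
  have V: "v \<otimes> (x \<otimes> y) = (a' * b') \<odot> ((x \<otimes> y) \<otimes> v)" if
    "v \<otimes> x = a' \<odot> (x \<otimes> v)" "v \<otimes> y = b' \<odot> (y \<otimes> v)" "x \<in> carrier A" "y \<in> carrier A"
    for x y a' b'
  proof -
    have "v \<otimes> (x \<otimes> y) = (v \<otimes> x) \<otimes> y" using that(3,4) v by (simp add: m_assoc)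
    also have "\<dots> = a' \<odot> (x \<otimes> (v \<otimes> y))"
      using that(3,4) v by (simp add: that(1) smult_mult m_assoc)
    also have "\<dots> = (a' * b') \<odot> ((x \<otimes> y) \<otimes> v)"
      using that(3,4) v by (simp add: that(2) smult_mult m_assoc)
    finally show ?thesis .
  qed
  show ?thesis
  proof (induction k rule: int_induct[where k = 0])
    case base
    then show ?case using v by simp
  next
    case (step1 i)
    have "ex (of_int i * a) * ex a = ex (of_int (i + 1) * a)"
      by (simp add: ex_add[symmetric] distrib_right)
    then show ?case using V[OF step1(2) comm] u by (simp add: upow_add_1)
  next
    case (step2 i)
    have "ex (of_int i * a) * ex (- a) = ex (of_int (i - 1) * a)"
      by (simp add: ex_add[symmetric] left_diff_distrib)
    then show ?case using V[OF step2(2) comm'] u by (simp add: upow_diff_1)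
  qed
qed

end

section \<open>Functional calculus for unitaries\<close>

text \<open>\<open>tp A u d f a\<close>: \<open>f\<close> is a trigonometric polynomial of degree at most \<open>d\<close> and \<open>a\<close> is its value at \<open>u\<close>.\<close>

inductive tp :: "'a cstar \<Rightarrow> 'a \<Rightarrow> int \<Rightarrow> (real \<Rightarrow> complex) \<Rightarrow> 'a \<Rightarrow> bool" for A u d where
  tp_mono: "\<bar>k\<bar> \<le> d \<Longrightarrow> tp A u d (\<lambda>x. c * ex (of_int k * x)) (c \<odot>\<^bsub>A\<^esub> upow A u k)"
| tp_add: "tp A u d f a \<Longrightarrow> tp A u d g b \<Longrightarrow> tp A u d (\<lambda>x. f x + g x) (a \<oplus>\<^bsub>A\<^esub> b)"

lemma tp_continuous: "tp A u d f a \<Longrightarrow> continuous_on S f"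
  by (induction rule: tp.induct) (auto intro!: continuous_intros)

lemma tp_mono_degree: "tp A u d f a \<Longrightarrow> d \<le> d' \<Longrightarrow> tp A u d' f a"
  by (induction rule: tp.induct) (auto intro: tp.intros)

lemma has_integral_ex:
  "((\<lambda>x. ex (of_int k * x)) has_integral (if k = 0 then 1 else 0)) {0..1}"
proof (cases "k = 0")
  case True
  then show ?thesis using has_integral_const_real[of "1::complex" 0 1] by simp
next
  case False
  define c where "c = 2 * pi * \<i> * of_int k"
  have c: "c \<noteq> 0" using False by (simp add: c_def)
  have ex: "ex (of_int k * x) = exp (c * of_real x)" for x
    by (simp add: ex_def cis_conv_exp c_def mult_ac)
  have "((\<lambda>x. exp (c * of_real x) / c) has_vector_derivative exp (c * of_real x)) (at x within {0..1})"
    for x :: real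
    using c by (auto intro!: derivative_eq_intros has_vector_derivative_real_field)
  then have "((\<lambda>x. exp (c * of_real x)) has_integral
      (exp (c * of_real 1) / c - exp (c * of_real 0) / c)) {0..1}"
    by (intro fundamental_theorem_of_calculus) auto
  moreover have "exp (c * of_real 1) = 1"
    using ex[of 1] ex_of_int[of k] by simp
  ultimately show ?thesis using False by (simp add: ex)
qed

definition fcoeff :: "(real \<Rightarrow> complex) \<Rightarrow> int \<Rightarrow> complex" where
  "fcoeff f k = integral {0..1} (\<lambda>x. f x * ex (- (of_int k * x)))"

lemma fcoeff_mono: "fcoeff (\<lambda>x. c * ex (of_int j * x)) k = (if j = k then c else 0)"
proof -
  have "((\<lambda>x. c * ex (of_int (j - k) * x)) has_integral (c * (if j - k = 0 then 1 else 0))) {0..1}"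
    by (intro has_integral_mult_right has_integral_ex)
  moreover have "(\<lambda>x. c * ex (of_int (j - k) * x)) = (\<lambda>x. c * ex (of_int j * x) * ex (- (of_int k * x)))"
    by (simp add: ex_add[symmetric] mult.assoc left_diff_distrib)
  ultimately have "((\<lambda>x. c * ex (of_int j * x) * ex (- (of_int k * x))) has_integral (if j = k then c else 0)) {0..1}"
    by (auto split: if_splits)
  then show ?thesis unfolding fcoeff_def by (rule integral_unique)
qed

lemma fcoeff_add:
  assumes "continuous_on {0..1} f" "continuous_on {0..1} g"
  shows "fcoeff (\<lambda>x. f x + g x) k = fcoeff f k + fcoeff g k"
proof -
  have "(\<lambda>x. h x * ex (- (of_int k * x))) integrable_on {0..1}" if "continuous_on {0..1} h" for h
    by (intro integrable_continuous_real continuous_intros that)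
  from this[OF assms(1)] this[OF assms(2)] show ?thesis
    unfolding fcoeff_def distrib_right by (rule integral_add)
qed

lemma fcoeff_bound:
  assumes "continuous_on {0..1} f" "\<And>x. cmod (f x) \<le> M"
  shows "cmod (fcoeff f k) \<le> M"
proof -
  have "cmod (fcoeff f k) \<le> M * (1 - 0)"
    unfolding fcoeff_def using assms
    by (intro integral_bound continuous_intros) (auto simp: norm_mult)
  then show ?thesis by simp
qed

context cstar_algebra
begin

lemma finsum_eq_single:
  assumes "finite S" "i \<in> S" "x \<in> carrier A"
  shows "(\<Oplus>k\<in>S. if k = i then x else \<zero>) = x"
proof -
  have "(\<Oplus>k\<in>S. if i = k then x else \<zero>) = x"
    using assms finsum_singleton[of i S "\<lambda>_. x"] by auto
  then show ?thesis by (simp add: eq_commute[of i])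
qed

context
  fixes u assumes u: "unitary A u"
begin

lemma tp_carrier: "tp A u d f a \<Longrightarrow> a \<in> carrier A"
  by (induction rule: tp.induct) (use u in auto)

lemma tp_mult:
  assumes "tp A u d f a" "tp A u d' g b"
  shows "tp A u (d + d') (\<lambda>x. f x * g x) (a \<otimes> b)"
  using assms
proof (induction rule: tp.induct)
  case (tp_mono k c)
  from tp_mono.prems show ?case
  proof (induction rule: tp.induct)
    case (tp_mono k' c')
    have "tp A u (d + d') (\<lambda>x. (c * c') * ex (of_int (k + k') * x)) ((c * c') \<odot> upow A u (k + k'))"
      using \<open>\<bar>k\<bar> \<le> d\<close> tp_mono by (intro tp.tp_mono) auto
    also have "(\<lambda>x. (c * c') * ex (of_int (k + k') * x))
        = (\<lambda>x. c * ex (of_int k * x) * (c' * ex (of_int k' * x)))"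
      by (simp add: ex_add distrib_right mult.assoc mult.left_commute)
    also have "(c * c') \<odot> upow A u (k + k') = (c \<odot> upow A u k) \<otimes> (c' \<odot> upow A u k')"
      using u by (simp add: smult_mult upow_add mult.commute)
    finally show ?case .
  next
    case (tp_add g b g' b')
    then show ?case using tp.tp_add[OF tp_add.IH] u tp_carrier[OF tp_add.hyps(1)] tp_carrier[OF tp_add.hyps(2)]
      by (simp add: r_distr distrib_left)
  qed
next
  case (tp_add f a f' a')
  then show ?case using tp.tp_add[OF tp_add.IH(1)[OF tp_add.prems] tp_add.IH(2)[OF tp_add.prems]]
      u tp_carrier[OF tp_add.hyps(1)] tp_carrier[OF tp_add.hyps(2)] tp_carrier[OF tp_add.prems]
    by (simp add: l_distr distrib_right)
qed

lemma tp_smult: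
  "tp A u d f a \<Longrightarrow> tp A u d (\<lambda>x. c * f x) (c \<odot> a)"
proof (induction rule: tp.induct)
  case (tp_mono k c')
  then show ?case using tp.tp_mono[of k d A u "c * c'"] u by (simp add: mult.assoc)
next
  case (tp_add f a g b)
  then show ?case using tp.tp_add[OF tp_add.IH] tp_carrier[OF tp_add.hyps(1)] tp_carrier[OF tp_add.hyps(2)]
    by (simp add: smult_add_right distrib_left)
qed

lemma tp_const: "0 \<le> d \<Longrightarrow> tp A u d (\<lambda>x. c) (c \<odot> \<one>)"
  using tp.tp_mono[of 0 d A u c] by simp

lemma tp_adj: "tp A u d f a \<Longrightarrow> tp A u d (\<lambda>x. cnj (f x)) (adj A a)"
proof (induction rule: tp.induct)
  case (tp_mono k c)
  then show ?case using tp.tp_mono[of "-k" d A u "cnj c"] u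
    by (simp add: adj_smult adj_upow flip: ex_minus)
next
  case (tp_add f a g b)
  then show ?case using tp.tp_add[OF tp_add.IH] tp_carrier[OF tp_add.hyps(1)] tp_carrier[OF tp_add.hyps(2)]
    by (simp add: adj_add)
qed

lemma tp_shift:
  assumes v: "unitary A v" and comm: "v \<otimes> u = ex t \<odot> (u \<otimes> v)" and "tp A u d f a"
  shows "tp A u d (\<lambda>x. f (x + t)) (v \<otimes> a \<otimes> adj A v)"
  using assms(3)
proof (induction rule: tp.induct)
  case (tp_mono k c)
  have "v \<otimes> (c \<odot> upow A u k) \<otimes> adj A v = c \<odot> ((v \<otimes> upow A u k) \<otimes> adj A v)"
    using u v by (simp add: smult_mult m_assoc)
  also have "\<dots> = (c * ex (of_int k * t)) \<odot> upow A u k"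
    unfolding upow_commute[OF u unitary_carrier[OF v] comm]
    using u v by (simp add: smult_mult m_assoc)
  finally show ?case using tp.tp_mono[OF tp_mono, of A u "c * ex (of_int k * t)"]
    by (simp add: distrib_left ex_add mult_ac)
next
  case (tp_add f a g b)
  then show ?case using tp.tp_add[OF tp_add.IH] tp_carrier[OF tp_add.hyps(1)] tp_carrier[OF tp_add.hyps(2)] v
    by (simp add: l_distr r_distr)
qed

text \<open>By orthogonality of the exponentials, the coefficients of \<open>a\<close> can be read
  off from \<open>f\<close>. Thus \<open>a\<close> depends on \<open>f\<close> and \<open>d\<close>
  alone, although one function arises from many derivations of \<open>tp\<close>.\<close>

lemma tp_fourier:
  "tp A u d f a \<Longrightarrow> a = (\<Oplus>k\<in>{-d..d}. fcoeff f k \<odot> upow A u k)"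
proof (induction rule: tp.induct)
  case (tp_mono k c)
  have "(\<Oplus>j\<in>{-d..d}. fcoeff (\<lambda>x. c * ex (of_int k * x)) j \<odot> upow A u j)
      = (\<Oplus>j\<in>{-d..d}. if j = k then c \<odot> upow A u k else \<zero>)"
    by (rule finsum_cong') (use u in \<open>auto simp: fcoeff_mono\<close>)
  also have "\<dots> = c \<odot> upow A u k"
    using tp_mono u by (intro finsum_eq_single) auto
  finally show ?case ..
next
  case (tp_add f a g b)
  have "a \<oplus> b = (\<Oplus>k\<in>{-d..d}. fcoeff f k \<odot> upow A u k \<oplus> fcoeff g k \<odot> upow A u k)"
    using u by (subst finsum_addf) (auto simp flip: tp_add.IH)
  also have "\<dots> = (\<Oplus>k\<in>{-d..d}. fcoeff (\<lambda>x. f x + g x) k \<odot> upow A u k)"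
    using tp_continuous[OF tp_add.hyps(1)] tp_continuous[OF tp_add.hyps(2)] u
    by (intro finsum_cong') (auto simp: fcoeff_add smult_add_left)
  finally show ?case .
qed

text \<open>Each of the \<open>2 * d + 1\<close> Fourier coefficients is the mean of
  \<open>f\<close> times a unimodular function, hence at most \<open>M\<close> in modulus, and
  powers of \<open>u\<close> have norm at most 1.\<close>

lemma tp_crude_bound:
  assumes tp: "tp A u d f a" and M: "\<And>x. cmod (f x) \<le> M" and d: "0 \<le> d"
  shows "cnorm A a \<le> (2 * of_int d + 1) * M"
proof -
  have M0: "M \<ge> 0" using M[of 0] norm_ge_zero order_trans by blast
  have "cnorm A a \<le> (\<Sum>k\<in>{-d..d}. cnorm A (fcoeff f k \<odot> upow A u k))"
    by (subst tp_fourier[OF tp]) (use u in \<open>auto intro!: cnorm_finsum_le\<close>)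
  also have "\<dots> \<le> (\<Sum>k\<in>{-d..d}. M)"
  proof (intro sum_mono)
    fix k
    have "cmod (fcoeff f k) * cnorm A (upow A u k) \<le> M * 1"
      using fcoeff_bound[of f M k] tp_continuous[OF tp] M cnorm_unitary_le[of "upow A u k"]
        cnorm_nonneg[of "upow A u k"] u M0
      by (intro mult_mono) auto
    then show "cnorm A (fcoeff f k \<odot> upow A u k) \<le> M" using u by (simp add: cnorm_smult)
  qed
  also have "\<dots> = (2 * of_int d + 1) * M"
    using d by (simp add: of_nat_nat)
  finally show ?thesis .
qed

text \<open>The crude bound for the powers \<open>a^(2^n)\<close> of a self-adjoint \<open>a\<close> grows only linearly in the
  degree, so taking \<open>2^n\<close>-th roots removes the factor.\<close>

lemma tp_bound:
  assumes tp: "tp A u d f a" and M: "\<And>x. cmod (f x) \<le> M" and d: "0 \<le> d"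
  shows "cnorm A a \<le> M"
proof -
  have M0: "M \<ge> 0" using M[of 0] norm_ge_zero order_trans by blast
  \<comment> \<open>For self-adjoint \<open>h\<close> the C*-identity says that the norm of the
    square is the square of the norm.\<close>
  have sa: "cnorm A h \<le> K" if tph: "tp A u D g h" and h: "adj A h = h"
    and K: "\<And>x. cmod (g x) \<le> K" and D: "0 \<le> D" for g h D K
  proof (rule ccontr)
    assume "\<not> cnorm A h \<le> K"
    then have lt: "K < cnorm A h" by simp
    have K0: "K \<ge> 0" using K[of 0] norm_ge_zero order_trans by blast
    \<comment> \<open>Repeated squaring: \<open>p n\<close> is the power of \<open>h\<close> with
      exponent \<open>2 ^ n\<close>, and along these exponents the norm of the power is known
      exactly.\<close>
    define p where "p n = ((\<lambda>y. y \<otimes> y) ^^ n) h" for n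
    have p: "tp A u (2 ^ n * D) (\<lambda>x. g x ^ (2 ^ n)) (p n) \<and> adj A (p n) = p n
        \<and> cnorm A (p n) = cnorm A h ^ (2 ^ n)" for n
    proof (induction n)
      case 0
      then show ?case using tph h by (simp add: p_def)
    next
      case (Suc n)
      have c: "p n \<in> carrier A" using Suc tp_carrier by blast
      have S: "p (Suc n) = p n \<otimes> p n" by (simp add: p_def)
      have "cnorm A (p (Suc n)) = (cnorm A (p n))\<^sup>2"
        using cstar_identity[OF c] Suc by (simp add: S)
      moreover have "tp A u (2 ^ n * D + 2 ^ n * D) (\<lambda>x. g x ^ 2 ^ n * g x ^ 2 ^ n) (p n \<otimes> p n)"
        using Suc by (intro tp_mult) auto
      moreover have "2 ^ n * D + 2 ^ n * D = 2 ^ Suc n * D" by simp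
      moreover have "(\<lambda>x. g x ^ 2 ^ n * g x ^ 2 ^ n) = (\<lambda>x. g x ^ 2 ^ Suc n)"
        by (simp add: mult_2 flip: power_add)
      moreover have "(cnorm A h ^ 2 ^ n)\<^sup>2 = cnorm A h ^ 2 ^ Suc n"
        by (simp add: mult.commute flip: power_mult)
      moreover have "adj A (p n \<otimes> p n) = p n \<otimes> p n"
        using Suc c by (simp add: adj_mult)
      ultimately show ?case using Suc by (simp only: S)
    qed
    have le: "cnorm A h ^ (2 ^ n) \<le> (2 * (2 ^ n * of_int D) + 1) * K ^ (2 ^ n)" for n
    proof -
      have "cnorm A (p n) \<le> (2 * of_int (2 ^ n * D) + 1) * K ^ (2 ^ n)"
        using p[of n] K D by (intro tp_crude_bound) (auto simp: norm_power intro!: power_mono)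
      then show ?thesis using p[of n] by simp
    qed
    have h0: "cnorm A h > 0" using lt K0 by simp
    have Kpos: "K > 0"
      using le[of 0] K0 h0 by (cases "K = 0") auto
    define r where "r = cnorm A h / K"
    have r: "r > 1" using lt Kpos by (simp add: r_def)
    have le': "r ^ (2 ^ n) \<le> (2 * of_int D + 1) * 2 ^ n" for n
    proof -
      have "r ^ (2 ^ n) \<le> 2 * (2 ^ n * of_int D) + 1"
        using le[of n] Kpos by (simp add: r_def power_divide divide_simps)
      also have "\<dots> \<le> (2 * of_int D + 1) * 2 ^ n" by (simp add: algebra_simps)
      finally show ?thesis .
    qed
    \<comment> \<open>Along \<open>m = 2 ^ n\<close> the power \<open>r ^ m\<close> outgrows every
      multiple of \<open>m\<close>, which contradicts \<open>le'\<close>.\<close>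
    have "(\<lambda>m. real m * (1 / r) ^ m) \<longlonglongrightarrow> 0"
      using r powser_times_n_limit_0[of "1 / r"] by simp
    moreover have "filterlim (\<lambda>n::nat. 2 ^ n :: nat) at_top sequentially"
      by (rule filterlim_subseq) (simp add: strict_mono_def)
    ultimately have "(\<lambda>n. real (2 ^ n) * (1 / r) ^ (2 ^ n)) \<longlonglongrightarrow> 0"
      by (rule filterlim_compose)
    then have "\<forall>\<^sub>F n in sequentially. real (2 ^ n) * (1 / r) ^ (2 ^ n) < 1 / (2 * of_int D + 1)"
      using D by (intro order_tendstoD) auto
    then obtain n where n: "real (2 ^ n) * (1 / r) ^ (2 ^ n) < 1 / (2 * of_int D + 1)"
      by (auto simp: eventually_sequentially)
    then have "(2 * of_int D + 1) * 2 ^ n < r ^ (2 ^ n)"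
      using r D by (simp add: power_one_over divide_simps split: if_splits) (simp add: algebra_simps)
    then show False using le'[of n] by simp
  qed
  have c: "a \<in> carrier A" using tp tp_carrier by blast
  \<comment> \<open>A general \<open>a\<close> is reduced to the self-adjoint
    \<open>adj A a \<otimes> a\<close>, whose function is the squared modulus of
    \<open>f\<close>.\<close>
  have "cnorm A (adj A a \<otimes> a) \<le> M\<^sup>2"
  proof (rule sa)
    show "tp A u (d + d) (\<lambda>x. cnj (f x) * f x) (adj A a \<otimes> a)"
      by (intro tp_mult tp_adj tp)
    show "cmod (cnj (f x) * f x) \<le> M\<^sup>2" for x
      using M[of x] M0 by (auto simp: norm_mult power2_eq_square intro: mult_mono)
  qed (use c d in \<open>auto simp: adj_mult\<close>)
  then have "(cnorm A a)\<^sup>2 \<le> M\<^sup>2" using cstar_identity[OF c] by simp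
  then show ?thesis using M0 by (rule power2_le_imp_le)
qed

end

end

section \<open>Continuous functions of period 1 and their values at a unitary\<close>

definition cper :: "(real \<Rightarrow> complex) \<Rightarrow> bool" where
  "cper f \<longleftrightarrow> continuous_on UNIV f \<and> (\<forall>x. f (x + 1) = f x)"

lemma cper_const: "cper (\<lambda>x. c)"
  by (simp add: cper_def)

lemma cper_add: "cper f \<Longrightarrow> cper g \<Longrightarrow> cper (\<lambda>x. f x + g x)"
  by (auto simp: cper_def intro!: continuous_intros)

lemma cper_mult: "cper f \<Longrightarrow> cper g \<Longrightarrow> cper (\<lambda>x. f x * g x)"
  by (auto simp: cper_def intro!: continuous_intros)

lemma cper_cnj: "cper f \<Longrightarrow> cper (\<lambda>x. cnj (f x))"
  by (auto simp: cper_def intro!: continuous_intros)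

lemma cper_shift: "cper f \<Longrightarrow> cper (\<lambda>x. f (x + t))"
  unfolding cper_def
  by (auto intro!: continuous_intros continuous_on_compose2[of UNIV f]) (metis add.assoc add.commute)

lemma cper_sum: "(\<And>i. i \<in> S \<Longrightarrow> cper (f i)) \<Longrightarrow> cper (\<lambda>x. \<Sum>i\<in>S. f i x)"
  by (induction S rule: infinite_finite_induct) (auto simp: cper_const cper_add)

lemma cper_add_int:
  assumes "cper f"
  shows "f (x + of_int k) = f x"
proof (induction k rule: int_induct[where k = 0])
  case (step1 i)
  then show ?case using assms by (metis add.assoc cper_def of_int_1 of_int_add)
next
  case (step2 i)
  have "f ((x + of_int (i - 1)) + 1) = f (x + of_int (i - 1))" using assms unfolding cper_def by blast
  moreover have "(x + of_int (i - 1)) + 1 = x + of_int i" by simp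
  ultimately show ?case using step2 by metis
qed simp

lemma ex_eq_iff: "ex x = ex y \<longleftrightarrow> (\<exists>k::int. x = y + of_int k)"
proof
  assume "ex x = ex y"
  then have "ex (x - y) = 1" using ex_add[of x "-y"] by (simp add: ex_minus)
  then have "cos (2 * pi * (x - y)) = 1" by (simp add: ex_def complex_eq_iff)
  then obtain n :: int where "2 * pi * (x - y) = of_int n * (2 * pi)"
    by (auto simp: cos_one_2pi_int)
  then have "x = y + of_int n" by simp
  then show "\<exists>k::int. x = y + of_int k" by blast
qed auto

lemma ex_surj:
  assumes "cmod z = 1"
  obtains x where "0 \<le> x" "x \<le> 1" "z = ex x"
proof -
  have "z \<noteq> 0" using assms by auto
  then have z: "z = cis (Arg z)" using assms cis_Arg[of z] by (simp add: sgn_div_norm)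
  define y where "y = Arg z / (2 * pi)"
  have "z = ex y" using z by (simp add: ex_def y_def)
  also have "\<dots> = ex (frac y)"
    unfolding ex_eq_iff by (rule exI[of _ "\<lfloor>y\<rfloor>"]) (simp add: frac_def)
  finally show ?thesis using that[of "frac y"] frac_ge_0[of y] frac_lt_1[of y] by simp
qed

text \<open>The closure of the graph of \<open>tp\<close>: one and the same polynomial must
  approximate the function uniformly and the element in norm. The algebraic rules are thus checked
  on polynomials, and existence and uniqueness of the value come afterwards.\<close>

definition fc :: "'a cstar \<Rightarrow> 'a \<Rightarrow> (real \<Rightarrow> complex) \<Rightarrow> 'a \<Rightarrow> bool" where
  "fc A u f a \<longleftrightarrow> a \<in> carrier A \<and> (\<forall>e>0. \<exists>d g b. 0 \<le> d \<and> tp A u d g b \<and>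
     (\<forall>x. cmod (f x - g x) \<le> e) \<and> cnorm A (a \<ominus>\<^bsub>A\<^esub> b) \<le> e)"

definition fcal :: "'a cstar \<Rightarrow> 'a \<Rightarrow> (real \<Rightarrow> complex) \<Rightarrow> 'a" where
  "fcal A u f = (THE a. fc A u f a)"

lemma fcE:
  assumes "fc A u f a" "e > 0"
  obtains d g b where "0 \<le> d" "tp A u d g b" "\<And>x. cmod (f x - g x) \<le> e" "cnorm A (a \<ominus>\<^bsub>A\<^esub> b) \<le> e"
  using assms unfolding fc_def by blast

lemma fc_carrier: "fc A u f a \<Longrightarrow> a \<in> carrier A"
  by (simp add: fc_def)

lemma tp_bounded: "tp A u d f a \<Longrightarrow> \<exists>M. \<forall>x. cmod (f x) \<le> M"
proof (induction rule: tp.induct)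
  case (tp_mono k c)
  then show ?case by (auto simp: norm_mult)
next
  case (tp_add f a g b)
  then show ?case by (meson add_mono norm_triangle_le)
qed

lemma fc_bounded:
  assumes "fc A u f a"
  obtains M where "M \<ge> 0" "\<And>x. cmod (f x) \<le> M"
proof -
  obtain d g b where g: "tp A u d g b" "\<And>x. cmod (f x - g x) \<le> 1"
    using assms by (rule fcE[of A u f a 1]) auto
  obtain M where M: "\<And>x. cmod (g x) \<le> M" using tp_bounded[OF g(1)] by blast
  have "cmod (f x) \<le> M + 1" for x
    using norm_triangle_ineq[of "f x - g x" "g x"] g(2)[of x] M[of x] by simp
  moreover from this[of 0] have "0 \<le> M + 1" using norm_ge_zero order_trans by blast
  ultimately show ?thesis using that by blast
qed

context cstar_algebra
begin

context
  fixes u assumes u: "unitary A u"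
begin

lemma fc_tp: "0 \<le> d \<Longrightarrow> tp A u d f a \<Longrightarrow> fc A u f a"
proof -
  assume d: "0 \<le> d" and tp: "tp A u d f a"
  have a: "a \<in> carrier A" using tp_carrier[OF u tp] .
  then have "cnorm A (a \<ominus> a) = 0" by (simp add: cnorm_eq_diff)
  moreover have "cmod (f x - f x) \<le> e" if "e > 0" for e x using that by simp
  ultimately have "0 \<le> d \<and> tp A u d f a \<and> (\<forall>x. cmod (f x - f x) \<le> e) \<and> cnorm A (a \<ominus> a) \<le> e" if "e > 0" for e
    using that d tp by (auto simp only: less_imp_le)
  then show ?thesis unfolding fc_def using a by blast
qed

lemma fc_bound:
  assumes fc: "fc A u f a" and M: "\<And>x. cmod (f x) \<le> M"
  shows "cnorm A a \<le> M"
proof (rule field_le_epsilon)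
  fix e :: real assume e: "e > 0"
  obtain d g b where g: "0 \<le> d" "tp A u d g b" "\<And>x. cmod (f x - g x) \<le> e / 2" "cnorm A (a \<ominus> b) \<le> e / 2"
    using fc by (rule fcE[of A u f a "e / 2"]) (use e in auto)
  have "cmod (g x) \<le> M + e / 2" for x
    using norm_triangle_ineq[of "g x - f x" "f x"] g(3)[of x] M[of x] by (simp add: norm_minus_commute)
  then have b: "cnorm A b \<le> M + e / 2" by (rule tp_bound[OF u g(2)]) (rule g)
  have ab: "a \<in> carrier A" "b \<in> carrier A" using fc_carrier[OF fc] tp_carrier[OF u g(2)] by auto
  then have "cnorm A a \<le> cnorm A (a \<ominus> b) + cnorm A b"
    using cnorm_triangle[of "a \<ominus> b" b] diff_add_diff[of a b \<zero>] by (simp add: diff_eq_smult a_assoc)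
  then show "cnorm A a \<le> M + e" using b g(4) by linarith
qed

lemma fc_add:
  assumes "fc A u f a" "fc A u g b"
  shows "fc A u (\<lambda>x. f x + g x) (a \<oplus> b)"
  unfolding fc_def
proof (intro conjI allI impI)
  show "a \<oplus> b \<in> carrier A" using assms[THEN fc_carrier] by simp
  fix e :: real assume e: "e > 0"
  obtain d f' a' where 1: "0 \<le> d" "tp A u d f' a'" "\<And>x. cmod (f x - f' x) \<le> e / 2" "cnorm A (a \<ominus> a') \<le> e / 2"
    using assms(1) by (rule fcE[of A u f a "e / 2"]) (use e in auto)
  obtain d' g' b' where 2: "0 \<le> d'" "tp A u d' g' b'" "\<And>x. cmod (g x - g' x) \<le> e / 2" "cnorm A (b \<ominus> b') \<le> e / 2"
    using assms(2) by (rule fcE[of A u g b "e / 2"]) (use e in auto)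
  have c: "a \<in> carrier A" "b \<in> carrier A" "a' \<in> carrier A" "b' \<in> carrier A"
    using assms[THEN fc_carrier] tp_carrier[OF u 1(2)] tp_carrier[OF u 2(2)] by auto
  have "(a \<oplus> b) \<ominus> (a' \<oplus> b') = (a \<ominus> a') \<oplus> (b \<ominus> b')"
    using c by (simp add: diff_eq_smult smult_add_right a_assoc a_lcomm)
  then have "cnorm A ((a \<oplus> b) \<ominus> (a' \<oplus> b')) \<le> e"
    using cnorm_triangle[of "a \<ominus> a'" "b \<ominus> b'"] c 1(4) 2(4) by simp
  moreover have "cmod (f x + g x - (f' x + g' x)) \<le> e" for x
    using norm_triangle_ineq[of "f x - f' x" "g x - g' x"] 1(3)[of x] 2(3)[of x] by (simp add: algebra_simps)
  moreover have "tp A u (max d d') (\<lambda>x. f' x + g' x) (a' \<oplus> b')"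
    using tp_mono_degree[OF 1(2), of "max d d'"] tp_mono_degree[OF 2(2), of "max d d'"]
    by (intro tp_add) auto
  ultimately show "\<exists>d h c. 0 \<le> d \<and> tp A u d h c \<and> (\<forall>x. cmod (f x + g x - h x) \<le> e) \<and>
      cnorm A (a \<oplus> b \<ominus> c) \<le> e"
    using 1(1) by (intro exI[of _ "max d d'"] exI conjI allI) auto
qed

lemma fc_mult:
  assumes "fc A u f a" "fc A u g b"
  shows "fc A u (\<lambda>x. f x * g x) (a \<otimes> b)"
  unfolding fc_def
proof (intro conjI allI impI)
  show "a \<otimes> b \<in> carrier A" using assms[THEN fc_carrier] by simp
  fix e :: real assume e: "e > 0"
  obtain M where M: "M \<ge> 0" "\<And>x. cmod (f x) \<le> M" using fc_bounded[OF assms(1)] by blast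
  obtain K where K: "K \<ge> 0" "\<And>x. cmod (g x) \<le> K" using fc_bounded[OF assms(2)] by blast
  \<comment> \<open>As \<open>r \<le> 1\<close>, the quadratic error \<open>r * r\<close> is at most
    \<open>r\<close>, so the total error is at most \<open>r * (M + K + 1) \<le> e\<close>.\<close>
  define r where "r = min 1 (e / (M + K + 1))"
  have r: "r > 0" "r \<le> 1" using e M K by (auto simp: r_def)
  have "r * (M + K + 1) \<le> e / (M + K + 1) * (M + K + 1)"
    using M K by (intro mult_right_mono) (auto simp: r_def)
  then have re: "r * (M + K + 1) \<le> e" using M K by simp
  have rr: "r * r \<le> r" using mult_left_mono[of r 1 r] r by simp
  have *: "p * q \<le> M * r \<Longrightarrow> p' * q' \<le> r * (K + r) \<Longrightarrow> p * q + p' * q' \<le> e" for p q p' q' :: real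
    using re rr by (simp add: algebra_simps)
  obtain d f' a' where 1: "0 \<le> d" "tp A u d f' a'" "\<And>x. cmod (f x - f' x) \<le> r" "cnorm A (a \<ominus> a') \<le> r"
    using assms(1) by (rule fcE[of A u f a r]) (use r in auto)
  obtain d' g' b' where 2: "0 \<le> d'" "tp A u d' g' b'" "\<And>x. cmod (g x - g' x) \<le> r" "cnorm A (b \<ominus> b') \<le> r"
    using assms(2) by (rule fcE[of A u g b r]) (use r in auto)
  have c: "a \<in> carrier A" "b \<in> carrier A" "a' \<in> carrier A" "b' \<in> carrier A"
    using assms[THEN fc_carrier] tp_carrier[OF u 1(2)] tp_carrier[OF u 2(2)] by auto
  have g': "cmod (g' x) \<le> K + r" for x
    using norm_triangle_ineq[of "g' x - g x" "g x"] 2(3)[of x] K(2)[of x] by (simp add: norm_minus_commute)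
  then have b': "cnorm A b' \<le> K + r" by (rule tp_bound[OF u 2(2)]) (rule 2)
  have "(a \<otimes> b) \<ominus> (a' \<otimes> b') = (a \<otimes> b \<ominus> a \<otimes> b') \<oplus> (a \<otimes> b' \<ominus> a' \<otimes> b')"
    using c by (intro diff_add_diff[symmetric]) auto
  also have "\<dots> = a \<otimes> (b \<ominus> b') \<oplus> (a \<ominus> a') \<otimes> b'"
    using c by (simp add: diff_eq_smult l_distr r_distr smult_mult)
  finally have "cnorm A ((a \<otimes> b) \<ominus> (a' \<otimes> b'))
      \<le> cnorm A (a \<otimes> (b \<ominus> b')) + cnorm A ((a \<ominus> a') \<otimes> b')"
    using cnorm_triangle[of "a \<otimes> (b \<ominus> b')" "(a \<ominus> a') \<otimes> b'"] c by simp
  also have "\<dots> \<le> cnorm A a * cnorm A (b \<ominus> b') + cnorm A (a \<ominus> a') * cnorm A b'"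
    using c by (intro add_mono cnorm_mult) auto
  also have "\<dots> \<le> e"
    using fc_bound[OF assms(1) M(2)] 1(4) 2(4) b' c M(1) r cnorm_nonneg
    by (intro * mult_mono) auto
  finally have n: "cnorm A ((a \<otimes> b) \<ominus> (a' \<otimes> b')) \<le> e" .
  have f: "cmod (f x * g x - f' x * g' x) \<le> e" for x
  proof -
    have "f x * g x - f' x * g' x = f x * (g x - g' x) + (f x - f' x) * g' x"
      by (simp add: algebra_simps)
    then have "cmod (f x * g x - f' x * g' x) \<le> cmod (f x) * cmod (g x - g' x) + cmod (f x - f' x) * cmod (g' x)"
      by (metis norm_mult norm_triangle_ineq)
    also have "\<dots> \<le> e" using 1(3)[of x] 2(3)[of x] g'[of x] M r by (intro * mult_mono) auto
    finally show ?thesis .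
  qed
  show "\<exists>d h c. 0 \<le> d \<and> tp A u d h c \<and> (\<forall>x. cmod (f x * g x - h x) \<le> e) \<and>
      cnorm A (a \<otimes> b \<ominus> c) \<le> e"
    using tp_mult[OF u 1(2) 2(2)] 1(1) 2(1) n f by (intro exI[of _ "d + d'"] exI conjI allI) auto
qed

lemma fc_const: "fc A u (\<lambda>x. c) (c \<odot> \<one>)"
  using tp_const[OF u, of 0 c] by (intro fc_tp) auto

lemma fc_adj:
  assumes "fc A u f a"
  shows "fc A u (\<lambda>x. cnj (f x)) (adj A a)"
  unfolding fc_def
proof (intro conjI allI impI)
  show "adj A a \<in> carrier A" using assms[THEN fc_carrier] by simp
  fix e :: real assume e: "e > 0"
  obtain d f' a' where 1: "0 \<le> d" "tp A u d f' a'" "\<And>x. cmod (f x - f' x) \<le> e" "cnorm A (a \<ominus> a') \<le> e"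
    using assms(1) by (rule fcE[of A u f a e]) (use e in auto)
  have c: "a \<in> carrier A" "a' \<in> carrier A"
    using assms[THEN fc_carrier] tp_carrier[OF u 1(2)] by auto
  have "adj A a \<ominus> adj A a' = adj A (a \<ominus> a')"
    using c by (simp add: diff_eq_smult adj_add adj_smult)
  then have "cnorm A (adj A a \<ominus> adj A a') \<le> e" using 1(4) c by simp
  moreover have "cmod (cnj (f x) - cnj (f' x)) \<le> e" for x
    using 1(3)[of x] by (metis complex_cnj_diff complex_mod_cnj)
  ultimately show "\<exists>d h c. 0 \<le> d \<and> tp A u d h c \<and> (\<forall>x. cmod (cnj (f x) - h x) \<le> e) \<and>
      cnorm A (adj A a \<ominus> c) \<le> e"
    using tp_adj[OF u 1(2)] 1(1) by blast
qed

lemma fc_shift: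
  assumes v: "unitary A v" and comm: "v \<otimes> u = ex t \<odot> (u \<otimes> v)" and "fc A u f a"
  shows "fc A u (\<lambda>x. f (x + t)) (v \<otimes> a \<otimes> adj A v)"
  unfolding fc_def
proof (intro conjI allI impI)
  show "v \<otimes> a \<otimes> adj A v \<in> carrier A" using assms(3)[THEN fc_carrier] v by simp
  fix e :: real assume e: "e > 0"
  obtain d f' a' where 1: "0 \<le> d" "tp A u d f' a'" "\<And>x. cmod (f x - f' x) \<le> e" "cnorm A (a \<ominus> a') \<le> e"
    using assms(3) by (rule fcE[of A u f a e]) (use e in auto)
  have c: "a \<in> carrier A" "a' \<in> carrier A"
    using assms(3)[THEN fc_carrier] tp_carrier[OF u 1(2)] by auto
  have "v \<otimes> a \<otimes> adj A v \<ominus> v \<otimes> a' \<otimes> adj A v = v \<otimes> (a \<ominus> a') \<otimes> adj A v"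
    using c v by (simp add: diff_eq_smult l_distr r_distr smult_mult)
  moreover have "cnorm A (v \<otimes> (a \<ominus> a') \<otimes> adj A v) \<le> 1 * e * 1"
    using c v 1(4) cnorm_unitary_le by (intro cnorm_mult_le) auto
  ultimately have "cnorm A (v \<otimes> a \<otimes> adj A v \<ominus> v \<otimes> a' \<otimes> adj A v) \<le> e" by simp
  then show "\<exists>d h c. 0 \<le> d \<and> tp A u d h c \<and> (\<forall>x. cmod (f (x + t) - h x) \<le> e) \<and>
      cnorm A (v \<otimes> a \<otimes> adj A v \<ominus> c) \<le> e"
    using tp_shift[OF u v comm 1(2)] 1(1,3) by blast
qed

text \<open>The difference of two values belongs to the zero function, and \<open>fc_bound\<close>
  with bound 0 applies to it.\<close>

lemma fc_unique:
  assumes "fc A u f a" "fc A u f b"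
  shows "a = b"
proof -
  have c: "a \<in> carrier A" "b \<in> carrier A" using assms[THEN fc_carrier] by auto
  have "fc A u (\<lambda>x. f x + (-1) * f x) (a \<oplus> ((-1) \<odot> \<one>) \<otimes> b)"
    by (intro fc_add assms fc_mult fc_const)
  then have "cnorm A (a \<oplus> ((-1) \<odot> \<one>) \<otimes> b) \<le> 0"
    by (rule fc_bound) simp
  then have "cnorm A (a \<ominus> b) = 0"
    using c cnorm_nonneg[of "a \<ominus> b"] by (simp add: diff_eq_smult smult_mult)
  then show ?thesis using c by (simp add: cnorm_eq_diff)
qed

text \<open>A real-linear function on the plane is a combination of \<open>z\<close> and its
  conjugate. On the circle these are \<open>ex x\<close> and \<open>ex (- x)\<close>, so polynomials
  restrict to trigonometric polynomials.\<close>

lemma tp_real_polynomial: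
  fixes g :: "complex \<Rightarrow> real"
  assumes "real_polynomial_function g"
  shows "\<exists>d b. 0 \<le> d \<and> tp A u d (\<lambda>x. of_real (g (ex x))) b"
  using assms
proof (induction rule: real_polynomial_function.induct)
  case (linear g)
  interpret bounded_linear g by fact
  define c1 where "c1 = (of_real (g 1) - \<i> * of_real (g \<i>)) / 2"
  define c2 where "c2 = (of_real (g 1) + \<i> * of_real (g \<i>)) / 2"
  have g: "of_real (g z) = c1 * z + c2 * cnj z" for z :: complex
  proof -
    have "z = Re z *\<^sub>R 1 + Im z *\<^sub>R \<i>" by (simp add: complex_eq_iff)
    then have "g z = Re z * g 1 + Im z * g \<i>" by (metis add scale real_scaleR_def)
    then show ?thesis by (simp add: c1_def c2_def complex_eq_iff algebra_simps add_divide_distrib diff_divide_distrib)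
  qed
  have "tp A u 1 (\<lambda>x. c1 * ex (of_int 1 * x) + c2 * ex (of_int (-1) * x))
      (c1 \<odot> upow A u 1 \<oplus> c2 \<odot> upow A u (-1))"
    by (intro tp.intros) auto
  then show ?case by (auto simp: g ex_minus intro!: exI[of _ 1])
next
  case (const c)
  then show ?case using tp_const[OF u, of 0 "of_real c"] by blast
next
  case (add f g)
  then obtain d b d' b' where "0 \<le> d" "tp A u d (\<lambda>x. of_real (f (ex x))) b"
    "0 \<le> d'" "tp A u d' (\<lambda>x. of_real (g (ex x))) b'" by blast
  then have "tp A u (max d d') (\<lambda>x. of_real (f (ex x)) + of_real (g (ex x))) (b \<oplus> b')"
    by (intro tp_add) (auto intro: tp_mono_degree)
  then show ?case using \<open>0 \<le> d\<close> by (intro exI[of _ "max d d'"] exI[of _ "b \<oplus> b'"]) auto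
next
  case (mult f g)
  then obtain d b d' b' where *: "0 \<le> d" "tp A u d (\<lambda>x. of_real (f (ex x))) b"
    "0 \<le> d'" "tp A u d' (\<lambda>x. of_real (g (ex x))) b'" by blast
  then show ?case using tp_mult[OF u *(2) *(4)]
    by (intro exI[of _ "d + d'"] exI[of _ "b \<otimes> b'"]) auto
qed

lemma tp_dense:
  assumes f: "cper f" and e: "e > 0"
  shows "\<exists>d g b. 0 \<le> d \<and> tp A u d g b \<and> (\<forall>x. cmod (f x - g x) \<le> e)"
proof -
  \<comment> \<open>\<open>F\<close> is \<open>f\<close> viewed on the circle, where
    Stone-Weierstrass is available; by periodicity the choice of the argument of \<open>z\<close>
    does not affect the value.\<close>
  define F where "F z = f (SOME x. ex x = z)" for z
  have F: "F (ex x) = f x" for x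
  proof -
    have "ex (SOME y. ex y = ex x) = ex x" by (rule someI) simp
    then obtain k :: int where "(SOME y. ex y = ex x) = x + of_int k" unfolding ex_eq_iff by blast
    then show ?thesis using f by (simp add: F_def cper_add_int)
  qed
  have cf: "continuous_on S f" for S using f continuous_on_subset by (auto simp: cper_def)
  have "continuous_on (sphere 0 1) F"
  \<comment> \<open>The chosen argument need not vary continuously with \<open>z\<close>. Continuity
    comes from the graph instead, which is a continuous image of the compact interval
    \<open>{0..1}\<close>.\<close>
  proof (rule continuous_from_closed_graph)
    show "compact (f ` {0..1})" using cf by (intro compact_continuous_image) auto
    show "F \<in> sphere 0 1 \<rightarrow> f ` {0..1}"
      using F by (auto elim!: ex_surj)
    have "(\<lambda>z. (z, F z)) ` sphere 0 1 = (\<lambda>x. (ex x, f x)) ` {0..1}"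
    proof (intro equalityI subsetI)
      fix p assume "p \<in> (\<lambda>z. (z, F z)) ` sphere 0 1"
      then obtain z where z: "cmod z = 1" "p = (z, F z)" by auto
      obtain x where "0 \<le> x" "x \<le> 1" "z = ex x" using z(1) by (rule ex_surj)
      then show "p \<in> (\<lambda>x. (ex x, f x)) ` {0..1}" using z(2) F by auto
    next
      fix p assume "p \<in> (\<lambda>x. (ex x, f x)) ` {0..1}"
      then obtain x where "p = (ex x, F (ex x))" using F by auto
      then show "p \<in> (\<lambda>z. (z, F z)) ` sphere 0 1" by auto
    qed
    moreover have "compact ((\<lambda>x. (ex x, f x)) ` {0..1})"
      using cf by (intro compact_continuous_image continuous_intros) auto
    ultimately show "closed ((\<lambda>z. (z, F z)) ` sphere 0 1)" by (simp add: compact_imp_closed)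
  qed
  then obtain g where g: "polynomial_function g" "\<And>z. z \<in> sphere 0 1 \<Longrightarrow> norm (F z - g z) < e"
    using Stone_Weierstrass_polynomial_function[of "sphere 0 1" F e] e by auto
  have "real_polynomial_function (Re \<circ> g)" "real_polynomial_function (Im \<circ> g)"
    using g(1) bounded_linear_Re bounded_linear_Im unfolding polynomial_function_def by auto
  then obtain d b d' b' where *: "0 \<le> d" "tp A u d (\<lambda>x. of_real (Re (g (ex x)))) b"
    "0 \<le> d'" "tp A u d' (\<lambda>x. of_real (Im (g (ex x)))) b'"
    using tp_real_polynomial[of "Re \<circ> g"] tp_real_polynomial[of "Im \<circ> g"]
    unfolding comp_def by blast
  have "tp A u (max d d') (\<lambda>x. of_real (Re (g (ex x))) + \<i> * of_real (Im (g (ex x)))) (b \<oplus> \<i> \<odot> b')"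
    using tp_mono_degree[OF *(2), of "max d d'"] tp_mono_degree[OF *(4), of "max d d'"]
    by (intro tp_add tp_smult[OF u]) simp_all
  then have "tp A u (max d d') (\<lambda>x. g (ex x)) (b \<oplus> \<i> \<odot> b')"
    by (simp flip: complex_eq)
  moreover have "cmod (f x - g (ex x)) \<le> e" for x
    using g(2)[of "ex x"] F[of x] by simp
  ultimately show ?thesis using *(1) by (intro exI[of _ "max d d'"] exI conjI allI) auto
qed

text \<open>Polynomials converging uniformly to \<open>f\<close> have a Cauchy sequence of values,
  because norms of values are bounded by sup norms; completeness of \<open>A\<close> supplies the
  limit.\<close>

lemma fc_exists:
  assumes f: "cper f"
  shows "\<exists>a. fc A u f a"
proof -
  have "\<forall>n::nat. \<exists>d g b. 0 \<le> d \<and> tp A u d g b \<and> (\<forall>x. cmod (f x - g x) \<le> 1 / Suc n)"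
    using tp_dense[OF f] by simp
  then obtain d g b where dgb: "\<And>n. 0 \<le> d n" "\<And>n. tp A u (d n) (g n) (b n)"
    "\<And>n x. cmod (f x - g n x) \<le> 1 / Suc n" by metis
  have c: "b n \<in> carrier A" for n using tp_carrier[OF u dgb(2)] .
  have diff: "cnorm A (b i \<ominus> b j) \<le> 1 / Suc i + 1 / Suc j" for i j
  proof -
    have "fc A u (\<lambda>x. g i x + (-1) * g j x) (b i \<oplus> ((-1) \<odot> \<one>) \<otimes> b j)"
      by (intro fc_add fc_mult fc_const fc_tp[OF dgb(1) dgb(2)])
    then have "cnorm A (b i \<oplus> ((-1) \<odot> \<one>) \<otimes> b j) \<le> 1 / Suc i + 1 / Suc j"
    proof (rule fc_bound)
      fix x
      show "cmod (g i x + (-1) * g j x) \<le> 1 / Suc i + 1 / Suc j"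
        using norm_triangle_ineq[of "g i x - f x" "f x - g j x"] dgb(3)[of x i]
          dgb(3)[of x j] by (simp add: norm_minus_commute)
    qed
    then show ?thesis using c by (simp add: diff_eq_smult smult_mult)
  qed
  have small: "\<exists>N. \<forall>n\<ge>N. 1 / real (Suc n) < e" if e: "e > 0" for e
  proof -
    obtain N where N: "1 / real (Suc N) < e" using nat_approx_posE[OF e] by auto
    have "1 / real (Suc n) < e" if "n \<ge> N" for n
    proof -
      have "1 / real (Suc n) \<le> 1 / real (Suc N)" using that by (intro divide_left_mono) auto
      then show ?thesis using N by linarith
    qed
    then show ?thesis by blast
  qed
  have "\<exists>x\<in>carrier A. (\<lambda>i. cnorm A (b i \<ominus> x)) \<longlonglongrightarrow> 0"
  proof (rule complete)
    fix e :: real assume "e > 0"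
    then obtain N where N: "\<forall>n\<ge>N. 1 / real (Suc n) < e / 2" using small[of "e / 2"] by auto
    have "cnorm A (b i \<ominus> b j) < e" if "i \<ge> N" "j \<ge> N" for i j
      using diff[of i j] N[rule_format, OF that(1)] N[rule_format, OF that(2)] by linarith
    then show "\<exists>N. \<forall>i\<ge>N. \<forall>j\<ge>N. cnorm A (b i \<ominus> b j) < e" by blast
  qed (rule c)
  then obtain a where a: "a \<in> carrier A" "(\<lambda>i. cnorm A (b i \<ominus> a)) \<longlonglongrightarrow> 0" by blast
  have "fc A u f a"
    unfolding fc_def
  proof (intro conjI allI impI a)
    fix e :: real assume e: "e > 0"
    obtain N where N: "\<forall>n\<ge>N. 1 / real (Suc n) < e" using small[OF e] by auto
    have "\<forall>\<^sub>F n in sequentially. cnorm A (b n \<ominus> a) < e" using a(2) e by (rule order_tendstoD)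
    then obtain N' where N': "\<And>n. n \<ge> N' \<Longrightarrow> cnorm A (b n \<ominus> a) < e" by (auto simp: eventually_sequentially)
    define n where "n = max N N'"
    have "1 / Suc n < e" "cnorm A (a \<ominus> b n) < e"
      using N N' cnorm_diff_commute[OF a(1) c] by (auto simp: n_def)
    moreover have "cmod (f x - g n x) \<le> e" for x
      using dgb(3)[of x n] \<open>1 / Suc n < e\<close> by linarith
    ultimately show "\<exists>d g b. 0 \<le> d \<and> tp A u d g b \<and> (\<forall>x. cmod (f x - g x) \<le> e) \<and> cnorm A (a \<ominus> b) \<le> e"
      using dgb(1,2)[of n] by (intro exI[of _ "d n"] exI[of _ "g n"] exI[of _ "b n"] conjI allI) simp_all
  qed
  then show ?thesis ..
qed

lemma fc_fcal: "cper f \<Longrightarrow> fc A u f (fcal A u f)"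
  unfolding fcal_def using fc_exists[of f] fc_unique by (metis theI)

lemma fcal_eqI: "fc A u f a \<Longrightarrow> fcal A u f = a"
  unfolding fcal_def using fc_unique by blast

lemma fcal_carrier [simp]: "cper f \<Longrightarrow> fcal A u f \<in> carrier A"
  using fc_carrier[OF fc_fcal] .

lemma fcal_add: "cper f \<Longrightarrow> cper g \<Longrightarrow> fcal A u (\<lambda>x. f x + g x) = fcal A u f \<oplus> fcal A u g"
  by (intro fcal_eqI fc_add fc_fcal)

lemma fcal_mult: "cper f \<Longrightarrow> cper g \<Longrightarrow> fcal A u (\<lambda>x. f x * g x) = fcal A u f \<otimes> fcal A u g"
  by (intro fcal_eqI fc_mult fc_fcal)

lemma fcal_adj: "cper f \<Longrightarrow> fcal A u (\<lambda>x. cnj (f x)) = adj A (fcal A u f)"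
  by (intro fcal_eqI fc_adj fc_fcal)

lemma fcal_const: "fcal A u (\<lambda>x. c) = c \<odot> \<one>"
  by (intro fcal_eqI fc_const)

lemma fcal_smult: "cper f \<Longrightarrow> fcal A u (\<lambda>x. c * f x) = c \<odot> fcal A u f"
  using fcal_mult[OF cper_const, of f c] by (simp add: fcal_const smult_mult)

lemma fcal_shift:
  assumes "unitary A v" "v \<otimes> u = ex t \<odot> (u \<otimes> v)" "cper f"
  shows "v \<otimes> fcal A u f = fcal A u (\<lambda>x. f (x + t)) \<otimes> v"
proof -
  have "fcal A u (\<lambda>x. f (x + t)) = v \<otimes> fcal A u f \<otimes> adj A v"
    using assms by (intro fcal_eqI fc_shift fc_fcal)
  then show ?thesis using assms by (simp add: m_assoc)
qed

lemma fcal_sum: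
  assumes "finite S" "\<And>i. i \<in> S \<Longrightarrow> cper (f i)"
  shows "fcal A u (\<lambda>x. \<Sum>i\<in>S. f i x) = (\<Oplus>i\<in>S. fcal A u (f i))"
  using assms
proof (induction S rule: finite_induct)
  case empty
  then show ?case using fcal_const[of 0] by simp
next
  case (insert i S)
  then have c: "(\<lambda>i. fcal A u (f i)) \<in> S \<rightarrow> carrier A" "fcal A u (f i) \<in> carrier A" by auto
  have "fcal A u (\<lambda>x. \<Sum>i\<in>insert i S. f i x) = fcal A u (\<lambda>x. f i x + (\<Sum>i\<in>S. f i x))"
    using insert by simp
  also have "\<dots> = fcal A u (f i) \<oplus> (\<Oplus>i\<in>S. fcal A u (f i))"
    using insert by (subst fcal_add) (auto intro: cper_sum)
  finally show ?case using insert c by (subst finsum_insert) auto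
qed

end

end

section \<open>Traces\<close>

lemma tp_cper: "tp A u d f a \<Longrightarrow> cper f"
proof (induction rule: tp.induct)
  case (tp_mono k c)
  have "of_int k * (x + 1) = of_int k * x + (of_int k :: real)" for x :: real
    by (simp add: distrib_left)
  then show ?case by (auto simp: cper_def intro!: continuous_intros)
qed (rule cper_add)

lemma cper_continuous_on: "cper f \<Longrightarrow> continuous_on S f"
  unfolding cper_def using continuous_on_subset by blast

locale traced = cstar_algebra A for A :: "'a cstar" (structure) +
  fixes \<tau> :: "'a \<Rightarrow> complex"
  assumes trace: "tracial_state A \<tau>"
begin

lemma tau_add: "x \<in> carrier A \<Longrightarrow> y \<in> carrier A \<Longrightarrow> \<tau> (x \<oplus> y) = \<tau> x + \<tau> y"
  and tau_smult: "x \<in> carrier A \<Longrightarrow> \<tau> (c \<odot> x) = c * \<tau> x"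
  and tau_pos: "x \<in> carrier A \<Longrightarrow> Im (\<tau> (adj A x \<otimes> x)) = 0 \<and> 0 \<le> Re (\<tau> (adj A x \<otimes> x))"
  and tau_one: "\<tau> \<one> = 1"
  and tau_commute: "x \<in> carrier A \<Longrightarrow> y \<in> carrier A \<Longrightarrow> \<tau> (x \<otimes> y) = \<tau> (y \<otimes> x)"
  using trace unfolding tracial_state_def by blast+

lemma tau_zero: "\<tau> \<zero> = 0"
  using tau_smult[of \<zero> 0] by simp

lemma tau_finsum:
  assumes "finite S" "f \<in> S \<rightarrow> carrier A"
  shows "\<tau> (\<Oplus>i\<in>S. f i) = (\<Sum>i\<in>S. \<tau> (f i))"
  using assms
proof (induction S rule: finite_induct)
  case empty
  then show ?case by (simp add: tau_zero)
next
  case (insert i S)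
  then have f: "f \<in> S \<rightarrow> carrier A" "f i \<in> carrier A" by auto
  then have "\<tau> (\<Oplus>i\<in>insert i S. f i) = \<tau> (f i \<oplus> (\<Oplus>i\<in>S. f i))"
    using insert by (subst finsum_insert) auto
  also have "\<dots> = \<tau> (f i) + \<tau> (\<Oplus>i\<in>S. f i)" using f by (intro tau_add) auto
  finally show ?case using insert f by simp
qed

text \<open>Adding a scalar extracts the consequences of positivity: \<open>c = 1\<close> and
  \<open>c = \<i>\<close> give the behaviour under adjoints, and \<open>c = - \<tau> x\<close> gives
  the Cauchy-Schwarz inequality.\<close>

lemma tau_expand:
  assumes x: "x \<in> carrier A"
  defines "y c \<equiv> x \<oplus> c \<odot> \<one>"
  shows "\<tau> (adj A (y c) \<otimes> y c) = \<tau> (adj A x \<otimes> x) + c * \<tau> (adj A x) + cnj c * \<tau> x + cnj c * c"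
proof -
  have "adj A (y c) \<otimes> y c = (adj A x \<otimes> x \<oplus> c \<odot> adj A x) \<oplus> (cnj c \<odot> x \<oplus> (cnj c * c) \<odot> \<one>)"
    using x by (simp add: y_def adj_add adj_smult l_distr r_distr smult_mult smult_add_right a_assoc)
      (simp add: a_lcomm mult.commute)
  then show ?thesis using x by (simp add: tau_add tau_smult tau_one)
qed

lemma tau_adj:
  assumes x: "x \<in> carrier A"
  shows "\<tau> (adj A x) = cnj (\<tau> x)"
proof -
  have *: "Im (c * \<tau> (adj A x) + cnj c * \<tau> x + cnj c * c) = 0" for c
    using tau_pos[of "x \<oplus> c \<odot> \<one>"] tau_pos[of x] x unfolding tau_expand[OF x] by auto
  show ?thesis using *[of 1] *[of \<i>] by (simp add: complex_eq_iff)
qed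

lemma tau_Cauchy_Schwarz:
  assumes x: "x \<in> carrier A"
  shows "(cmod (\<tau> x))\<^sup>2 \<le> Re (\<tau> (adj A x \<otimes> x))"
proof -
  have "\<tau> (adj A (x \<oplus> (- \<tau> x) \<odot> \<one>) \<otimes> (x \<oplus> (- \<tau> x) \<odot> \<one>)) = \<tau> (adj A x \<otimes> x) - \<tau> x * cnj (\<tau> x)"
    unfolding tau_expand[OF x] by (simp add: tau_adj x)
  then have "0 \<le> Re (\<tau> (adj A x \<otimes> x) - \<tau> x * cnj (\<tau> x))"
    using tau_pos[of "x \<oplus> (- \<tau> x) \<odot> \<one>"] x by auto
  then show ?thesis by (simp add: complex_mult_cnj cmod_power2)
qed

context
  fixes u assumes u: "unitary A u"
begin

text \<open>Cauchy-Schwarz leads to the trace of the squared modulus of \<open>f\<close> at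
  \<open>u\<close>, since the trace property removes \<open>w\<close>. This is at most the square of
  \<open>M\<close>, because the difference is the squared modulus of \<open>q\<close> and so has
  nonnegative trace.\<close>

lemma tau_fcal_bound:
  assumes f: "cper f" and M: "\<And>x. cmod (f x) \<le> M" and w: "unitary A w"
  shows "cmod (\<tau> (fcal A u f \<otimes> w)) \<le> M"
proof -
  have M0: "M \<ge> 0" using M[of 0] norm_ge_zero order_trans by blast
  define q :: "real \<Rightarrow> complex" where "q x = of_real (sqrt (M\<^sup>2 - (cmod (f x))\<^sup>2))" for x
  have q: "cper q"
    using cper_continuous_on[OF f, of UNIV] f unfolding q_def cper_def
    by (auto intro!: continuous_intros)
  have qq: "cnj (q x) * q x = of_real (M\<^sup>2) + (-1) * (cnj (f x) * f x)" for x
  proof -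
    have "(cmod (f x))\<^sup>2 \<le> M\<^sup>2" using M[of x] by (intro power_mono) auto
    then have "cnj (q x) * q x = of_real (M\<^sup>2 - (cmod (f x))\<^sup>2)"
      by (simp add: q_def flip: of_real_mult)
    also have "\<dots> = of_real (M\<^sup>2) + (-1) * (cnj (f x) * f x)"
      using complex_norm_square[of "f x"] by (simp add: mult.commute)
    finally show ?thesis .
  qed
  define x where "x = fcal A u f \<otimes> w"
  have c: "fcal A u f \<in> carrier A" "fcal A u q \<in> carrier A" "x \<in> carrier A" "w \<in> carrier A"
    using fcal_carrier[OF u] f q w by (auto simp: x_def)
  have "\<tau> (adj A x \<otimes> x) = \<tau> ((adj A w \<otimes> (adj A (fcal A u f) \<otimes> fcal A u f)) \<otimes> w)"
    using c by (simp add: x_def adj_mult m_assoc)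
  also have "\<dots> = \<tau> (w \<otimes> (adj A w \<otimes> (adj A (fcal A u f) \<otimes> fcal A u f)))"
    using c by (intro tau_commute) auto
  also have "\<dots> = \<tau> (adj A (fcal A u f) \<otimes> fcal A u f)"
    using c w by simp
  finally have 1: "\<tau> (adj A x \<otimes> x) = \<tau> (adj A (fcal A u f) \<otimes> fcal A u f)" .
  have "adj A (fcal A u q) \<otimes> fcal A u q = fcal A u (\<lambda>x. cnj (q x) * q x)"
    using q cper_cnj[OF q] by (simp add: fcal_mult[OF u] fcal_adj[OF u])
  also have "\<dots> = fcal A u (\<lambda>x. of_real (M\<^sup>2) + (-1) * (cnj (f x) * f x))"
    unfolding qq ..
  also have "\<dots> = fcal A u (\<lambda>x. of_real (M\<^sup>2)) \<oplus> fcal A u (\<lambda>x. (-1) * (cnj (f x) * f x))"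
    by (intro fcal_add u cper_const cper_mult cper_cnj f)
  also have "fcal A u (\<lambda>x. (-1) * (cnj (f x) * f x)) = (-1) \<odot> fcal A u (\<lambda>x. cnj (f x) * f x)"
    by (intro fcal_smult u cper_const cper_mult cper_cnj f)
  also have "fcal A u (\<lambda>x. cnj (f x) * f x) = adj A (fcal A u f) \<otimes> fcal A u f"
    using f cper_cnj[OF f] by (simp add: fcal_mult[OF u] fcal_adj[OF u])
  also have "fcal A u (\<lambda>x. of_real (M\<^sup>2)) = of_real (M\<^sup>2) \<odot> \<one>"
    by (rule fcal_const[OF u])
  finally have "\<tau> (adj A (fcal A u q) \<otimes> fcal A u q) = of_real (M\<^sup>2) - \<tau> (adj A x \<otimes> x)"
    using c 1 by (simp add: tau_add tau_smult tau_one)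
  then have "Re (\<tau> (adj A x \<otimes> x)) \<le> M\<^sup>2"
    using tau_pos[OF c(2)] by simp
  then have "(cmod (\<tau> x))\<^sup>2 \<le> M\<^sup>2"
    using tau_Cauchy_Schwarz[OF c(3)] by simp
  then show ?thesis using M0 unfolding x_def by (rule power2_le_imp_le)
qed

text \<open>Both sides are additive and bounded by the sup norm, and they agree on trigonometric
  polynomials, which are dense. It is applied with \<open>L = 0\<close> and with the integral over a
  period.\<close>

lemma tau_fcal_functional:
  fixes L :: "(real \<Rightarrow> complex) \<Rightarrow> complex"
  assumes f: "cper f" and w: "unitary A w"
    and L_add: "\<And>f g. cper f \<Longrightarrow> cper g \<Longrightarrow> L (\<lambda>x. f x + g x) = L f + L g"
    and L_bound: "\<And>f M. cper f \<Longrightarrow> (\<And>x. cmod (f x) \<le> M) \<Longrightarrow> cmod (L f) \<le> M"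
    and L_ex: "\<And>c k. L (\<lambda>x. c * ex (of_int k * x)) = c * \<tau> (upow A u k \<otimes> w)"
  shows "\<tau> (fcal A u f \<otimes> w) = L f"
proof -
  have tp: "\<tau> (b \<otimes> w) = L g" if "tp A u d g b" for d g b
    using that
  proof (induction rule: tp.induct)
    case (tp_mono k c)
    then show ?case using u w by (simp add: L_ex smult_mult tau_smult)
  next
    case (tp_add f a g b)
    then show ?case using w tp_carrier[OF u tp_add.hyps(1)] tp_carrier[OF u tp_add.hyps(2)]
        tp_cper[OF tp_add.hyps(1)] tp_cper[OF tp_add.hyps(2)]
      by (simp add: L_add l_distr tau_add)
  qed
  have "cmod (\<tau> (fcal A u f \<otimes> w) - L f) \<le> 0 + e" if e: "e > 0" for e
  proof -
    obtain d g b where g: "0 \<le> d" "tp A u d g b" "\<And>x. cmod (f x - g x) \<le> e / 2"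
      using tp_dense[OF u f, of "e / 2"] e by auto
    define h where "h x = f x + (-1) * g x" for x
    have cg: "cper g" using tp_cper[OF g(2)] .
    have ch: "cper h" unfolding h_def by (intro cper_add cper_mult cper_const f cg)
    have hb: "cmod (h x) \<le> e / 2" for x using g(3)[of x] by (simp add: h_def)
    have f_eq: "f = (\<lambda>x. h x + g x)" by (simp add: h_def)
    have "fcal A u g = b" by (rule fcal_eqI[OF u fc_tp[OF u g(1) g(2)]])
    then have "fcal A u f = fcal A u h \<oplus> b"
      unfolding f_eq by (simp add: fcal_add[OF u ch cg])
    moreover have "L f = L h + L g" unfolding f_eq by (rule L_add[OF ch cg])
    ultimately have "\<tau> (fcal A u f \<otimes> w) - L f = \<tau> (fcal A u h \<otimes> w) - L h"
      using w tp_carrier[OF u g(2)] fcal_carrier[OF u ch] tp[OF g(2)]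
      by (simp add: l_distr tau_add)
    then show ?thesis
      using norm_triangle_ineq4[of "\<tau> (fcal A u h \<otimes> w)" "L h"] tau_fcal_bound[OF ch hb w] L_bound[OF ch hb]
      by simp
  qed
  then have "cmod (\<tau> (fcal A u f \<otimes> w) - L f) \<le> 0" by (rule field_le_epsilon)
  then show ?thesis by simp
qed

lemma tau_fcal_eq_0:
  assumes "cper f" "unitary A w" "\<And>k. \<tau> (upow A u k \<otimes> w) = 0"
  shows "\<tau> (fcal A u f \<otimes> w) = 0"
  using assms(1,2) by (rule tau_fcal_functional) (auto simp: assms(3) intro: order_trans[OF norm_ge_zero])

lemma tau_fcal_integral:
  assumes f: "cper f" and tau: "\<And>k. k \<noteq> 0 \<Longrightarrow> \<tau> (upow A u k) = 0"
  shows "\<tau> (fcal A u f) = integral {0..1} f"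
proof -
  have "\<tau> (fcal A u f \<otimes> \<one>) = integral {0..1} f"
    using f unitary_one
  proof (rule tau_fcal_functional)
    fix f g assume "cper f" "cper g"
    then show "integral {0..1} (\<lambda>x. f x + g x) = integral {0..1} f + integral {0..1} g"
      by (intro integral_add integrable_continuous_real cper_continuous_on)
  next
    fix f M assume "cper f" "\<And>x. cmod (f x) \<le> M"
    then have "cmod (integral {0..1} f) \<le> M * (1 - 0)"
      by (intro integral_bound cper_continuous_on) auto
    then show "cmod (integral {0..1} f) \<le> M" by simp
  next
    fix c k
    have "((\<lambda>x. c * ex (of_int k * x)) has_integral (c * (if k = 0 then 1 else 0))) {0..1}"
      by (intro has_integral_mult_right has_integral_ex)
    then show "integral {0..1} (\<lambda>x. c * ex (of_int k * x)) = c * \<tau> (upow A u k \<otimes> \<one>)"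
      using tau[of k] u by (cases "k = 0") (auto simp: tau_one dest!: integral_unique)
  qed
  then show ?thesis using fcal_carrier[OF u f] by simp
qed

end

end

section \<open>Rieffel projections\<close>

lemma cper_frac:
  assumes cont: "continuous_on {0..1} G" and eq: "G 0 = G (1::real)"
  shows "cper (\<lambda>x. G (frac x))"
  unfolding cper_def
proof
  show "\<forall>x. G (frac (x + 1)) = G (frac x)" by (simp add: frac_1_eq)
  have piece: "continuous_on {of_int n..of_int n + 1} (\<lambda>x. G (frac x))" for n :: int
  proof (rule continuous_on_eq)
    show "continuous_on {of_int n..of_int n + 1} (\<lambda>x. G (x - of_int n))"
      by (intro continuous_on_compose2[OF cont] continuous_intros) auto
    fix x :: real assume x: "x \<in> {of_int n..of_int n + 1}"
    show "G (x - of_int n) = G (frac x)"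
    proof (cases "x = of_int n + 1")
      case True
      then have "frac x = 0" by (metis frac_eq_0_iff Ints_of_int of_int_1 of_int_add)
      then show ?thesis using True eq by simp
    next
      case False
      then have "\<lfloor>x\<rfloor> = n" using x by (intro floor_unique) auto
      then show ?thesis by (simp add: frac_def)
    qed
  qed
  show "continuous_on UNIV (\<lambda>x. G (frac x))"
  proof (clarsimp simp: continuous_on_eq_continuous_at)
    fix x :: real
    define n where "n = \<lfloor>x\<rfloor>"
    \<comment> \<open>Two adjacent unit intervals cover a neighbourhood of \<open>x\<close> even
      when \<open>x\<close> is an integer, where \<open>frac\<close> jumps.\<close>
    have "continuous_on ({of_int (n - 1)..of_int (n - 1) + 1} \<union> {of_int n..of_int n + 1}) (\<lambda>x. G (frac x))"
      by (intro continuous_on_closed_Un piece) auto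
    then have "continuous_on {of_int n - 1<..<of_int n + 1} (\<lambda>x. G (frac x))"
      by (rule continuous_on_subset) auto
    moreover have "x \<in> {of_int n - 1<..<of_int n + 1}"
      unfolding n_def by (simp; linarith)
    ultimately show "isCont (\<lambda>x. G (frac x)) x"
      using continuous_on_eq_continuous_at open_greaterThanLessThan by blast
  qed
qed

text \<open>The square of \<open>bump\<close> is a difference of \<open>\<theta>\<close>-translates of \<open>ramp\<close>, so its own
  \<open>\<theta>\<close>-translates telescope to 1.\<close>

definition ramp :: "real \<Rightarrow> real \<Rightarrow> real" where
  "ramp \<theta> x = max 0 (min 1 (x / (1 - \<theta>)))"

definition bump :: "real \<Rightarrow> real \<Rightarrow> real" where
  "bump \<theta> x = sqrt (ramp \<theta> x - ramp \<theta> (x - \<theta>))"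

locale unit_theta =
  fixes \<theta> :: real assumes theta: "0 < \<theta>" "\<theta> < 1"
begin

lemma ramp_mono: "x \<le> y \<Longrightarrow> ramp \<theta> x \<le> ramp \<theta> y"
proof -
  assume "x \<le> y"
  then have "x / (1 - \<theta>) \<le> y / (1 - \<theta>)" using theta by (intro divide_right_mono) auto
  then show ?thesis by (auto simp: ramp_def)
qed

lemma ramp_eq_0: "x \<le> 0 \<Longrightarrow> ramp \<theta> x = 0"
  using theta by (auto simp: ramp_def divide_nonpos_pos)

lemma ramp_eq_1: "x \<ge> 1 - \<theta> \<Longrightarrow> ramp \<theta> x = 1"
  using theta by (auto simp: ramp_def divide_simps)

lemma bump_power2: "(bump \<theta> x)\<^sup>2 = ramp \<theta> x - ramp \<theta> (x - \<theta>)"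
  unfolding bump_def using ramp_mono[of "x - \<theta>" x] theta by simp

lemma bump_eq_0: "x \<notin> {0<..<1} \<Longrightarrow> bump \<theta> x = 0"
  using theta ramp_eq_0[of x] ramp_eq_0[of "x - \<theta>"] ramp_eq_1[of x] ramp_eq_1[of "x - \<theta>"]
  by (cases "x \<le> 0") (auto simp: bump_def)

lemma continuous_on_bump [continuous_intros]:
  "continuous_on S g \<Longrightarrow> continuous_on S (\<lambda>x. bump \<theta> (g x))"
  unfolding bump_def ramp_def using theta by (intro continuous_intros) auto

text \<open>\<open>S\<close> contains every index with a nonzero summand, so it may be exchanged for
  a large symmetric interval. There the differences of \<open>ramp\<close> telescope to its value 1
  far to the right minus its value 0 far to the left.\<close>

lemma bump_partition:
  assumes S: "finite S" "\<And>k::int. bump \<theta> (z + of_int k * \<theta>) \<noteq> 0 \<Longrightarrow> k \<in> S"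
  shows "(\<Sum>k\<in>S. (bump \<theta> (z + of_int k * \<theta>))\<^sup>2) = 1"
proof -
  obtain N :: nat where N: "real N * \<theta> \<ge> \<bar>z\<bar> + 1" "\<And>k. k \<in> S \<Longrightarrow> \<bar>k\<bar> \<le> int N"
  proof -
    obtain N1 :: nat where N1: "real N1 > (\<bar>z\<bar> + 1) / \<theta>" using reals_Archimedean2 by blast
    obtain N2 where N2: "\<And>k. k \<in> S \<Longrightarrow> nat \<bar>k\<bar> \<le> N2"
      using finite_nat_set_iff_bounded_le[of "(\<lambda>k. nat \<bar>k\<bar>) ` S"] S(1) by auto
    have "real (max N1 N2) * \<theta> \<ge> \<bar>z\<bar> + 1"
    proof -
      have "\<bar>z\<bar> + 1 \<le> real N1 * \<theta>" using N1 theta by (simp add: divide_simps)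
      also have "\<dots> \<le> real (max N1 N2) * \<theta>" using theta by (intro mult_right_mono) auto
      finally show ?thesis .
    qed
    moreover have "\<bar>k\<bar> \<le> int (max N1 N2)" if "k \<in> S" for k using N2[OF that] by linarith
    ultimately show ?thesis using that by blast
  qed
  have "(\<Sum>k\<in>S. (bump \<theta> (z + of_int k * \<theta>))\<^sup>2)
      = (\<Sum>k\<in>{-int N..int N}. (bump \<theta> (z + of_int k * \<theta>))\<^sup>2)"
    using S N(2) by (intro sum.mono_neutral_left) force+
  also have "\<dots> = (\<Sum>k\<in>{-int N..int N}. ramp \<theta> (z + of_int k * \<theta>) - ramp \<theta> (z + of_int (k - 1) * \<theta>))"
    by (intro sum.cong) (auto simp: bump_power2 algebra_simps)
  also have "\<dots> = ramp \<theta> (z + of_int (int N) * \<theta>) - ramp \<theta> (z + of_int (- int N - 1) * \<theta>)"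
  proof -
    have "(\<Sum>k\<in>{-int m..int m}. F k - F (k - 1)) = F (int m) - F (- int m - 1)" for m and F :: "int \<Rightarrow> real"
    proof (induction m)
      case (Suc m)
      have "{-int (Suc m)..int (Suc m)} = insert (int (Suc m)) (insert (- int (Suc m)) {-int m..int m})"
        by auto
      moreover have "F (- int m - 1) = F (- 1 - int m)" by (rule arg_cong[where f = F]) simp
      ultimately show ?case using Suc by (simp add: algebra_simps)
    qed simp
    from this[of "\<lambda>k. ramp \<theta> (z + of_int k * \<theta>)" N] show ?thesis .
  qed
  also have "\<dots> = 1"
  proof -
    have "z + of_int (int N) * \<theta> \<ge> 1 - \<theta>" "z + of_int (- int N - 1) * \<theta> \<le> 0"
      using N(1) theta abs_ge_self[of z] abs_ge_minus_self[of z] by (simp_all add: algebra_simps)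
    then show ?thesis by (simp add: ramp_eq_1 ramp_eq_0)
  qed
  finally show ?thesis .
qed

text \<open>Both ramps rise along a piece of length \<open>1 - \<theta>\<close> inside the unit
  interval; the unshifted one then stays at 1 for the remaining length \<open>\<theta>\<close>,
  which is the difference of the integrals.\<close>

lemma integral_bump_power2: "((\<lambda>x. (bump \<theta> x)\<^sup>2) has_integral \<theta>) {0..1}"
proof -
  define s where "s = 1 - \<theta>"
  have s: "0 < s" "s < 1" using theta by (auto simp: s_def)
  have lin: "((\<lambda>x. (x - c) / s) has_integral (s / 2)) {c..c + s}" for c :: real
  proof -
    have "((\<lambda>x. (x - c) / s) has_integral ((c + s - c)\<^sup>2 / (2 * s) - (c - c)\<^sup>2 / (2 * s))) {c..c + s}"
      using s by (intro fundamental_theorem_of_calculus)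
        (auto intro!: derivative_eq_intros simp: has_real_derivative_iff_has_vector_derivative[symmetric] field_simps)
    then show ?thesis using s by (simp add: power2_eq_square)
  qed
  have a: "((\<lambda>x. ramp \<theta> x) has_integral (s / 2 + (1 - s))) {0..1}"
  proof (rule has_integral_combine[of 0 s 1])
    have "((\<lambda>x. (x - 0) / s) has_integral (s / 2)) {0..s}" using lin[of 0] by simp
    then show "(ramp \<theta> has_integral s / 2) {0..s}"
      by (rule has_integral_eq[rotated]) (use s in \<open>auto simp: ramp_def s_def\<close>)
    have "((\<lambda>x. 1) has_integral (1 - s)) {s..1}" using has_integral_const_real[of "1::real" s 1] s by simp
    then show "(ramp \<theta> has_integral 1 - s) {s..1}"
      by (rule has_integral_eq[rotated]) (auto simp: ramp_eq_1 s_def)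
  qed (use s in auto)
  have b: "((\<lambda>x. ramp \<theta> (x - \<theta>)) has_integral (0 + s / 2)) {0..1}"
  proof (rule has_integral_combine[of 0 \<theta> 1])
    have "((\<lambda>x. 0) has_integral (0::real)) {0..\<theta>}" by simp
    then show "((\<lambda>x. ramp \<theta> (x - \<theta>)) has_integral 0) {0..\<theta>}"
      by (rule has_integral_eq[rotated]) (auto simp: ramp_eq_0)
    have "((\<lambda>x. (x - \<theta>) / s) has_integral (s / 2)) {\<theta>..1}" using lin[of \<theta>] by (simp add: s_def)
    then show "((\<lambda>x. ramp \<theta> (x - \<theta>)) has_integral s / 2) {\<theta>..1}"
      by (rule has_integral_eq[rotated]) (use s in \<open>auto simp: ramp_def s_def divide_simps\<close>)
  qed (use theta in auto)
  have "((\<lambda>x. ramp \<theta> x - ramp \<theta> (x - \<theta>)) has_integral (s / 2 + (1 - s) - (0 + s / 2))) {0..1}"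
    by (intro has_integral_diff a b)
  then show ?thesis by (simp add: bump_power2 s_def)
qed

text \<open>The kernel of the partial isometry transporting the Rieffel projection along a unitary of
  type \<open>(a, b)\<close>. In the module picture the unitary acts on functions by
  \<open>\<xi>(x) \<mapsto> ex (- b x / \<theta>) \<xi>(x + a)\<close>.\<close>

definition hk :: "real \<Rightarrow> real \<Rightarrow> int \<Rightarrow> real \<Rightarrow> complex" where
  "hk a b k x = of_real (bump \<theta> (frac x) * bump \<theta> (frac x + of_int k * \<theta> + a))
     * ex (b * (frac x + of_int k * \<theta>) / \<theta>)"

text \<open>\<open>bump\<close> vanishes at 0 and at 1, so the jump of \<open>frac\<close> at the
  integers is invisible.\<close>

lemma cper_hk [simp]: "cper (hk a b k)"
proof -
  define G :: "real \<Rightarrow> complex" where "G y = of_real (bump \<theta> y * bump \<theta> (y + of_int k * \<theta> + a)) * ex (b * (y + of_int k * \<theta>) / \<theta>)" for y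
  have "cper (\<lambda>x. G (frac x))"
  proof (rule cper_frac)
    show "continuous_on {0..1} G" unfolding G_def using theta by (intro continuous_intros) auto
    show "G 0 = G 1" by (simp add: G_def bump_eq_0)
  qed
  then show ?thesis by (simp add: G_def hk_def[abs_def])
qed

lemma hk_eq_0: "\<bar>of_int k * \<theta> + a\<bar> \<ge> 1 \<Longrightarrow> hk a b k x = 0"
proof -
  assume *: "\<bar>of_int k * \<theta> + a\<bar> \<ge> 1"
  have "frac x \<notin> {0<..<1} \<or> frac x + of_int k * \<theta> + a \<notin> {0<..<1}" 
    unfolding greaterThanLessThan_iff using * by linarith
  then show ?thesis using bump_eq_0 by (auto simp: hk_def)
qed

text \<open>Outside this set \<open>hk a b k\<close> vanishes: where both bump factors are nonzero,
  their arguments lie in the open unit interval and are less than 1 apart. Finiteness of the set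
  makes the transport below a finite sum.\<close>

definition hsupp :: "real \<Rightarrow> int set" where
  "hsupp a = {k. \<bar>of_int k * \<theta> + a\<bar> < 1}"

lemma finite_hsupp [simp]: "finite (hsupp a)"
proof (rule finite_subset)
  show "hsupp a \<subseteq> {- \<lceil>(1 + \<bar>a\<bar>) / \<theta>\<rceil>..\<lceil>(1 + \<bar>a\<bar>) / \<theta>\<rceil>}"
  proof
    fix k assume "k \<in> hsupp a"
    then have "\<bar>of_int k * \<theta>\<bar> \<le> 1 + \<bar>a\<bar>" by (auto simp: hsupp_def)
    then have "\<bar>of_int k\<bar> * \<theta> \<le> 1 + \<bar>a\<bar>" using theta by (simp add: abs_mult)
    then have "\<bar>of_int k\<bar> \<le> (1 + \<bar>a\<bar>) / \<theta>" using theta by (simp add: divide_simps)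
    then have "\<bar>of_int k\<bar> \<le> (of_int \<lceil>(1 + \<bar>a\<bar>) / \<theta>\<rceil> :: real)" using le_of_int_ceiling order_trans by blast
    then have "\<bar>k\<bar> \<le> \<lceil>(1 + \<bar>a\<bar>) / \<theta>\<rceil>" by linarith
    then show "k \<in> {- \<lceil>(1 + \<bar>a\<bar>) / \<theta>\<rceil>..\<lceil>(1 + \<bar>a\<bar>) / \<theta>\<rceil>}" by auto
  qed
qed simp

text \<open>The composition rule for kernels. The shifted argument on the left comes from moving
  \<open>V k \<otimes> U\<close> past a function of \<open>u\<close>, the phase
  \<open>ex (of_int j * b)\<close> from moving \<open>U\<close> past \<open>V j\<close>. The phase
  on the right is the same for all \<open>j\<close> and \<open>k\<close>, so it can be pulled out of
  the sums later.\<close>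

lemma hk_mult:
  "ex (of_int j * b) * (hk a b k x * hk a' b' j (x + (of_int k * \<theta> + a)))
   = ex (a * b' / \<theta>) * (of_real ((bump \<theta> (frac x + a + of_int k * \<theta>))\<^sup>2) * hk (a + a') (b + b') (k + j) x)"
proof -
  define y where "y = frac x"
  define z where "z = frac (x + (of_int k * \<theta> + a))"
  define w where "w = y + of_int k * \<theta> + a"
  show ?thesis
  \<comment> \<open>Outside the open unit interval both sides contain the factor
    \<open>bump \<theta> w = 0\<close>; inside, \<open>w\<close> is itself the fractional part of
    the shifted argument.\<close>
  proof (cases "w \<in> {0<..<1}")
    case False
    then have "bump \<theta> w = 0" by (rule bump_eq_0)
    then have "bump \<theta> (frac x + a + of_int k * \<theta>) = 0" "bump \<theta> (frac x + of_int k * \<theta> + a) = 0"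
      by (simp_all add: w_def y_def add_ac)
    then show ?thesis by (simp add: hk_def)
  next
    case True
    have "x + (of_int k * \<theta> + a) - w = of_int \<lfloor>x\<rfloor>" by (simp add: w_def y_def frac_def)
    then have "\<lfloor>x + (of_int k * \<theta> + a)\<rfloor> = \<lfloor>x\<rfloor>" using True by (intro floor_unique) auto
    then have z: "z = w" by (simp add: z_def w_def y_def frac_def)
    have e: "ex (of_int j * b) * (ex (b * (y + of_int k * \<theta>) / \<theta>) * ex (b' * (w + of_int j * \<theta>) / \<theta>))
        = ex (a * b' / \<theta>) * ex ((b + b') * (y + of_int (k + j) * \<theta>) / \<theta>)"
    proof -
      have q: "b * t / \<theta> = (b / \<theta>) * t" "b' * t / \<theta> = (b' / \<theta>) * t"
        "(b + b') * t / \<theta> = (b / \<theta> + b' / \<theta>) * t" "a * b' / \<theta> = a * (b' / \<theta>)"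
        "of_int j * b = of_int j * (b / \<theta>) * \<theta>" for t
        using theta by (simp_all add: add_divide_distrib distrib_right)
      have "of_int j * b + (b * (y + of_int k * \<theta>) / \<theta> + b' * (w + of_int j * \<theta>) / \<theta>)
        = a * b' / \<theta> + (b + b') * (y + of_int (k + j) * \<theta>) / \<theta>"
        unfolding q w_def by (simp add: algebra_simps)
      then show ?thesis unfolding ex_add[symmetric] by (rule arg_cong)
    qed
    have "ex (of_int j * b) * (hk a b k x * hk a' b' j (x + (of_int k * \<theta> + a)))
      = of_real (bump \<theta> y * bump \<theta> w * (bump \<theta> w * bump \<theta> (w + of_int j * \<theta> + a')))
        * (ex (of_int j * b) * (ex (b * (y + of_int k * \<theta>) / \<theta>) * ex (b' * (w + of_int j * \<theta>) / \<theta>)))"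
      unfolding hk_def z_def[symmetric] y_def[symmetric] z w_def[symmetric] by simp
    also have "\<dots> = ex (a * b' / \<theta>) * (of_real ((bump \<theta> w)\<^sup>2) * (of_real (bump \<theta> y * bump \<theta> (w + of_int j * \<theta> + a'))
        * ex ((b + b') * (y + of_int (k + j) * \<theta>) / \<theta>)))"
      unfolding e by (simp add: power2_eq_square mult_ac)
    also have "w + of_int j * \<theta> + a' = y + of_int (k + j) * \<theta> + (a + a')"
      by (simp add: w_def algebra_simps)
    also have "w = frac x + a + of_int k * \<theta>" by (simp add: w_def y_def)
    finally show ?thesis by (simp add: hk_def y_def)
  qed
qed

lemma hk_adj:
  "cnj (hk a b k (x - (of_int k * \<theta> + a))) * ex (of_int k * b) = ex (a * b / \<theta>) * hk (- a) (- b) (- k) x"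
proof -
  define y where "y = frac x"
  define z where "z = frac (x - (of_int k * \<theta> + a))"
  define w where "w = y - of_int k * \<theta> - a"
  \<comment> \<open>\<open>z\<close> and \<open>w\<close> agree modulo integers. If they differ,
    each of the two products has a factor evaluated outside the open unit interval, so both
    vanish.\<close>
  have zw: "bump \<theta> z * bump \<theta> (z + of_int k * \<theta> + a) = bump \<theta> y * bump \<theta> w
     \<and> (bump \<theta> y * bump \<theta> w \<noteq> 0 \<longrightarrow> z = w)"
  proof -
    obtain m :: int where m: "z = w + of_int m"
      by (rule that[of "\<lfloor>x\<rfloor> - \<lfloor>x - (of_int k * \<theta> + a)\<rfloor>"]) (simp add: z_def w_def y_def frac_def)
    have y: "0 \<le> y" "y < 1" and z: "0 \<le> z" "z < 1"
      by (simp_all add: y_def z_def frac_lt_1)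
    have int: "m = 0" if "0 \<le> r" "r < 1" "r + of_int m \<in> {0<..<1}" for r :: real
    proof -
      have "of_int m < (1::real)" "of_int m > (-1::real)" using that by auto
      then show ?thesis by linarith
    qed
    show ?thesis
    proof (cases "m = 0")
      case True
      then show ?thesis using m by (simp add: w_def)
    next
      case False
      have "z + of_int k * \<theta> + a \<notin> {0<..<1}"
      proof
        assume "z + of_int k * \<theta> + a \<in> {0<..<1}"
        then have "y + of_int m \<in> {0<..<1}" using m by (simp add: w_def)
        then show False using False y int by blast
      qed
      moreover have "w \<notin> {0<..<1}"
      proof
        assume "w \<in> {0<..<1}"
        then have "of_int m < (1::real)" "of_int m > (-1::real)" using m z by auto
        then show False using False by linarith
      qed
      ultimately show ?thesis using bump_eq_0 by simp
    qed
  qed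
  have e: "ex (- (b * (w + of_int k * \<theta>) / \<theta>)) * ex (of_int k * b)
      = ex (a * b / \<theta>) * ex ((- b) * (y + of_int (- k) * \<theta>) / \<theta>)"
  proof -
    have q: "b * t / \<theta> = (b / \<theta>) * t" "- b * t / \<theta> = - (b / \<theta>) * t" "a * b / \<theta> = a * (b / \<theta>)"
      "of_int k * b = of_int k * (b / \<theta>) * \<theta>" for t
      using theta by simp_all
    have "- (b * (w + of_int k * \<theta>) / \<theta>) + of_int k * b
      = a * b / \<theta> + (- b) * (y + of_int (- k) * \<theta>) / \<theta>"
      unfolding q w_def by (simp add: algebra_simps diff_divide_distrib)
    then show ?thesis unfolding ex_add[symmetric] by (rule arg_cong)
  qed
  have "cnj (hk a b k (x - (of_int k * \<theta> + a))) * ex (of_int k * b)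
      = of_real (bump \<theta> y * bump \<theta> w) * (ex (- (b * (z + of_int k * \<theta>) / \<theta>)) * ex (of_int k * b))"
    unfolding hk_def z_def[symmetric] using zw by (simp add: ex_minus)
  also have "\<dots> = of_real (bump \<theta> y * bump \<theta> w) * (ex (- (b * (w + of_int k * \<theta>) / \<theta>)) * ex (of_int k * b))"
    using zw by (cases "bump \<theta> y * bump \<theta> w = 0") auto
  also have "\<dots> = ex (a * b / \<theta>) * hk (- a) (- b) (- k) x"
    unfolding e by (simp add: hk_def y_def w_def algebra_simps)
  finally show ?thesis .
qed

text \<open>Where \<open>hk\<close> is nonzero, \<open>frac x\<close> lies in the open unit
  interval; all nonzero translates of \<open>bump\<close> then have their index in
  \<open>hsupp a\<close>, and \<open>bump_partition\<close> applies.\<close>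

lemma sum_bump_hk:
  "(\<Sum>k\<in>hsupp a. of_real ((bump \<theta> (frac x + a + of_int k * \<theta>))\<^sup>2) * hk c b K x) = hk c b K x"
proof (cases "frac x \<in> {0<..<1}")
  case False
  then have "hk c b K x = 0" by (simp add: hk_def bump_eq_0)
  then show ?thesis by simp
next
  case True
  have "(\<Sum>k\<in>hsupp a. (bump \<theta> (frac x + a + of_int k * \<theta>))\<^sup>2) = 1"
  proof (rule bump_partition)
    fix k assume "bump \<theta> (frac x + a + of_int k * \<theta>) \<noteq> 0"
    then have "frac x + a + of_int k * \<theta> \<in> {0<..<1}" using bump_eq_0 by blast
    then show "k \<in> hsupp a" using True
      unfolding hsupp_def mem_Collect_eq greaterThanLessThan_iff by linarith
  qed simp
  then have "(\<Sum>k\<in>hsupp a. complex_of_real ((bump \<theta> (frac x + a + of_int k * \<theta>))\<^sup>2)) = 1"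
    by (metis of_real_1 of_real_sum)
  then show ?thesis by (simp add: sum_distrib_right[symmetric])
qed

lemma integral_hk_0: "integral {0..1} (hk 0 0 0) = of_real \<theta>"
proof -
  have "((\<lambda>x. complex_of_real ((bump \<theta> x)\<^sup>2)) has_integral of_real \<theta>) {0..1}"
    using integral_bump_power2 by (rule has_integral_of_real)
  then have "(hk 0 0 0 has_integral of_real \<theta>) {0..1}"
  proof (rule has_integral_eq[rotated])
    fix x :: real assume "x \<in> {0..1}"
    then show "complex_of_real ((bump \<theta> x)\<^sup>2) = hk 0 0 0 x"
      by (cases "x = 1") (auto simp: hk_def power2_eq_square bump_eq_0 frac_eq)
  qed
  then show ?thesis by (rule integral_unique)
qed

end

context cstar_algebra
begin

lemma finsum_superset:
  assumes "finite T" "S \<subseteq> T" "f \<in> T \<rightarrow> carrier A" "\<And>i. i \<in> T - S \<Longrightarrow> f i = \<zero>"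
  shows "(\<Oplus>i\<in>S. f i) = (\<Oplus>i\<in>T. f i)"
proof -
  have "(\<Oplus>i\<in>S \<union> (T - S). f i) = (\<Oplus>i\<in>S. f i) \<oplus> (\<Oplus>i\<in>T - S. f i)"
    using assms by (intro finsum_Un_disjoint) (auto dest: finite_subset)
  moreover have "(\<Oplus>i\<in>T - S. f i) = (\<Oplus>i\<in>T - S. \<zero>)"
    using assms by (intro finsum_cong') auto
  moreover have "S \<union> (T - S) = T" using assms by auto
  moreover have "(\<Oplus>i\<in>S. f i) \<in> carrier A" using assms by (intro finsum_closed) auto
  ultimately show ?thesis by (simp add: finsum_zero)
qed

lemma finsum_swap:
  assumes "finite S" "finite T" "\<And>i j. i \<in> S \<Longrightarrow> j \<in> T \<Longrightarrow> f i j \<in> carrier A"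
  shows "(\<Oplus>i\<in>S. \<Oplus>j\<in>T. f i j) = (\<Oplus>j\<in>T. \<Oplus>i\<in>S. f i j)"
  using assms(1,3)
proof (induction S rule: finite_induct)
  case empty
  then show ?case by (simp add: finsum_zero)
next
  case (insert i S)
  have 1: "(\<lambda>j. f i j) \<in> T \<rightarrow> carrier A" "(\<lambda>i. \<Oplus>j\<in>T. f i j) \<in> insert i S \<rightarrow> carrier A"
    "(\<lambda>j. \<Oplus>i\<in>S. f i j) \<in> T \<rightarrow> carrier A"
    using insert by (auto intro!: finsum_closed)
  have "(\<Oplus>i\<in>insert i S. \<Oplus>j\<in>T. f i j) = (\<Oplus>j\<in>T. f i j) \<oplus> (\<Oplus>i\<in>S. \<Oplus>j\<in>T. f i j)"
    using insert 1 by (intro finsum_insert) auto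
  also have "(\<Oplus>i\<in>S. \<Oplus>j\<in>T. f i j) = (\<Oplus>j\<in>T. \<Oplus>i\<in>S. f i j)"
    using insert by blast
  also have "(\<Oplus>j\<in>T. f i j) \<oplus> (\<Oplus>j\<in>T. \<Oplus>i\<in>S. f i j) = (\<Oplus>j\<in>T. f i j \<oplus> (\<Oplus>i\<in>S. f i j))"
    using 1 by (intro finsum_addf[symmetric])
  also have "\<dots> = (\<Oplus>j\<in>T. \<Oplus>i\<in>insert i S. f i j)"
  proof (intro finsum_cong' refl)
    show "(\<lambda>j. \<Oplus>i\<in>insert i S. f i j) \<in> T \<rightarrow> carrier A"
      using insert by (auto intro!: finsum_closed)
    fix j assume "j \<in> T"
    then show "f i j \<oplus> (\<Oplus>i\<in>S. f i j) = (\<Oplus>i\<in>insert i S. f i j)"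
      using insert by (intro finsum_insert[symmetric]) auto
  qed
  finally show ?case .
qed

end

section \<open>Unitaries of type \<open>(a, b)\<close> and their transport into the corner\<close>

definition acts :: "'a cstar \<Rightarrow> 'a \<Rightarrow> 'a \<Rightarrow> 'a \<Rightarrow> real \<Rightarrow> real \<Rightarrow> bool" where
  "acts A u v U a b \<longleftrightarrow> unitary A U \<and> U \<otimes>\<^bsub>A\<^esub> u = ex a \<odot>\<^bsub>A\<^esub> (u \<otimes>\<^bsub>A\<^esub> U)
     \<and> U \<otimes>\<^bsub>A\<^esub> v = ex b \<odot>\<^bsub>A\<^esub> (v \<otimes>\<^bsub>A\<^esub> U)"

context cstar_algebra
begin

lemma commute_mult:
  assumes "x \<in> carrier A" "y \<in> carrier A" "w \<in> carrier A"
    and "x \<otimes> w = c \<odot> (w \<otimes> x)" "y \<otimes> w = d \<odot> (w \<otimes> y)"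
  shows "(x \<otimes> y) \<otimes> w = (c * d) \<odot> (w \<otimes> (x \<otimes> y))"
proof -
  have "(x \<otimes> y) \<otimes> w = x \<otimes> (y \<otimes> w)" using assms(1-3) by (simp add: m_assoc)
  also have "\<dots> = d \<odot> ((x \<otimes> w) \<otimes> y)"
    using assms(1-3) by (simp add: assms(5) smult_mult m_assoc)
  also have "\<dots> = (c * d) \<odot> (w \<otimes> (x \<otimes> y))"
    using assms(1-3) unfolding assms(4) by (simp add: smult_mult m_assoc mult.commute)
  finally show ?thesis .
qed

lemma commute_adj:
  assumes x: "unitary A x" and w: "w \<in> carrier A" and "x \<otimes> w = ex a \<odot> (w \<otimes> x)"
  shows "adj A x \<otimes> w = ex (- a) \<odot> (w \<otimes> adj A x)"
proof -
  have "adj A x \<otimes> (x \<otimes> w) \<otimes> adj A x = ex a \<odot> (adj A x \<otimes> w)"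
    using x w by (simp add: assms(3) smult_mult m_assoc)
  moreover have "adj A x \<otimes> (x \<otimes> w) \<otimes> adj A x = w \<otimes> adj A x"
    using x w by simp
  ultimately show ?thesis using x w by (simp add: ex_minus)
qed

lemma acts_unitary: "acts A u v U a b \<Longrightarrow> unitary A U"
  by (simp add: acts_def)

end

locale rotation = cstar_algebra A + unit_theta \<theta>
  for A :: "'a cstar" (structure) and \<theta> :: real +
  fixes u v :: 'a
  assumes u: "unitary A u" and v: "unitary A v" and vu: "v \<otimes> u = ex \<theta> \<odot> (u \<otimes> v)"
begin

lemma acts_one: "acts A u v \<one> 0 0"
  using u v by (simp add: acts_def)

lemma acts_mult:
  assumes "acts A u v U a b" "acts A u v U' a' b'"
  shows "acts A u v (U \<otimes> U') (a + a') (b + b')"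
  using assms u v unfolding acts_def ex_add by (auto intro!: commute_mult unitary_mult)

lemma acts_adj:
  assumes "acts A u v U a b"
  shows "acts A u v (adj A U) (- a) (- b)"
  using assms u v unfolding acts_def by (auto intro!: commute_adj)

abbreviation \<Phi> :: "(real \<Rightarrow> complex) \<Rightarrow> 'a" where
  "\<Phi> f \<equiv> fcal A u f"

abbreviation V :: "int \<Rightarrow> 'a" where
  "V k \<equiv> upow A v k"

lemma V_carrier [simp]: "V k \<in> carrier A"
  using v by simp

lemma \<Phi>_carrier [simp]: "cper f \<Longrightarrow> \<Phi> f \<in> carrier A"
  using fcal_carrier[OF u] .

lemma \<Phi>_zero: "\<Phi> (\<lambda>x. 0) = \<zero>"
  using fcal_const[OF u, of 0] by simp

text \<open>In module terms this is the \<open>A\<close>-valued inner product of \<eta> with W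
  \<eta>, multiplied by \<open>U\<close>, where W is the line operator of type \<open>(a, b)\<close>
  described at \<open>hk\<close>; the coefficient of \<open>V k\<close> in that inner product is
  \<open>hk a b k\<close>. For \<open>U = \<one>\<close> and type \<open>(0, 0)\<close> it is the
  Rieffel projection.\<close>

definition transport :: "'a \<Rightarrow> real \<Rightarrow> real \<Rightarrow> 'a" where
  "transport U a b = (\<Oplus>k\<in>hsupp a. \<Phi> (hk a b k) \<otimes> (V k \<otimes> U))"

lemma transport_superset:
  assumes "finite S" "hsupp a \<subseteq> S" "U \<in> carrier A"
  shows "transport U a b = (\<Oplus>k\<in>S. \<Phi> (hk a b k) \<otimes> (V k \<otimes> U))"
  unfolding transport_def
proof (rule finsum_superset)
  fix k assume "k \<in> S - hsupp a"
  then have "hk a b k = (\<lambda>x. 0)" using hk_eq_0[of k a b] by (auto simp: hsupp_def)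
  then show "\<Phi> (hk a b k) \<otimes> (V k \<otimes> U) = \<zero>" using assms(3) by (simp add: \<Phi>_zero)
qed (use assms in auto)

lemma transport_carrier [simp]: "U \<in> carrier A \<Longrightarrow> transport U a b \<in> carrier A"
  unfolding transport_def by (auto intro!: finsum_closed)

lemma transport_smult: "U \<in> carrier A \<Longrightarrow> transport (c \<odot> U) a b = c \<odot> transport U a b"
  unfolding transport_def by (subst smult_finsum) (auto intro!: finsum_cong' simp: smult_mult)

lemma V_commute_\<Phi>:
  assumes U: "acts A u v U a b" and f: "cper f"
  shows "(V k \<otimes> U) \<otimes> \<Phi> f = \<Phi> (\<lambda>x. f (x + (of_int k * \<theta> + a))) \<otimes> (V k \<otimes> U)"
proof (rule fcal_shift[OF u _ _ f])
  have Uu: "unitary A U" using U by (rule acts_unitary)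
  show "unitary A (V k \<otimes> U)" using v Uu by (intro unitary_mult) auto
  have "V k \<otimes> u = ex (of_int k * \<theta>) \<odot> (u \<otimes> V k)"
  proof -
    have "adj A v \<otimes> u = ex (- \<theta>) \<odot> (u \<otimes> adj A v)" using v u vu by (intro commute_adj) auto
    show ?thesis
    proof (induction k rule: int_induct[where k = 0])
      case base
      then show ?case using u by simp
    next
      case (step1 i)
      have "(V i \<otimes> v) \<otimes> u = (ex (of_int i * \<theta>) * ex \<theta>) \<odot> (u \<otimes> (V i \<otimes> v))"
        using u v vu step1 by (intro commute_mult) auto
      then show ?case using v by (simp add: upow_add_1 distrib_right ex_add)
    next
      case (step2 i)
      have "(V i \<otimes> adj A v) \<otimes> u = (ex (of_int i * \<theta>) * ex (- \<theta>)) \<odot> (u \<otimes> (V i \<otimes> adj A v))"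
        using u v \<open>adj A v \<otimes> u = _\<close> step2 by (intro commute_mult) auto
      then show ?case using v by (simp add: upow_diff_1 left_diff_distrib flip: ex_add)
    qed
  qed
  moreover have "U \<otimes> u = ex a \<odot> (u \<otimes> U)" using U by (simp add: acts_def)
  ultimately show "(V k \<otimes> U) \<otimes> u = ex (of_int k * \<theta> + a) \<odot> (u \<otimes> (V k \<otimes> U))"
    unfolding ex_add using u Uu by (intro commute_mult) auto
qed

lemma acts_commute_V:
  assumes "acts A u v U a b"
  shows "U \<otimes> V k = ex (of_int k * b) \<odot> (V k \<otimes> U)"
  using assms v by (intro upow_commute) (auto simp: acts_def)

text \<open>Conjugation by \<open>U\<close> turns the inner product of \<eta> and W' \<eta> into
  that of W \<eta> and W W' \<eta>. Multiplied by the inner product of \<eta> and W \<eta> it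
  contracts to that of \<eta> and W W' \<eta>, because the squared translates of \<eta> sum to 1;
  and W W' is a scalar times the operator of the added type.\<close>

lemma transport_mult:
  assumes U: "acts A u v U a b" and U': "acts A u v U' a' b'"
  shows "transport U a b \<otimes> transport U' a' b' = ex (a * b' / \<theta>) \<odot> transport (U \<otimes> U') (a + a') (b + b')"
proof -
  have c: "U \<in> carrier A" "U' \<in> carrier A" using assms acts_unitary unitary_carrier by blast+
  define P where "P k = \<Phi> (hk a b k) \<otimes> (V k \<otimes> U)" for k
  define Q where "Q j = \<Phi> (hk a' b' j) \<otimes> (V j \<otimes> U')" for j
  define g where "g k K x = of_real ((bump \<theta> (frac x + a + of_int k * \<theta>))\<^sup>2) * hk (a + a') (b + b') K x" for k K x
  define c0 where "c0 = ex (a * b' / \<theta>)"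
  have g: "cper (g k K)" for k K
  proof -
    \<comment> \<open>The definition of \<open>g\<close> involves \<open>frac\<close> directly; its
      continuity is read off from the product of kernels that it equals up to phases.\<close>
    have "cper (\<lambda>x. cnj c0 * (ex (of_int (K - k) * b) * (hk a b k x * hk a' b' (K - k) (x + (of_int k * \<theta> + a)))))"
      by (intro cper_mult cper_const cper_hk cper_shift)
    moreover have "cnj c0 * (ex (of_int (K - k) * b) * (hk a b k x * hk a' b' (K - k) (x + (of_int k * \<theta> + a)))) = g k K x" for x
      unfolding hk_mult by (simp add: g_def c0_def flip: mult.assoc)
    ultimately show ?thesis by (simp only:)
  qed
  define R where "R k K = (c0 \<odot> \<Phi> (g k K)) \<otimes> (V K \<otimes> (U \<otimes> U'))" for k K
  have Rc: "R k K \<in> carrier A" for k K using g c by (simp add: R_def)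
  have PQ: "P k \<otimes> Q j = R k (k + j)" for k j
  proof -
    let ?h = "\<lambda>x. hk a' b' j (x + (of_int k * \<theta> + a))"
    have h: "cper ?h" by (intro cper_shift cper_hk)
    have "P k \<otimes> Q j = \<Phi> (hk a b k) \<otimes> (((V k \<otimes> U) \<otimes> \<Phi> (hk a' b' j)) \<otimes> (V j \<otimes> U'))"
      using c by (simp add: P_def Q_def m_assoc)
    also have "\<dots> = \<Phi> (hk a b k) \<otimes> (\<Phi> ?h \<otimes> (V k \<otimes> ((U \<otimes> V j) \<otimes> U')))"
      unfolding V_commute_\<Phi>[OF U cper_hk] using c h by (simp add: m_assoc)
    also have "\<dots> = ex (of_int j * b) \<odot> ((\<Phi> (hk a b k) \<otimes> \<Phi> ?h) \<otimes> ((V k \<otimes> V j) \<otimes> (U \<otimes> U')))"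
      unfolding acts_commute_V[OF U] using c h by (simp add: m_assoc smult_mult)
    also have "\<dots> = (ex (of_int j * b) \<odot> \<Phi> (\<lambda>x. hk a b k x * ?h x)) \<otimes> (V (k + j) \<otimes> (U \<otimes> U'))"
      using c h u v by (simp add: fcal_mult upow_add smult_mult cper_mult)
    also have "ex (of_int j * b) \<odot> \<Phi> (\<lambda>x. hk a b k x * ?h x) = \<Phi> (\<lambda>x. ex (of_int j * b) * (hk a b k x * ?h x))"
      by (intro fcal_smult[symmetric] u cper_mult cper_hk h)
    also have "\<dots> = \<Phi> (\<lambda>x. c0 * g k (k + j) x)"
      unfolding hk_mult g_def c0_def ..
    also have "\<dots> = c0 \<odot> \<Phi> (g k (k + j))"
      by (intro fcal_smult u g)
    finally show ?thesis by (simp add: R_def)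
  qed
  \<comment> \<open>One finite set of exponents \<open>K = k + j\<close> serves all
    \<open>k\<close>, so that the two sums can be exchanged; the terms added in this way
    vanish.\<close>
  define B where "B = hsupp (a + a') \<union> (\<Union>k\<in>hsupp a. (\<lambda>j. k + j) ` hsupp a')"
  have B: "finite B" "hsupp (a + a') \<subseteq> B" by (auto simp: B_def)
  have "transport U a b \<otimes> transport U' a' b' = (\<Oplus>k\<in>hsupp a. P k) \<otimes> (\<Oplus>j\<in>hsupp a'. Q j)"
    by (simp add: transport_def P_def Q_def)
  also have "\<dots> = (\<Oplus>k\<in>hsupp a. P k \<otimes> (\<Oplus>j\<in>hsupp a'. Q j))"
    using c by (intro finsum_ldistr finsum_closed) (auto simp: P_def Q_def)
  also have "\<dots> = (\<Oplus>k\<in>hsupp a. \<Oplus>K\<in>B. R k K)"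
  proof (intro finsum_cong' refl)
    show "(\<lambda>k. \<Oplus>K\<in>B. R k K) \<in> hsupp a \<rightarrow> carrier A" using Rc by (auto intro!: finsum_closed)
    fix k assume k: "k \<in> hsupp a"
    have "P k \<otimes> (\<Oplus>j\<in>hsupp a'. Q j) = (\<Oplus>j\<in>hsupp a'. P k \<otimes> Q j)"
      using c by (intro finsum_rdistr) (auto simp: P_def Q_def)
    also have "\<dots> = (\<Oplus>j\<in>hsupp a'. R k (k + j))" by (simp add: PQ)
    also have "\<dots> = (\<Oplus>K\<in>(\<lambda>j. k + j) ` hsupp a'. R k K)"
      using Rc by (intro finsum_reindex[symmetric]) auto
    also have "\<dots> = (\<Oplus>K\<in>B. R k K)"
    proof (rule finsum_superset)
      show "(\<lambda>j. k + j) ` hsupp a' \<subseteq> B" using k by (auto simp: B_def)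
      fix K assume K: "K \<in> B - (\<lambda>j. k + j) ` hsupp a'"
      have "K - k \<notin> hsupp a'"
      proof
        assume "K - k \<in> hsupp a'"
        then have "k + (K - k) \<in> (\<lambda>j. k + j) ` hsupp a'" by (rule imageI)
        then show False using K by simp
      qed
      then have ge: "\<bar>of_int (K - k) * \<theta> + a'\<bar> \<ge> 1" by (simp add: hsupp_def)
      have "g k K x = 0" for x
      proof -
        have "frac x + a + of_int k * \<theta> \<notin> {0<..<1} \<or> frac x + of_int K * \<theta> + (a + a') \<notin> {0<..<1}"
        proof (rule ccontr)
          assume "\<not> ?thesis"
          then have "\<bar>(frac x + of_int K * \<theta> + (a + a')) - (frac x + a + of_int k * \<theta>)\<bar> < 1" by auto
          moreover have "(frac x + of_int K * \<theta> + (a + a')) - (frac x + a + of_int k * \<theta>) = of_int (K - k) * \<theta> + a'"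
            by (simp add: algebra_simps)
          ultimately show False using ge by simp
        qed
        then show ?thesis using bump_eq_0 by (auto simp: g_def hk_def)
      qed
      then have "g k K = (\<lambda>x. 0)" by auto
      then show "R k K = \<zero>" using c by (simp add: R_def \<Phi>_zero)
    qed (use B Rc in auto)
    finally show "P k \<otimes> (\<Oplus>j\<in>hsupp a'. Q j) = (\<Oplus>K\<in>B. R k K)" .
  qed
  \<comment> \<open>For fixed \<open>K\<close> the summation over \<open>k\<close> affects only the
    squared bumps, and \<open>sum_bump_hk\<close> evaluates it.\<close>
  also have "\<dots> = (\<Oplus>K\<in>B. \<Oplus>k\<in>hsupp a. R k K)"
    using B Rc by (intro finsum_swap) auto
  also have "\<dots> = (\<Oplus>K\<in>B. c0 \<odot> (\<Phi> (hk (a + a') (b + b') K) \<otimes> (V K \<otimes> (U \<otimes> U'))))"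
  proof (intro finsum_cong' refl)
    show "(\<lambda>K. c0 \<odot> (\<Phi> (hk (a + a') (b + b') K) \<otimes> (V K \<otimes> (U \<otimes> U')))) \<in> B \<rightarrow> carrier A"
      using c by auto
    fix K
    have "(\<Oplus>k\<in>hsupp a. R k K) = (\<Oplus>k\<in>hsupp a. c0 \<odot> \<Phi> (g k K)) \<otimes> (V K \<otimes> (U \<otimes> U'))"
      unfolding R_def using c g by (intro finsum_ldistr[symmetric]) auto
    also have "(\<Oplus>k\<in>hsupp a. c0 \<odot> \<Phi> (g k K)) = c0 \<odot> (\<Oplus>k\<in>hsupp a. \<Phi> (g k K))"
      using g by (intro smult_finsum[symmetric]) auto
    also have "(\<Oplus>k\<in>hsupp a. \<Phi> (g k K)) = \<Phi> (\<lambda>x. \<Sum>k\<in>hsupp a. g k K x)"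
      using g u by (intro fcal_sum[symmetric]) auto
    also have "(\<lambda>x. \<Sum>k\<in>hsupp a. g k K x) = hk (a + a') (b + b') K"
      unfolding g_def sum_bump_hk ..
    finally show "(\<Oplus>k\<in>hsupp a. R k K) = c0 \<odot> (\<Phi> (hk (a + a') (b + b') K) \<otimes> (V K \<otimes> (U \<otimes> U')))"
      using c by (simp add: smult_mult)
  qed
  also have "\<dots> = c0 \<odot> transport (U \<otimes> U') (a + a') (b + b')"
    using c B by (subst transport_superset[OF B]) (auto intro!: smult_finsum[symmetric])
  finally show ?thesis by (simp add: c0_def)
qed

text \<open>The adjoint of the term with index \<open>k\<close> is, up to the common phase, the term
  with index \<open>- k\<close> for the adjoint of \<open>U\<close>. The phase appears because the
  adjoint of a line operator of type \<open>(a, b)\<close> is only proportional to the one of type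
  \<open>(- a, - b)\<close>.\<close>

lemma transport_adj:
  assumes U: "acts A u v U a b"
  shows "adj A (transport U a b) = ex (a * b / \<theta>) \<odot> transport (adj A U) (- a) (- b)"
proof -
  have Uu: "unitary A U" and c: "U \<in> carrier A" using U acts_unitary unitary_carrier by blast+
  define T where "T k = ex (a * b / \<theta>) \<odot> (\<Phi> (hk (- a) (- b) k) \<otimes> (V k \<otimes> adj A U))" for k
  have Tc: "T k \<in> carrier A" for k using c by (simp add: T_def)
  have "adj A (transport U a b) = (\<Oplus>k\<in>hsupp a. adj A (\<Phi> (hk a b k) \<otimes> (V k \<otimes> U)))"
    unfolding transport_def using c by (intro adj_finsum) auto
  also have "\<dots> = (\<Oplus>k\<in>hsupp a. T (- k))"
  proof (intro finsum_cong' refl)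
    show "(\<lambda>k. T (- k)) \<in> hsupp a \<rightarrow> carrier A" using Tc by auto
    fix k
    define t where "t = of_int k * \<theta> + a"
    define Y where "Y = V k \<otimes> U"
    \<comment> \<open>The argument is shifted back by \<open>t\<close> in advance, since passing
      \<open>Y\<close> shifts it forward by \<open>t\<close>.\<close>
    define h where "h x = cnj (hk a b k (x - t))" for x
    have Y: "unitary A Y" using v Uu by (simp add: Y_def unitary_mult)
    have h: "cper h" unfolding h_def diff_conv_add_uminus by (intro cper_cnj cper_shift cper_hk)
    have hc: "cper (\<lambda>x. cnj (hk a b k x))" by (intro cper_cnj cper_hk)
    have "Y \<otimes> \<Phi> h = \<Phi> (\<lambda>x. cnj (hk a b k x)) \<otimes> Y"
      unfolding Y_def V_commute_\<Phi>[OF U h] by (simp add: h_def t_def)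
    then have "adj A Y \<otimes> ((Y \<otimes> \<Phi> h) \<otimes> adj A Y) = adj A Y \<otimes> ((\<Phi> (\<lambda>x. cnj (hk a b k x)) \<otimes> Y) \<otimes> adj A Y)"
      by simp
    then have 1: "\<Phi> h \<otimes> adj A Y = adj A Y \<otimes> \<Phi> (\<lambda>x. cnj (hk a b k x))"
      using Y h hc by (simp add: m_assoc)
    have 2: "adj A Y = ex (of_int k * b) \<odot> (V (- k) \<otimes> adj A U)"
      using acts_commute_V[OF acts_adj[OF U], of "- k"] c v by (simp add: Y_def adj_mult adj_upow)
    have "adj A (\<Phi> (hk a b k) \<otimes> Y) = adj A Y \<otimes> \<Phi> (\<lambda>x. cnj (hk a b k x))"
      using Y u by (simp add: adj_mult fcal_adj)
    also have "\<dots> = (ex (of_int k * b) \<odot> \<Phi> h) \<otimes> (V (- k) \<otimes> adj A U)"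
      unfolding 1[symmetric] unfolding 2 using c h by (simp add: smult_mult)
    also have "ex (of_int k * b) \<odot> \<Phi> h = \<Phi> (\<lambda>x. ex (of_int k * b) * h x)"
      by (intro fcal_smult[symmetric] u h)
    also have "(\<lambda>x. ex (of_int k * b) * h x) = (\<lambda>x. ex (a * b / \<theta>) * hk (- a) (- b) (- k) x)"
      unfolding h_def t_def hk_adj[symmetric] by (simp add: mult.commute)
    also have "\<Phi> \<dots> = ex (a * b / \<theta>) \<odot> \<Phi> (hk (- a) (- b) (- k))"
      by (intro fcal_smult u cper_hk)
    finally show "adj A (\<Phi> (hk a b k) \<otimes> (V k \<otimes> U)) = T (- k)"
      using c by (simp add: Y_def T_def smult_mult)
  qed
  also have "\<dots> = (\<Oplus>k\<in>uminus ` hsupp a. T k)"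
    using Tc by (intro finsum_reindex[symmetric]) auto
  also have "uminus ` hsupp a = hsupp (- a)"
  proof -
    have "k \<in> hsupp (- a) \<longleftrightarrow> - k \<in> hsupp a" for k
      using abs_minus_cancel[of "of_int k * \<theta> - a"] by (simp add: hsupp_def)
    then have "hsupp (- a) = uminus -` hsupp a" by auto
    also have "\<dots> = uminus ` hsupp a"
    proof (intro equalityI subsetI)
      fix x assume "x \<in> uminus -` hsupp a"
      then have "- (- x) \<in> uminus ` hsupp a" by (intro imageI) simp
      then show "x \<in> uminus ` hsupp a" by simp
    qed auto
    finally show ?thesis ..
  qed
  also have "(\<Oplus>k\<in>hsupp (- a). T k) = ex (a * b / \<theta>) \<odot> transport (adj A U) (- a) (- b)"
    unfolding T_def transport_def using c by (intro smult_finsum[symmetric]) auto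
  finally show ?thesis .
qed

end

section \<open>Corners and induction on the size of the matrix\<close>

definition corner :: "'a cstar \<Rightarrow> 'a \<Rightarrow> 'a cstar" where
  "corner A e = A\<lparr>carrier := {x \<in> carrier A. e \<otimes>\<^bsub>A\<^esub> x = x \<and> x \<otimes>\<^bsub>A\<^esub> e = x}, one := e\<rparr>"

lemma corner_simps [simp]:
  "carrier (corner A e) = {x \<in> carrier A. e \<otimes>\<^bsub>A\<^esub> x = x \<and> x \<otimes>\<^bsub>A\<^esub> e = x}"
  "x \<otimes>\<^bsub>corner A e\<^esub> y = x \<otimes>\<^bsub>A\<^esub> y"
  "\<one>\<^bsub>corner A e\<^esub> = e"
  "x \<oplus>\<^bsub>corner A e\<^esub> y = x \<oplus>\<^bsub>A\<^esub> y"
  "\<zero>\<^bsub>corner A e\<^esub> = \<zero>\<^bsub>A\<^esub>"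
  "c \<odot>\<^bsub>corner A e\<^esub> x = c \<odot>\<^bsub>A\<^esub> x"
  "adj (corner A e) x = adj A x"
  "cnorm (corner A e) x = cnorm A x"
  by (simp_all add: corner_def)

context cstar_algebra
begin

lemma projectionD:
  assumes "projection A e"
  shows "e \<in> carrier A" "adj A e = e" "e \<otimes> e = e"
  using assms by (auto simp: projection_def)

lemma corner_ring:
  assumes "projection A e"
  shows "ring (corner A e)"
proof (rule ringI)
  note e = projectionD[OF assms]
  show "abelian_group (corner A e)"
  proof (rule abelian_groupI)
    fix x assume "x \<in> carrier (corner A e)"
    then show "\<exists>y\<in>carrier (corner A e). y \<oplus>\<^bsub>corner A e\<^esub> x = \<zero>\<^bsub>corner A e\<^esub>"
      using e smult_add_left[of x "-1" 1] by (intro bexI[of _ "(-1) \<odot> x"]) (auto simp: smult_mult)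
  qed (use e in \<open>auto simp: a_assoc a_comm a_lcomm l_distr r_distr\<close>)
  show "monoid (corner A e)"
    using e by (intro monoidI) (auto simp: m_assoc, metis m_assoc)
qed (use projectionD[OF assms] in \<open>auto simp: l_distr r_distr\<close>)

lemma corner_minus:
  assumes "projection A e" "x \<in> carrier (corner A e)" "y \<in> carrier (corner A e)"
  shows "x \<ominus>\<^bsub>corner A e\<^esub> y = x \<ominus> y"
proof -
  note e = projectionD[OF assms(1)]
  have "\<ominus>\<^bsub>corner A e\<^esub> y = (-1) \<odot> y"
    using assms(3) e smult_add_left[of y "-1" 1]
    by (intro abelian_group.minus_equality[OF ring.is_abelian_group[OF corner_ring[OF assms(1)]]])
       (auto simp: smult_mult)
  then show ?thesis using assms by (simp add: a_minus_def[of "corner A e"] diff_eq_smult)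
qed

text \<open>Completeness takes an argument: the limit \<open>x\<close> in \<open>A\<close> belongs
  to the corner because \<open>e \<otimes> x\<close> and \<open>x \<otimes> e\<close> are limits of
  the same sequence.\<close>

lemma cstar_algebra_corner:
  assumes "projection A e"
  shows "cstar_algebra (corner A e)"
proof -
  note e = projectionD[OF assms]
  have R: "cring (ring_of_type_algebra :: complex ring)"
    using module.axioms(1) module_axioms by blast
  have M: "module (ring_of_type_algebra :: complex ring) (corner A e)"
    using R ring.is_abelian_group[OF corner_ring[OF assms]]
    by (rule moduleI)
      (use e in \<open>auto simp: ring_of_type_algebra_def smult_mult smult_add_left smult_add_right\<close>)
  show ?thesis
  proof (intro cstar_algebra.intro corner_ring[OF assms] M cstar_algebra_axioms.intro)
    fix x assume "x \<in> carrier (corner A e)"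
    then show "adj (corner A e) x \<in> carrier (corner A e)"
      using e adj_mult[of e x] adj_mult[of x e] by auto
  next
    fix f :: "nat \<Rightarrow> 'a"
    assume f: "\<And>i. f i \<in> carrier (corner A e)"
      and Cauchy: "\<And>r. r > 0 \<Longrightarrow> \<exists>N. \<forall>i\<ge>N. \<forall>j\<ge>N. cnorm (corner A e) (f i \<ominus>\<^bsub>corner A e\<^esub> f j) < r"
    have fA: "f i \<in> carrier A" "e \<otimes> f i = f i" "f i \<otimes> e = f i" for i using f[of i] by auto
    have "\<exists>x\<in>carrier A. (\<lambda>i. cnorm A (f i \<ominus> x)) \<longlonglongrightarrow> 0"
      using fA Cauchy by (intro complete) (auto simp: corner_minus[OF assms f f])
    then obtain x where x: "x \<in> carrier A" "(\<lambda>i. cnorm A (f i \<ominus> x)) \<longlonglongrightarrow> 0" by blast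
    have unique: "y = x" if y: "y \<in> carrier A" "\<And>i. cnorm A (f i \<ominus> y) \<le> c * cnorm A (f i \<ominus> x)" for y c
    proof -
      have "(\<lambda>i. c * cnorm A (f i \<ominus> x) + cnorm A (f i \<ominus> x)) \<longlonglongrightarrow> c * 0 + 0"
        by (intro tendsto_intros x)
      moreover have "cnorm A (y \<ominus> x) \<le> c * cnorm A (f i \<ominus> x) + cnorm A (f i \<ominus> x)" for i
        using cnorm_diff_triangle[OF y(1) fA(1) x(1), of i] y(2)[of i] cnorm_diff_commute[OF y(1) fA(1), of i]
        by simp
      ultimately have "cnorm A (y \<ominus> x) \<le> 0"
        using LIMSEQ_le_const[of _ 0 "cnorm A (y \<ominus> x)"] by auto
      then show ?thesis using cnorm_nonneg[of "y \<ominus> x"] cnorm_eq_diff[of y x] x y by simp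
    qed
    have "e \<otimes> x = x"
    proof (rule unique)
      fix i
      have "f i \<ominus> e \<otimes> x = e \<otimes> (f i \<ominus> x)" using fA x e by (simp add: diff_eq_smult r_distr smult_mult)
      then show "cnorm A (f i \<ominus> e \<otimes> x) \<le> cnorm A e * cnorm A (f i \<ominus> x)" using fA x e cnorm_mult by simp
    qed (use x e in simp)
    moreover have "x \<otimes> e = x"
    proof (rule unique)
      fix i
      have "f i \<ominus> x \<otimes> e = (f i \<ominus> x) \<otimes> e" using fA x e by (simp add: diff_eq_smult l_distr smult_mult)
      then show "cnorm A (f i \<ominus> x \<otimes> e) \<le> cnorm A e * cnorm A (f i \<ominus> x)"
        using fA x e cnorm_mult[of "f i \<ominus> x" e] by (simp add: mult.commute)
    qed (use x e in simp)
    ultimately have "x \<in> carrier (corner A e)" using x by simp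
    moreover have "(\<lambda>i. cnorm (corner A e) (f i \<ominus>\<^bsub>corner A e\<^esub> x)) \<longlonglongrightarrow> 0"
      using x(2) by (simp only: corner_minus[OF assms f \<open>x \<in> carrier (corner A e)\<close>] corner_simps)
    ultimately show "\<exists>x\<in>carrier (corner A e). (\<lambda>i. cnorm (corner A e) (f i \<ominus>\<^bsub>corner A e\<^esub> x)) \<longlonglongrightarrow> 0"
      by blast
  qed (use e in \<open>auto simp: smult_mult adj_add adj_smult adj_mult cnorm_nonneg cnorm_eq_0 cnorm_triangle
      cnorm_smult cnorm_mult cstar_identity\<close>)
qed

lemma projection_corner:
  assumes "projection A e" "projection (corner A e) p"
  shows "projection A p"
  using assms(2) by (simp add: projection_def)

lemma tracial_state_corner:
  assumes e: "projection A e" and tau: "tracial_state A \<tau>" and t: "\<tau> e = of_real t" "t > 0"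
  shows "tracial_state (corner A e) (\<lambda>x. \<tau> x / of_real t)"
proof -
  interpret traced A \<tau> by unfold_locales (rule tau)
  show ?thesis
    unfolding tracial_state_def using t projectionD[OF e] tau_pos
    by (auto simp: tau_add tau_smult add_divide_distrib intro: arg_cong[where f = "\<lambda>z. z / of_real t"] tau_commute)
qed

end

section \<open>Words in the generators and their degrees\<close>

type_synonym letter = "nat \<times> bool"

definition letter :: "'a cstar \<Rightarrow> (nat \<Rightarrow> 'a) \<Rightarrow> letter \<Rightarrow> 'a" where
  "letter A u l = (if snd l then u (fst l) else adj A (u (fst l)))"

definition wprod :: "'a cstar \<Rightarrow> (nat \<Rightarrow> 'a) \<Rightarrow> letter list \<Rightarrow> 'a" where
  "wprod A u ws = foldr (\<lambda>l x. letter A u l \<otimes>\<^bsub>A\<^esub> x) ws \<one>\<^bsub>A\<^esub>"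

definition wdeg :: "letter list \<Rightarrow> nat \<Rightarrow> int" where
  "wdeg ws i = (\<Sum>l\<leftarrow>ws. if fst l = i then if snd l then 1 else -1 else 0)"

lemma wprod_simps [simp]:
  "wprod A u [] = \<one>\<^bsub>A\<^esub>" "wprod A u (l # ws) = letter A u l \<otimes>\<^bsub>A\<^esub> wprod A u ws"
  by (simp_all add: wprod_def)

lemma wdeg_Nil [simp]: "wdeg [] i = 0"
  and wdeg_Cons: "wdeg (l # ws) i = (if fst l = i then if snd l then 1 else -1 else 0) + wdeg ws i"
  and wdeg_append [simp]: "wdeg (ws @ ws') i = wdeg ws i + wdeg ws' i"
  by (simp_all add: wdeg_def)

lemma wdeg_map_shift: "wdeg (map (map_prod (\<lambda>j. j + d) id) ws) (i + d) = wdeg ws i"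
  by (induction ws) (auto simp: wdeg_Cons)

definition wpow :: "nat \<Rightarrow> int \<Rightarrow> letter list" where
  "wpow j k = replicate (nat \<bar>k\<bar>) (j, 0 \<le> k)"

lemma fst_wpow: "fst ` set (wpow j k) \<subseteq> {j}"
  by (auto simp: wpow_def)

lemma wdeg_wpow: "wdeg (wpow j k) i = (if i = j then k else 0)"
proof -
  have "wdeg (replicate n (j, s)) i = (if i = j then if s then int n else - int n else 0)" for n s
    by (induction n) (auto simp: wdeg_Cons)
  then show ?thesis by (auto simp: wpow_def)
qed

context cstar_algebra
begin

lemma unitary_letter: "unitary A (u (fst l)) \<Longrightarrow> unitary A (letter A u l)"
  by (simp add: letter_def)

lemma unitary_wprod: "(\<And>j. j \<in> fst ` set ws \<Longrightarrow> unitary A (u j)) \<Longrightarrow> unitary A (wprod A u ws)"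
  by (induction ws) (auto intro!: unitary_mult unitary_letter)

lemma wprod_append:
  assumes "\<And>j. j \<in> fst ` set (ws @ ws') \<Longrightarrow> unitary A (u j)"
  shows "wprod A u (ws @ ws') = wprod A u ws \<otimes> wprod A u ws'"
  using assms
proof (induction ws)
  case Nil
  then have "unitary A (wprod A u ws')" by (intro unitary_wprod) auto
  then show ?case by simp
next
  case (Cons l ws)
  have "unitary A (wprod A u ws)" "unitary A (wprod A u ws')" "unitary A (letter A u l)"
    using Cons.prems by (auto intro!: unitary_wprod unitary_letter)
  then show ?case using Cons by (simp add: m_assoc)
qed

lemma wprod_wpow:
  assumes "unitary A (u j)"
  shows "wprod A u (wpow j k) = upow A (u j) k"
proof -
  have "wprod A u (replicate n (j, s)) = (if s then u j else adj A (u j)) [^] n" for n s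
  proof (induction n)
    case (Suc n)
    then show ?case using assms monoid.nat_pow_Suc2[OF monoid_A, of "u j" n]
        monoid.nat_pow_Suc2[OF monoid_A, of "adj A (u j)" n]
      by (cases s) (simp_all add: letter_def del: nat_pow_Suc)
  qed simp
  then show ?thesis by (auto simp: wpow_def upow_def simp del: pow_nat)
qed

lemma wprod_map_shift:
  "wprod A u (map (map_prod (\<lambda>j. j + d) id) ws) = wprod A (\<lambda>j. u (j + d)) ws"
  by (induction ws) (auto simp: letter_def)

end

text \<open>The trace condition over words in the generators and their adjoints is the form of the
  canonical trace that passes to corners.\<close>

definition nct :: "nat \<Rightarrow> (nat \<Rightarrow> nat \<Rightarrow> real) \<Rightarrow> 'a cstar \<Rightarrow> (nat \<Rightarrow> 'a) \<Rightarrow> ('a \<Rightarrow> complex) \<Rightarrow> bool" where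
  "nct n \<Theta> A u \<tau> \<longleftrightarrow> cstar_algebra A \<and> tracial_state A \<tau> \<and> (\<forall>j<n. unitary A (u j)) \<and>
     (\<forall>j<n. \<forall>k<n. u k \<otimes>\<^bsub>A\<^esub> u j = ex (\<Theta> j k) \<odot>\<^bsub>A\<^esub> (u j \<otimes>\<^bsub>A\<^esub> u k)) \<and>
     (\<forall>ws i. fst ` set ws \<subseteq> {..<n} \<longrightarrow> wdeg ws i \<noteq> 0 \<longrightarrow> \<tau> (wprod A u ws) = 0)"

locale traced_rotation = rotation A \<theta> u v + traced A \<tau>
  for A :: "'a cstar" (structure) and \<theta> u v \<tau>
begin

text \<open>The trace depends on the kernel functions only through their Fourier modes, so it is
  enough that it vanishes on every monomial in \<open>u\<close> and \<open>v\<close> followed by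
  \<open>W\<close>.\<close>

lemma tau_transport_eq_0:
  assumes "unitary A W" "\<And>m k. \<tau> (upow A u m \<otimes> (V k \<otimes> W)) = 0"
  shows "\<tau> (transport W a b) = 0"
proof -
  have "\<tau> (transport W a b) = (\<Sum>k\<in>hsupp a. \<tau> (\<Phi> (hk a b k) \<otimes> (V k \<otimes> W)))"
    unfolding transport_def using assms(1) by (intro tau_finsum) auto
  also have "\<dots> = (\<Sum>k\<in>hsupp a. 0)"
    using assms v by (intro sum.cong tau_fcal_eq_0[OF u] refl) (auto intro!: unitary_mult)
  finally show ?thesis by simp
qed

lemma projection_transport: "projection A (transport \<one> 0 0)"
  unfolding projection_def
  using transport_mult[OF acts_one acts_one] transport_adj[OF acts_one] by simp

text \<open>The terms with \<open>k \<noteq> 0\<close> have trace 0 mode by mode; the term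
  \<open>k = 0\<close> is a function of \<open>u\<close>, and its trace is the integral of the
  squared bump.\<close>

lemma tau_projection:
  assumes "\<And>m k. m \<noteq> 0 \<or> k \<noteq> 0 \<Longrightarrow> \<tau> (upow A u m \<otimes> V k) = 0"
  shows "\<tau> (transport \<one> 0 0) = of_real \<theta>"
proof -
  have "\<tau> (transport \<one> 0 0) = (\<Sum>k\<in>hsupp 0. \<tau> (\<Phi> (hk 0 0 k) \<otimes> V k))"
    unfolding transport_def by (subst tau_finsum) auto
  also have "\<dots> = (\<Sum>k\<in>{0}. \<tau> (\<Phi> (hk 0 0 k) \<otimes> V k))"
  proof (rule sum.mono_neutral_right)
    show "{0} \<subseteq> hsupp 0" by (simp add: hsupp_def)
    show "\<forall>k\<in>hsupp 0 - {0}. \<tau> (\<Phi> (hk 0 0 k) \<otimes> V k) = 0"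
      using assms v by (auto intro!: tau_fcal_eq_0[OF u])
  qed simp
  also have "\<dots> = \<tau> (\<Phi> (hk 0 0 0))" by simp
  also have "\<dots> = integral {0..1} (hk 0 0 0)"
  proof (rule tau_fcal_integral[OF u cper_hk])
    fix k :: int assume "k \<noteq> 0"
    then show "\<tau> (upow A u k) = 0" using assms[of k 0] u by simp
  qed
  finally show ?thesis by (simp add: integral_hk_0)
qed

end

text \<open>The entries of \<open>F \<Theta>\<close> in terms of those of a skew-symmetric \<open>\<Theta>\<close>.\<close>

definition red :: "(nat \<Rightarrow> nat \<Rightarrow> real) \<Rightarrow> nat \<Rightarrow> nat \<Rightarrow> real" where
  "red \<Theta> j k = \<Theta> (j + 2) (k + 2)
     - (\<Theta> 0 (j + 2) * \<Theta> 1 (k + 2) - \<Theta> 0 (k + 2) * \<Theta> 1 (j + 2)) / \<Theta> 0 1"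

lemma nctD:
  assumes "nct n \<Theta> A u \<tau>"
  shows "cstar_algebra A" "tracial_state A \<tau>" "\<And>j. j < n \<Longrightarrow> unitary A (u j)"
    "\<And>j k. j < n \<Longrightarrow> k < n \<Longrightarrow> u k \<otimes>\<^bsub>A\<^esub> u j = ex (\<Theta> j k) \<odot>\<^bsub>A\<^esub> (u j \<otimes>\<^bsub>A\<^esub> u k)"
    "\<And>ws i. fst ` set ws \<subseteq> {..<n} \<Longrightarrow> wdeg ws i \<noteq> 0 \<Longrightarrow> \<tau> (wprod A u ws) = 0"
  using assms unfolding nct_def by blast+

context cstar_algebra
begin

lemma nct_tau_monomial:
  assumes nct: "nct n \<Theta> A u \<tau>" and n: "2 \<le> n"
    and ws: "fst ` set ws \<subseteq> {..<n}" "m + wdeg ws 0 \<noteq> 0 \<or> k + wdeg ws 1 \<noteq> 0 \<or> (\<exists>i\<ge>2. wdeg ws i \<noteq> 0)"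
  shows "\<tau> (upow A (u 0) m \<otimes> (upow A (u 1) k \<otimes> wprod A u ws)) = 0"
proof -
  note un = nctD(3)[OF nct]
  have s: "fst ` set (wpow 0 m @ (wpow 1 k @ ws)) \<subseteq> {..<n}"
  proof -
    have "fst ` set (wpow j k) \<subseteq> {..<n}" if "j < n" for j k
      using fst_wpow[of j k] that by auto
    from this[of 0 m] this[of 1 k] show ?thesis using ws(1) n by (simp add: image_Un)
  qed
  have "\<tau> (wprod A u (wpow 0 m @ (wpow 1 k @ ws))) = 0"
    using ws(2)
  proof (elim disjE exE conjE)
    fix i :: nat assume "2 \<le> i" "wdeg ws i \<noteq> 0"
    then show ?thesis using nctD(5)[OF nct s, of i] by (simp add: wdeg_wpow)
  qed (use nctD(5)[OF nct s, of 0] nctD(5)[OF nct s, of 1] in \<open>simp_all add: wdeg_wpow\<close>)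
  moreover have "wprod A u (wpow 0 m @ (wpow 1 k @ ws)) = wprod A u (wpow 0 m) \<otimes> wprod A u (wpow 1 k @ ws)"
    by (rule wprod_append) (use s un in blast)
  moreover have "wprod A u (wpow 1 k @ ws) = wprod A u (wpow 1 k) \<otimes> wprod A u ws"
  proof (rule wprod_append)
    show "unitary A (u j)" if "j \<in> fst ` set (wpow 1 k @ ws)" for j
    proof -
      have "j \<in> fst ` set (wpow 0 m @ (wpow 1 k @ ws))" using that by (simp only: set_append image_Un Un_iff) blast
      then show ?thesis using s un by blast
    qed
  qed
  moreover have "wprod A u (wpow 0 m) = upow A (u 0) m" "wprod A u (wpow 1 k) = upow A (u 1) k"
    using un[of 0] un[of 1] n by (auto intro!: wprod_wpow)
  ultimately show ?thesis by (simp only:)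
qed

text \<open>Here \<theta> represents the entry \<open>\<Theta> 0 1\<close> modulo integers. The
  induction step uses it with equality, the base case with the fractional part.\<close>

lemma nct_traced_rotation:
  assumes nct: "nct n \<Theta> A u \<tau>" and n: "2 \<le> n" and "0 < \<theta>" "\<theta> < 1" "ex (\<Theta> 0 1) = ex \<theta>"
  shows "traced_rotation A \<theta> (u 0) (u 1) \<tau>"
    and "\<tau> (rotation.transport A \<theta> (u 0) (u 1) \<one> 0 0) = of_real \<theta>"
proof -
  show *: "traced_rotation A \<theta> (u 0) (u 1) \<tau>"
  proof unfold_locales
    show "unitary A (u 0)" "unitary A (u 1)" using nctD(3)[OF nct] n by simp_all
    show "u 1 \<otimes> u 0 = ex \<theta> \<odot> (u 0 \<otimes> u 1)" using nctD(4)[OF nct, of 0 1] n assms(5) by simp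
  qed (use assms(3,4) nctD(2)[OF nct] in simp_all)
  show "\<tau> (rotation.transport A \<theta> (u 0) (u 1) \<one> 0 0) = of_real \<theta>"
  proof (rule traced_rotation.tau_projection[OF *])
    fix m k :: int assume "m \<noteq> 0 \<or> k \<noteq> 0"
    then have "\<tau> (upow A (u 0) m \<otimes> (upow A (u 1) k \<otimes> wprod A u [])) = 0"
      by (intro nct_tau_monomial[OF nct n]) simp_all
    moreover have "unitary A (u 1)" using nctD(3)[OF nct] n by simp
    ultimately show "\<tau> (upow A (u 0) m \<otimes> upow A (u 1) k) = 0" by simp
  qed
qed

text \<open>In this step \<theta> is \<open>\<Theta> 0 1\<close> itself: the transport phases are
  divided by it, so changing it by an integer would change the relations between the new
  generators.\<close>

lemma nct_step:
  assumes nct: "nct (n + 2) \<Theta> A u \<tau>" and \<theta>: "0 < \<Theta> 0 1" "\<Theta> 0 1 < 1"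
  obtains e w where "projection A e" "nct n (red \<Theta>) (corner A e) w (\<lambda>x. \<tau> x / of_real (\<Theta> 0 1))"
proof -
  define \<theta> where "\<theta> = \<Theta> 0 1"
  define p where "p = u 0"
  define q where "q = u 1"
  note tr = nct_traced_rotation[OF nct _ \<theta> refl, folded \<theta>_def p_def q_def]
  interpret traced_rotation A \<theta> p q \<tau> using tr(1) by simp
  define e where "e = transport \<one> 0 0"
  define w where "w j = transport (u (j + 2)) (\<Theta> 0 (j + 2)) (\<Theta> 1 (j + 2))" for j
  have e: "projection A e" unfolding e_def by (rule projection_transport)
  have act: "acts A p q (u (j + 2)) (\<Theta> 0 (j + 2)) (\<Theta> 1 (j + 2))" if "j < n" for j
    unfolding acts_def p_def q_def
    using nctD(3)[OF nct, of "j + 2"] nctD(4)[OF nct, of 0 "j + 2"] nctD(4)[OF nct, of 1 "j + 2"] that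
    by (intro conjI) simp_all
  \<comment> \<open>The unit has type \<open>(0, 0)\<close>, so multiplication by \<open>e\<close>
    costs no phase and fixes every transport.\<close>
  have corner: "transport U a b \<in> carrier (corner A e)" if "acts A p q U a b" for U a b
    using transport_mult[OF acts_one that] transport_mult[OF that acts_one] acts_unitary[OF that]
    by (simp add: e_def)
  have unit: "unitary (corner A e) (transport U a b)" if "acts A p q U a b" for U a b
  proof -
    have U: "unitary A U" using acts_unitary[OF that] .
    \<comment> \<open>The phase of \<open>transport_adj\<close> and the phase of
      \<open>transport_mult\<close> for the types \<open>(a, b)\<close> and
      \<open>(- a, - b)\<close> cancel.\<close>
    have "ex (- (a * b / \<theta>)) = cnj (ex (a * b / \<theta>))" by (rule ex_minus)
    then show ?thesis
      unfolding unitary_def using corner[OF that] transport_adj[OF that] transport_mult[OF that acts_adj[OF that]]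
        transport_mult[OF acts_adj[OF that] that] U
      by (simp add: smult_mult e_def)
  qed
  \<comment> \<open>A word in the new generators is a phase times the transport of the same word in
    the old ones. The phase need not be computed in order to see that the trace vanishes.\<close>
  have word: "\<exists>c a b. cmod c = 1 \<and> acts A p q (wprod A (\<lambda>j. u (j + 2)) ws) a b
      \<and> wprod (corner A e) w ws = c \<odot> transport (wprod A (\<lambda>j. u (j + 2)) ws) a b"
    if "fst ` set ws \<subseteq> {..<n}" for ws
    using that
  proof (induction ws)
    case Nil
    then show ?case using acts_one by (intro exI[of _ 1] exI[of _ 0]) (simp add: e_def)
  next
    case (Cons l ws)
    then obtain c a b where IH: "cmod c = 1" "acts A p q (wprod A (\<lambda>j. u (j + 2)) ws) a b"
      "wprod (corner A e) w ws = c \<odot> transport (wprod A (\<lambda>j. u (j + 2)) ws) a b" by auto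
    have j: "fst l < n" using Cons.prems by simp
    obtain c' a' b' where l: "cmod c' = 1" "acts A p q (letter A (\<lambda>j. u (j + 2)) l) a' b'"
      "letter (corner A e) w l = c' \<odot> transport (letter A (\<lambda>j. u (j + 2)) l) a' b'"
    proof (cases "snd l")
      case True
      show ?thesis
        by (rule that[of 1]) (use True act[OF j] acts_unitary[OF act[OF j]] in \<open>simp_all add: letter_def w_def\<close>)
    next
      case False
      then show ?thesis
        using that[of "ex (\<Theta> 0 (fst l + 2) * \<Theta> 1 (fst l + 2) / \<theta>)"] acts_adj[OF act[OF j]] transport_adj[OF act[OF j]]
        by (simp add: letter_def w_def)
    qed
    note U = acts_unitary[OF IH(2)] acts_unitary[OF l(2)]
    show ?case
    proof (intro exI conjI)
      show "acts A p q (wprod A (\<lambda>j. u (j + 2)) (l # ws)) (a' + a) (b' + b)"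
        using acts_mult[OF l(2) IH(2)] by simp
      show "wprod (corner A e) w (l # ws) = (c' * c * ex (a' * b / \<theta>)) \<odot>
          transport (wprod A (\<lambda>j. u (j + 2)) (l # ws)) (a' + a) (b' + b)"
        using U transport_mult[OF l(2) IH(2)] by (simp add: l(3) IH(3) smult_mult mult_ac unitary_mult)
    qed (simp add: norm_mult IH l)
  qed
  have "nct n (red \<Theta>) (corner A e) w (\<lambda>x. \<tau> x / of_real \<theta>)"
    unfolding nct_def
  proof (intro conjI allI impI)
    show "cstar_algebra (corner A e)" using e by (rule cstar_algebra_corner)
    show "tracial_state (corner A e) (\<lambda>x. \<tau> x / of_real \<theta>)"
      using e trace tr(2) theta(1) by (intro tracial_state_corner) (auto simp: e_def)
    show "unitary (corner A e) (w j)" if "j < n" for j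
      unfolding w_def using act[OF that] by (rule unit)
  next
    fix j k assume j: "j < n" and k: "k < n"
    note U = acts_unitary[OF act[OF j]] acts_unitary[OF act[OF k]]
    have "w k \<otimes> w j = ex (\<Theta> 0 (k + 2) * \<Theta> 1 (j + 2) / \<theta>) \<odot>
       transport (u (k + 2) \<otimes> u (j + 2)) (\<Theta> 0 (k + 2) + \<Theta> 0 (j + 2)) (\<Theta> 1 (k + 2) + \<Theta> 1 (j + 2))"
      unfolding w_def by (rule transport_mult[OF act[OF k] act[OF j]])
    also have "u (k + 2) \<otimes> u (j + 2) = ex (\<Theta> (j + 2) (k + 2)) \<odot> (u (j + 2) \<otimes> u (k + 2))"
      using j k by (intro nctD(4)[OF nct]) auto
    finally have 1: "w k \<otimes> w j = (ex (\<Theta> 0 (k + 2) * \<Theta> 1 (j + 2) / \<theta>) * ex (\<Theta> (j + 2) (k + 2))) \<odot>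
       transport (u (j + 2) \<otimes> u (k + 2)) (\<Theta> 0 (j + 2) + \<Theta> 0 (k + 2)) (\<Theta> 1 (j + 2) + \<Theta> 1 (k + 2))"
      using U by (simp add: transport_smult add.commute)
    have 2: "w j \<otimes> w k = ex (\<Theta> 0 (j + 2) * \<Theta> 1 (k + 2) / \<theta>) \<odot>
       transport (u (j + 2) \<otimes> u (k + 2)) (\<Theta> 0 (j + 2) + \<Theta> 0 (k + 2)) (\<Theta> 1 (j + 2) + \<Theta> 1 (k + 2))"
      unfolding w_def by (rule transport_mult[OF act[OF j] act[OF k]])
    \<comment> \<open>The two orders of multiplication have different phases with the same transport
      behind them; the difference of the exponents is the Schur complement correction in
      \<open>red\<close>.\<close>
    have 3: "\<Theta> 0 (k + 2) * \<Theta> 1 (j + 2) / \<theta> + \<Theta> (j + 2) (k + 2) = red \<Theta> j k + \<Theta> 0 (j + 2) * \<Theta> 1 (k + 2) / \<theta>"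
      by (simp add: red_def \<theta>_def diff_divide_distrib)
    show "w k \<otimes>\<^bsub>corner A e\<^esub> w j = ex (red \<Theta> j k) \<odot>\<^bsub>corner A e\<^esub> (w j \<otimes>\<^bsub>corner A e\<^esub> w k)"
    proof -
      have "transport (u (j + 2) \<otimes> u (k + 2)) (\<Theta> 0 (j + 2) + \<Theta> 0 (k + 2)) (\<Theta> 1 (j + 2) + \<Theta> 1 (k + 2)) \<in> carrier A"
        using U by (intro transport_carrier) simp
      then show ?thesis
        unfolding corner_simps 1 2 ex_add[symmetric] 3 by (simp only: smult_smult ex_add)
    qed
  next
    fix ws i assume ws: "fst ` set ws \<subseteq> {..<n}" "wdeg ws i \<noteq> 0"
    define ws' where "ws' = map (map_prod (\<lambda>j. j + 2) id) ws"
    have ws': "fst ` set ws' \<subseteq> {..<n + 2}" "wdeg ws' (i + 2) \<noteq> 0"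
      using ws unfolding ws'_def by (auto simp only: wdeg_map_shift) fastforce+
    have W: "wprod A u ws' = wprod A (\<lambda>j. u (j + 2)) ws"
      unfolding ws'_def by (rule wprod_map_shift)
    obtain c a b where c: "acts A p q (wprod A u ws') a b"
      "wprod (corner A e) w ws = c \<odot> transport (wprod A u ws') a b" using word[OF ws(1)] unfolding W by auto
    have "\<tau> (transport (wprod A u ws') a b) = 0"
    \<comment> \<open>Powers of \<open>p\<close> and \<open>q\<close> do not affect the degree in
      the generator \<open>i + 2\<close>.\<close>
    proof (rule tau_transport_eq_0[OF acts_unitary[OF c(1)]])
      fix m k
      show "\<tau> (upow A p m \<otimes> (upow A q k \<otimes> wprod A u ws')) = 0"
        unfolding p_def q_def
        by (rule nct_tau_monomial[OF nct _ ws'(1)]) (use ws'(2) in \<open>auto intro!: exI[of _ "i + 2"]\<close>)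
    qed
    then show "\<tau> (wprod (corner A e) w ws) / of_real \<theta> = 0"
      using acts_unitary[OF c(1)] by (simp add: c(2) tau_smult)
  qed
  then show ?thesis using that e unfolding \<theta>_def by blast
qed

end

section \<open>Induction along the chain of reductions\<close>

fun chain_ok :: "nat \<Rightarrow> (nat \<Rightarrow> nat \<Rightarrow> real) \<Rightarrow> bool" where
  "chain_ok 0 \<Theta> \<longleftrightarrow> \<Theta> 0 1 \<notin> \<int>"
| "chain_ok (Suc m) \<Theta> \<longleftrightarrow> 0 < \<Theta> 0 1 \<and> \<Theta> 0 1 < 1 \<and> chain_ok m (red \<Theta>)"

fun chain_trace :: "nat \<Rightarrow> (nat \<Rightarrow> nat \<Rightarrow> real) \<Rightarrow> real" where
  "chain_trace 0 \<Theta> = frac (\<Theta> 0 1)"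
| "chain_trace (Suc m) \<Theta> = \<Theta> 0 1 * chain_trace m (red \<Theta>)"

lemma exists_projection:
  assumes "nct (2 * m + 2) \<Theta> A u \<tau>" "chain_ok m \<Theta>"
  shows "\<exists>P. projection A P \<and> \<tau> P = of_real (chain_trace m \<Theta>)"
  using assms
proof (induction m arbitrary: \<Theta> A u \<tau>)
  case 0
  \<comment> \<open>No further generator is transported, and the relation fixes
    \<open>\<Theta> 0 1\<close> only modulo integers. Its fractional part therefore serves as
    \<theta>; it is positive because the entry is not an integer.\<close>
  define \<theta> where "\<theta> = frac (\<Theta> 0 1)"
  have \<theta>: "0 < \<theta>" "\<theta> < 1" using 0(2) by (auto simp: \<theta>_def frac_lt_1)
  have "ex (\<Theta> 0 1) = ex \<theta>"
    unfolding ex_eq_iff by (rule exI[of _ "\<lfloor>\<Theta> 0 1\<rfloor>"]) (simp add: \<theta>_def frac_def)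
  note tr = cstar_algebra.nct_traced_rotation[OF nctD(1)[OF 0(1)] 0(1) _ \<theta> this]
  show ?case
    using traced_rotation.projection_transport[OF tr(1)] tr(2) by (auto simp: \<theta>_def)
next
  case (Suc m)
  have *: "0 < \<Theta> 0 1" "\<Theta> 0 1 < 1" "chain_ok m (red \<Theta>)" using Suc.prems(2) by auto
  have "nct ((2 * m + 2) + 2) \<Theta> A u \<tau>" using Suc.prems(1) by (simp add: numeral_eq_Suc)
  then obtain e w where e: "projection A e"
    "nct (2 * m + 2) (red \<Theta>) (corner A e) w (\<lambda>x. \<tau> x / of_real (\<Theta> 0 1))"
    using *(1,2) by (rule cstar_algebra.nct_step[OF nctD(1)[OF Suc.prems(1)]])
  from Suc.IH[OF e(2) *(3)] obtain P where
    P: "projection (corner A e) P" "\<tau> P / of_real (\<Theta> 0 1) = of_real (chain_trace m (red \<Theta>))" by blast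
  \<comment> \<open>The trace on the corner is normalized by \<open>\<Theta> 0 1\<close>; undoing
    this contributes one factor of the product.\<close>
  have "\<tau> P = of_real (chain_trace (Suc m) \<Theta>)"
    using P(2) *(1) by (simp add: divide_simps mult.commute split: if_splits)
  moreover have "projection A P"
    using cstar_algebra.projection_corner[OF nctD(1)[OF Suc.prems(1)] e(1) P(1)] .
  ultimately show ?case by blast
qed

section \<open>Pfaffians and the reduction map\<close>

text \<open>Arrays over all natural numbers replace matrices: \<open>red\<close> shifts indices by
  2, and with the number \<open>m\<close> of pairs as a separate parameter one array has pfaffians
  of all its leading blocks.\<close>

definition pfprod :: "nat \<Rightarrow> (nat \<Rightarrow> nat \<Rightarrow> real) \<Rightarrow> (nat \<Rightarrow> nat) \<Rightarrow> real" where
  "pfprod m b p = (\<Prod>i<m. b (p (2 * i)) (p (2 * i + 1)))"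

definition pfsum :: "nat \<Rightarrow> (nat \<Rightarrow> nat \<Rightarrow> real) \<Rightarrow> real" where
  "pfsum m b = (\<Sum>p | p permutes {..<2 * m}. real_of_int (sign p) * pfprod m b p)"

definition pfn :: "nat \<Rightarrow> (nat \<Rightarrow> nat \<Rightarrow> real) \<Rightarrow> real" where
  "pfn m b = pfsum m b / (2 ^ m * fact m)"

definition skew :: "(nat \<Rightarrow> nat \<Rightarrow> real) \<Rightarrow> bool" where
  "skew b \<longleftrightarrow> (\<forall>i j. b j i = - b i j)"

lemma skewD: "skew b \<Longrightarrow> b j i = - b i j"
  unfolding skew_def by blast

lemma skew_diag: "skew b \<Longrightarrow> b i i = 0"
proof -
  assume "skew b"
  then have "b i i = - b i i" by (rule skewD)
  then show ?thesis by linarith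
qed

lemma pfprod_cong:
  assumes "p permutes {..<2 * m}"
    and "\<And>i j. i < 2 * m \<Longrightarrow> j < 2 * m \<Longrightarrow> i \<noteq> j \<Longrightarrow> b i j = b' i j"
  shows "pfprod m b p = pfprod m b' p"
  unfolding pfprod_def
proof (rule prod.cong[OF refl], rule assms(2))
  fix i assume i: "i \<in> {..<m}"
  show "p (2 * i) < 2 * m" "p (2 * i + 1) < 2 * m"
    using permutes_in_image[OF assms(1), of "2 * i"] permutes_in_image[OF assms(1), of "2 * i + 1"] i by auto
  have "2 * i \<noteq> 2 * i + 1" by simp
  then show "p (2 * i) \<noteq> p (2 * i + 1)"
    using injD[OF permutes_inj[OF assms(1)], of "2 * i" "2 * i + 1"] by blast
qed

lemma pfsum_cong:
  assumes "\<And>i j. i < 2 * m \<Longrightarrow> j < 2 * m \<Longrightarrow> i \<noteq> j \<Longrightarrow> b i j = b' i j"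
  shows "pfsum m b = pfsum m b'"
  unfolding pfsum_def
proof (rule sum.cong[OF refl])
  fix p assume "p \<in> {p. p permutes {..<2 * m}}"
  then have "pfprod m b p = pfprod m b' p" by (intro pfprod_cong assms) auto
  then show "real_of_int (sign p) * pfprod m b p = real_of_int (sign p) * pfprod m b' p" by simp
qed

lemma permutes_permutation: "p permutes {..<n::nat} \<Longrightarrow> permutation p"
  by (auto simp: permutation_permutes)

text \<open>Once index \<open>s\<close> is copied over \<open>r\<close>, exchanging the values
  \<open>r\<close> and \<open>s\<close> of a permutation keeps the product and reverses the
  sign.\<close>

lemma pfsum_identify:
  assumes r: "r < 2 * m" and s: "s < 2 * m" and rs: "r \<noteq> s"
  defines "\<phi> \<equiv> \<lambda>i. if i = r then s else i"
  shows "pfsum m (\<lambda>i j. b (\<phi> i) (\<phi> j)) = 0"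
proof -
  let ?c = "\<lambda>i j. b (\<phi> i) (\<phi> j)"
  have t: "Transposition.transpose r s permutes {..<2 * m}" using r s by (intro permutes_swap_id) auto
  have \<phi>: "\<phi> (Transposition.transpose r s x) = \<phi> x" for x by (auto simp: \<phi>_def Transposition.transpose_def)
  have "pfsum m ?c = (\<Sum>p | p permutes {..<2 * m}. real_of_int (sign (Transposition.transpose r s \<circ> p)) * pfprod m ?c (Transposition.transpose r s \<circ> p))"
    unfolding pfsum_def by (rule setum_permutations_compose_left[OF t])
  also have "\<dots> = (\<Sum>p | p permutes {..<2 * m}. - (real_of_int (sign p) * pfprod m ?c p))"
    by (rule sum.cong) (use rs in \<open>auto simp: sign_compose permutation_swap_id permutes_permutation sign_swap_id pfprod_def \<phi>\<close>)
  also have "\<dots> = - pfsum m ?c" by (simp add: pfsum_def sum_negf)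
  finally show ?thesis by simp
qed

text \<open>Diagonal entries never enter a pfaffian, so nothing is required of \<open>b' r r\<close>.\<close>

lemma pfsum_row_operation:
  assumes r: "r < 2 * m" and s: "s < 2 * m" "s' < 2 * m" and rs: "r \<noteq> s" "r \<noteq> s'"
    and b': "\<And>i j. i \<noteq> r \<Longrightarrow> j \<noteq> r \<Longrightarrow> b' i j = b i j"
      "\<And>j. j \<noteq> r \<Longrightarrow> b' r j = b r j + c * b s j + c' * b s' j"
      "\<And>i. i \<noteq> r \<Longrightarrow> b' i r = b i r + c * b i s + c' * b i s'"
  shows "pfsum m b' = pfsum m b"
proof -
  define \<phi> where "\<phi> s i = (if i = r then s else i)" for s i
  have prod: "pfprod m b' p = pfprod m b p + c * pfprod m (\<lambda>i j. b (\<phi> s i) (\<phi> s j)) p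
      + c' * pfprod m (\<lambda>i j. b (\<phi> s' i) (\<phi> s' j)) p" if p: "p permutes {..<2 * m}" for p
  proof -
    \<comment> \<open>\<open>x\<close> is the position of the value \<open>r\<close>. Only the
      factor \<open>i0\<close> containing this position involves row or column \<open>r\<close>, so
      every product is linear in them.\<close>
    define x where "x = inv_into UNIV p r"
    have px: "p x = r" using p by (simp add: x_def permutes_inverses)
    have x: "x < 2 * m" using permutes_in_image[OF p, of x] px r by simp
    define i0 where "i0 = x div 2"
    have i0: "i0 \<in> {..<m}" using x by (auto simp: i0_def)
    have p_eq: "p y = r \<longleftrightarrow> y = x" for y using px injD[OF permutes_inj[OF p], of y x] by auto
    have other: "p (2 * i) \<noteq> r \<and> p (2 * i + 1) \<noteq> r" if "i \<noteq> i0" for i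
      using that unfolding p_eq i0_def by auto
    have split: "pfprod m d p = d (p (2 * i0)) (p (2 * i0 + 1)) * (\<Prod>i\<in>{..<m} - {i0}. d (p (2 * i)) (p (2 * i + 1)))" for d
      unfolding pfprod_def using i0 by (intro prod.remove) auto
    have rest: "(\<Prod>i\<in>{..<m} - {i0}. d (p (2 * i)) (p (2 * i + 1))) = (\<Prod>i\<in>{..<m} - {i0}. b (p (2 * i)) (p (2 * i + 1)))"
      if "\<And>i j. i \<noteq> r \<Longrightarrow> j \<noteq> r \<Longrightarrow> d i j = b i j" for d
      using other that by (intro prod.cong) auto
    have r1: "(\<Prod>i\<in>{..<m} - {i0}. b' (p (2 * i)) (p (2 * i + 1))) = (\<Prod>i\<in>{..<m} - {i0}. b (p (2 * i)) (p (2 * i + 1)))"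
      using b'(1) by (rule rest)
    have r2: "(\<Prod>i\<in>{..<m} - {i0}. b (\<phi> t (p (2 * i))) (\<phi> t (p (2 * i + 1)))) = (\<Prod>i\<in>{..<m} - {i0}. b (p (2 * i)) (p (2 * i + 1)))" for t
      by (rule rest[of "\<lambda>i j. b (\<phi> t i) (\<phi> t j)"]) (auto simp: \<phi>_def)
    have "b' (p (2 * i0)) (p (2 * i0 + 1)) = b (p (2 * i0)) (p (2 * i0 + 1))
      + c * b (\<phi> s (p (2 * i0))) (\<phi> s (p (2 * i0 + 1))) + c' * b (\<phi> s' (p (2 * i0))) (\<phi> s' (p (2 * i0 + 1)))"
    proof (cases "even x")
      case True
      then have "2 * i0 = x" by (simp add: i0_def)
      then have "p (2 * i0) = r" "p (2 * i0 + 1) \<noteq> r" unfolding p_eq by auto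
      then show ?thesis by (simp add: \<phi>_def b'(2))
    next
      case False
      then have "2 * i0 + 1 = x" by (simp add: i0_def)
      then have "p (2 * i0 + 1) = r" "p (2 * i0) \<noteq> r" unfolding p_eq by auto
      then show ?thesis by (simp add: \<phi>_def b'(3))
    qed
    then show ?thesis unfolding split r1 r2 by (simp add: algebra_simps)
  qed
  have "pfsum m b' = (\<Sum>p | p permutes {..<2 * m}. real_of_int (sign p) * pfprod m b p
     + c * (real_of_int (sign p) * pfprod m (\<lambda>i j. b (\<phi> s i) (\<phi> s j)) p)
     + c' * (real_of_int (sign p) * pfprod m (\<lambda>i j. b (\<phi> s' i) (\<phi> s' j)) p))"
    unfolding pfsum_def by (rule sum.cong) (auto simp: prod algebra_simps)
  also have "\<dots> = pfsum m b + c * pfsum m (\<lambda>i j. b (\<phi> s i) (\<phi> s j)) + c' * pfsum m (\<lambda>i j. b (\<phi> s' i) (\<phi> s' j))"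
    by (simp add: pfsum_def sum.distrib sum_distrib_left)
  also have "\<dots> = pfsum m b"
    unfolding \<phi>_def using pfsum_identify[OF r s(1) rs(1)] pfsum_identify[OF r s(2) rs(2)] by simp
  finally show ?thesis .
qed

section \<open>Splitting off the upper left block\<close>

lemma pfprod_swap_in_pair:
  assumes b: "skew b" and i: "i < m"
  shows "pfprod m b (p \<circ> Transposition.transpose (2 * i) (2 * i + 1)) = - pfprod m b p"
proof -
  let ?t = "Transposition.transpose (2 * i) (2 * i + 1)"
  have "pfprod m b (p \<circ> ?t) = b (p (2 * i + 1)) (p (2 * i)) * (\<Prod>k\<in>{..<m} - {i}. b ((p \<circ> ?t) (2 * k)) ((p \<circ> ?t) (2 * k + 1)))"
    unfolding pfprod_def using i by (subst prod.remove[of _ i]) auto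
  also have "(\<Prod>k\<in>{..<m} - {i}. b ((p \<circ> ?t) (2 * k)) ((p \<circ> ?t) (2 * k + 1))) = (\<Prod>k\<in>{..<m} - {i}. b (p (2 * k)) (p (2 * k + 1)))"
  proof (rule prod.cong[OF refl])
    fix k assume "k \<in> {..<m} - {i}"
    then have "2 * k \<noteq> 2 * i" "2 * k \<noteq> 2 * i + 1" "2 * k + 1 \<noteq> 2 * i" "2 * k + 1 \<noteq> 2 * i + 1" by (auto; presburger)+
    then show "b ((p \<circ> ?t) (2 * k)) ((p \<circ> ?t) (2 * k + 1)) = b (p (2 * k)) (p (2 * k + 1))"
      by (simp add: transpose_apply_other)
  qed
  also have "b (p (2 * i + 1)) (p (2 * i)) = - b (p (2 * i)) (p (2 * i + 1))" by (rule skewD[OF b])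
  also have "- b (p (2 * i)) (p (2 * i + 1)) * (\<Prod>k\<in>{..<m} - {i}. b (p (2 * k)) (p (2 * k + 1))) = - pfprod m b p"
    unfolding pfprod_def using i by (subst (2) prod.remove[of _ i]) auto
  finally show ?thesis .
qed

lemma pfprod_swap_pairs:
  assumes i: "i < m" "i \<noteq> 0"
  shows "pfprod m b (p \<circ> (Transposition.transpose 0 (2 * i) \<circ> Transposition.transpose 1 (2 * i + 1))) = pfprod m b p"
proof -
  let ?\<sigma> = "Transposition.transpose 0 (2 * i) \<circ> Transposition.transpose 1 (2 * i + 1)"
  let ?g = "\<lambda>k. b (p (2 * k)) (p (2 * k + 1))"
  have t: "Transposition.transpose 0 i permutes {..<m}" using i by (intro permutes_swap_id) auto
  have "?\<sigma> (2 * k) = 2 * Transposition.transpose 0 i k \<and> ?\<sigma> (2 * k + 1) = 2 * Transposition.transpose 0 i k + 1" for k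
    using i by (auto simp: Transposition.transpose_def)
  then have "pfprod m b (p \<circ> ?\<sigma>) = (\<Prod>k<m. ?g (Transposition.transpose 0 i k))"
    unfolding pfprod_def by (intro prod.cong) auto
  also have "\<dots> = (\<Prod>k<m. ?g k)" using prod.permute[OF t, of ?g] by (simp add: comp_def)
  finally show ?thesis by (simp add: pfprod_def)
qed

text \<open>Exchanging two whole pairs is an even permutation that reorders the factors; exchanging
  the members of a pair is odd and reverses one factor by skewness. Both preserve the signed
  product, and together they bring any position to the front.\<close>

lemma move_to_front:
  assumes b: "skew b" and x: "x < 2 * m"
  obtains \<sigma> where "\<sigma> permutes {..<2 * m}" "\<sigma> 0 = x"
    "\<And>p. p permutes {..<2 * m} \<Longrightarrow> real_of_int (sign (p \<circ> \<sigma>)) * pfprod m b (p \<circ> \<sigma>) = real_of_int (sign p) * pfprod m b p"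
proof -
  define i where "i = x div 2"
  have i: "i < m" using x by (auto simp: i_def)
  obtain \<rho> where \<rho>: "\<rho> permutes {..<2 * m}" "\<rho> 0 = 2 * i" "\<rho> 1 = 2 * i + 1" "sign \<rho> = 1"
    "\<And>p. pfprod m b (p \<circ> \<rho>) = pfprod m b p"
  proof (cases "i = 0")
    case True
    show ?thesis by (rule that[of id]) (use True in \<open>auto simp: permutes_id\<close>)
  next
    case False
    show ?thesis
    proof (rule that[of "Transposition.transpose 0 (2 * i) \<circ> Transposition.transpose 1 (2 * i + 1)"])
      show "Transposition.transpose 0 (2 * i) \<circ> Transposition.transpose 1 (2 * i + 1) permutes {..<2 * m}"
        using i by (intro permutes_compose permutes_swap_id) auto
      show "sign (Transposition.transpose 0 (2 * i) \<circ> Transposition.transpose 1 (2 * i + 1)) = 1"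
        using False by (simp add: sign_compose permutation_swap_id sign_swap_id)
    qed (use False i pfprod_swap_pairs[of i m b] in \<open>auto simp: Transposition.transpose_def\<close>)
  qed
  show ?thesis
  proof (cases "even x")
    case True
    show ?thesis
    proof (rule that[OF \<rho>(1)])
      show "\<rho> 0 = x" using \<rho>(2) True by (simp add: i_def)
      show "real_of_int (sign (p \<circ> \<rho>)) * pfprod m b (p \<circ> \<rho>) = real_of_int (sign p) * pfprod m b p"
        if "p permutes {..<2 * m}" for p
        using that \<rho> by (simp add: sign_compose permutes_permutation)
    qed
  next
    case False
    have t: "Transposition.transpose 0 1 permutes {..<2 * m}" using i by (intro permutes_swap_id) auto
    show ?thesis
    proof (rule that[of "\<rho> \<circ> Transposition.transpose 0 1"])
      show "\<rho> \<circ> Transposition.transpose 0 1 permutes {..<2 * m}" by (intro permutes_compose t \<rho>)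
      show "(\<rho> \<circ> Transposition.transpose 0 1) 0 = x" using \<rho>(3) False by (simp add: i_def)
      fix p assume p: "p permutes {..<2 * m}"
      have "pfprod m b ((p \<circ> \<rho>) \<circ> Transposition.transpose (2 * 0) (2 * 0 + 1)) = - pfprod m b (p \<circ> \<rho>)"
        using i by (intro pfprod_swap_in_pair[OF b]) simp
      moreover have "sign ((p \<circ> \<rho>) \<circ> Transposition.transpose 0 1) = - sign p"
        using p \<rho> by (simp add: sign_compose permutes_permutation permutation_compose permutation_swap_id sign_swap_id)
      ultimately show "real_of_int (sign (p \<circ> (\<rho> \<circ> Transposition.transpose 0 1))) * pfprod m b (p \<circ> (\<rho> \<circ> Transposition.transpose 0 1))
          = real_of_int (sign p) * pfprod m b p"
        using \<rho>(5) by (simp add: comp_assoc)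
    qed
  qed
qed

lemma permutes_inv_eq_iff: "p permutes S \<Longrightarrow> inv_into UNIV p y = x \<longleftrightarrow> p x = y"
  by (metis permutes_inverses)

text \<open>The permutations are grouped by the position \<open>x\<close> at which the value 0
  occurs; \<open>move_to_front\<close> matches each of the \<open>2 * m\<close> groups with the
  group \<open>x = 0\<close>.\<close>

lemma pfsum_fix_0:
  assumes b: "skew b" and m: "0 < m"
  shows "pfsum m b = real (2 * m) * (\<Sum>p | p permutes {..<2 * m} \<and> p 0 = 0. real_of_int (sign p) * pfprod m b p)"
proof -
  let ?P = "{p. p permutes {..<2 * m}}"
  let ?f = "\<lambda>p. real_of_int (sign p) * pfprod m b p"
  have fin: "finite ?P" by (rule finite_permutations) simp
  have inv: "inv_into UNIV p 0 \<in> {..<2 * m}" if "p \<in> ?P" for p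
    using that permutes_in_image[OF permutes_inv[of p "{..<2 * m}"], of 0] m by simp
  have "(\<Sum>x<2 * m. \<Sum>p\<in>{p \<in> ?P. inv_into UNIV p 0 = x}. ?f p) = sum ?f ?P"
    using inv fin by (intro sum.group) auto
  then have "pfsum m b = (\<Sum>x<2 * m. \<Sum>p\<in>{p \<in> ?P. inv_into UNIV p 0 = x}. ?f p)"
    by (simp add: pfsum_def)
  also have "\<dots> = (\<Sum>x<2 * m. \<Sum>p\<in>{p \<in> ?P. p 0 = 0}. ?f p)"
  proof (rule sum.cong[OF refl])
    fix x assume "x \<in> {..<2 * m}"
    then obtain \<sigma> where \<sigma>: "\<sigma> permutes {..<2 * m}" "\<sigma> 0 = x" "\<And>p. p permutes {..<2 * m} \<Longrightarrow> ?f (p \<circ> \<sigma>) = ?f p"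
      using move_to_front[OF b] by auto
    show "(\<Sum>p\<in>{p \<in> ?P. inv_into UNIV p 0 = x}. ?f p) = (\<Sum>p\<in>{p \<in> ?P. p 0 = 0}. ?f p)"
    proof (rule sum.reindex_bij_witness[of _ "\<lambda>p. p \<circ> inv_into UNIV \<sigma>" "\<lambda>p. p \<circ> \<sigma>"])
      fix p assume p: "p \<in> {p \<in> ?P. inv_into UNIV p 0 = x}"
      show "p \<circ> \<sigma> \<circ> inv_into UNIV \<sigma> = p" using \<sigma>(1) by (simp add: comp_assoc permutes_inv_o)
      have pp: "p permutes {..<2 * m}" "inv_into UNIV p 0 = x" using p by auto
      have "p x = 0" using pp(2) permutes_inv_eq_iff[OF pp(1), of 0 x] by simp
      then show "p \<circ> \<sigma> \<in> {p \<in> ?P. p 0 = 0}" using permutes_compose[OF \<sigma>(1) pp(1)] \<sigma>(2) by simp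
      show "?f (p \<circ> \<sigma>) = ?f p" by (rule \<sigma>(3)[OF pp(1)])
    next
      fix p assume p: "p \<in> {p \<in> ?P. p 0 = 0}"
      show "p \<circ> inv_into UNIV \<sigma> \<circ> \<sigma> = p" using \<sigma>(1) by (simp add: comp_assoc permutes_inv_o)
      have q: "p \<circ> inv_into UNIV \<sigma> permutes {..<2 * m}" using p \<sigma>(1) by (intro permutes_compose permutes_inv) auto
      moreover have "(p \<circ> inv_into UNIV \<sigma>) x = 0" using p \<sigma>(2) permutes_inv_eq_iff[OF \<sigma>(1), of x 0] by simp
      ultimately show "p \<circ> inv_into UNIV \<sigma> \<in> {p \<in> ?P. inv_into UNIV p 0 = x}" using permutes_inv_eq_iff[OF q] by simp
    qed
  qed
  also have "\<dots> = real (2 * m) * (\<Sum>p\<in>{p \<in> ?P. p 0 = 0}. ?f p)" by simp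
  finally show ?thesis by simp
qed

lemma sum_permutes_fix_01:
  "(\<Sum>p | p permutes {..<2 * Suc m} \<and> p 0 = 0 \<and> p 1 = 1. f p)
   = (\<Sum>q | q permutes {..<2 * m}. f (map_permutation {..<2 * m} (\<lambda>x. x + 2) q))"
proof -
  have bij: "bij_betw (\<lambda>x. x + 2) {..<2 * m} {2..<2 * Suc m}"
    by (rule bij_betwI[of _ _ _ "\<lambda>x. x - 2"]) auto
  have bij': "bij_betw (\<lambda>x. x - 2) {2..<2 * Suc m} {..<2 * m}"
    by (rule bij_betwI[of _ _ _ "\<lambda>x. x + 2"]) auto
  have eq: "{p. p permutes {..<2 * Suc m} \<and> p 0 = 0 \<and> p 1 = 1} = {p. p permutes {2..<2 * Suc m}}"
  proof (intro equalityI subsetI)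
    fix p assume p: "p \<in> {p. p permutes {..<2 * Suc m} \<and> p 0 = 0 \<and> p 1 = 1}"
    have "p permutes {2..<2 * Suc m}"
    proof (rule permutes_superset)
      show "p permutes {..<2 * Suc m}" using p by simp
      fix x assume "x \<in> {..<2 * Suc m} - {2..<2 * Suc m}"
      then have "x = 0 \<or> x = 1" by auto
      then show "p x = x" using p by auto
    qed
    then show "p \<in> {p. p permutes {2..<2 * Suc m}}" by simp
  next
    fix p assume "p \<in> {p. p permutes {2..<2 * Suc m}}"
    then have p: "p permutes {2..<2 * Suc m}" by simp
    have "p permutes {..<2 * Suc m}" by (rule permutes_subset[OF p]) auto
    moreover have "p 0 = 0" "p 1 = 1" by (rule permutes_not_in[OF p], simp)+
    ultimately show "p \<in> {p. p permutes {..<2 * Suc m} \<and> p 0 = 0 \<and> p 1 = 1}" by simp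
  qed
  show ?thesis
    unfolding eq
  proof (rule sum.reindex_bij_witness[of _ "map_permutation {..<2 * m} (\<lambda>x. x + 2)" "map_permutation {2..<2 * Suc m} (\<lambda>x. x - 2)"])
    fix p assume p: "p \<in> {p. p permutes {2..<2 * Suc m}}"
    have "map_permutation {..<2 * m} (\<lambda>x. x + 2) (map_permutation {2..<2 * Suc m} (\<lambda>x. x - 2) p)
        = map_permutation {2..<2 * Suc m} ((\<lambda>x. x + 2) \<circ> (\<lambda>x. x - 2)) p"
      using p bij' bij_betw_imp_inj_on[OF bij] by (intro map_permutation_compose) auto
    also have "\<dots> = map_permutation {2..<2 * Suc m} (\<lambda>x. x) p"
      using p bij_betw_imp_inj_on[OF bij'] by (intro map_permutation_cong) (auto intro!: inj_onI)
    also have "\<dots> = p" using p by simp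
    finally show "map_permutation {..<2 * m} (\<lambda>x. x + 2) (map_permutation {2..<2 * Suc m} (\<lambda>x. x - 2) p) = p" .
    then show "f (map_permutation {..<2 * m} (\<lambda>x. x + 2) (map_permutation {2..<2 * Suc m} (\<lambda>x. x - 2) p)) = f p" by simp
    show "map_permutation {2..<2 * Suc m} (\<lambda>x. x - 2) p \<in> {q. q permutes {..<2 * m}}"
      using map_permutation_permutes[OF bij'] p by simp
  next
    fix q assume q: "q \<in> {q. q permutes {..<2 * m}}"
    have "map_permutation {2..<2 * Suc m} (\<lambda>x. x - 2) (map_permutation {..<2 * m} (\<lambda>x. x + 2) q)
        = map_permutation {..<2 * m} ((\<lambda>x. x - 2) \<circ> (\<lambda>x. x + 2)) q"
      using q bij bij_betw_imp_inj_on[OF bij'] by (intro map_permutation_compose) auto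
    also have "\<dots> = map_permutation {..<2 * m} (\<lambda>x. x) q" by (simp add: comp_def)
    also have "\<dots> = q" using q by simp
    finally show "map_permutation {2..<2 * Suc m} (\<lambda>x. x - 2) (map_permutation {..<2 * m} (\<lambda>x. x + 2) q) = q" .
    show "map_permutation {..<2 * m} (\<lambda>x. x + 2) q \<in> {p. p permutes {2..<2 * Suc m}}"
      using map_permutation_permutes[OF bij] q by simp
  qed
qed

text \<open>With 0 in front, a nonzero product forces 1 to be its partner. The factor
  \<open>2 * Suc m\<close> from \<open>pfsum_fix_0\<close> is exactly the quotient of the two
  normalizing constants.\<close>

lemma pfn_block:
  assumes b: "skew b" and zero: "\<And>j. 2 \<le> j \<Longrightarrow> j < 2 * Suc m \<Longrightarrow> b 0 j = 0"
  shows "pfn (Suc m) b = b 0 1 * pfn m (\<lambda>i j. b (i + 2) (j + 2))"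
proof -
  let ?d = "\<lambda>i j. b (i + 2) (j + 2)"
  let ?f = "\<lambda>p. real_of_int (sign p) * pfprod (Suc m) b p"
  let ?e = "map_permutation {..<2 * m} (\<lambda>x. x + 2 :: nat)"
  have "(\<Sum>p | p permutes {..<2 * Suc m} \<and> p 0 = 0. ?f p) = (\<Sum>p | p permutes {..<2 * Suc m} \<and> p 0 = 0 \<and> p 1 = 1. ?f p)"
  proof (rule sum.mono_neutral_right)
    show "finite {p. p permutes {..<2 * Suc m} \<and> p 0 = 0}"
      by (rule finite_subset[OF _ finite_permutations[of "{..<2 * Suc m}"]]) auto
    show "\<forall>p\<in>{p. p permutes {..<2 * Suc m} \<and> p 0 = 0} - {p. p permutes {..<2 * Suc m} \<and> p 0 = 0 \<and> p 1 = 1}. ?f p = 0"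
    proof
      fix p assume "p \<in> {p. p permutes {..<2 * Suc m} \<and> p 0 = 0} - {p. p permutes {..<2 * Suc m} \<and> p 0 = 0 \<and> p 1 = 1}"
      then have p: "p permutes {..<2 * Suc m}" "p 0 = 0" "p 1 \<noteq> 1" by auto
      have "p 1 < 2 * Suc m" using permutes_in_image[OF p(1), of 1] by simp
      moreover have "p 1 \<noteq> 0" using injD[OF permutes_inj[OF p(1)], of 1 0] p(2) by auto
      ultimately have "b (p 0) (p 1) = 0" using p(2,3) zero[of "p 1"] by simp
      then have "pfprod (Suc m) b p = 0" unfolding pfprod_def
        by (intro prod_zero) (auto intro!: bexI[of _ 0])
      then show "?f p = 0" by simp
    qed
  qed auto
  also have "\<dots> = (\<Sum>q | q permutes {..<2 * m}. ?f (?e q))" by (rule sum_permutes_fix_01)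
  also have "\<dots> = (\<Sum>q | q permutes {..<2 * m}. b 0 1 * (real_of_int (sign q) * pfprod m ?d q))"
  proof (rule sum.cong[OF refl])
    fix q assume "q \<in> {q. q permutes {..<2 * m}}"
    then have q: "q permutes {..<2 * m}" by simp
    have inj: "inj_on (\<lambda>x. x + 2 :: nat) {..<2 * m}" by (auto intro: inj_onI)
    have e: "?e q (x + 2) = q x + 2" if "x < 2 * m" for x
    proof -
      have "inv_into {..<2 * m} (\<lambda>x. x + 2) (x + 2) = x" by (rule inv_into_f_f[OF inj]) (use that in simp)
      moreover have "x + 2 \<in> (\<lambda>x. x + 2) ` {..<2 * m}" using that by blast
      ultimately show ?thesis by (simp only: map_permutation_def restrict_id_def comp_def if_True)
    qed
    have e01: "?e q 0 = 0" "?e q 1 = 1" by (auto simp: map_permutation_def restrict_id_def)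
    have "pfprod (Suc m) b (?e q) = b (?e q 0) (?e q 1) * (\<Prod>i<m. b (?e q (2 * Suc i)) (?e q (2 * Suc i + 1)))"
      unfolding pfprod_def by (subst prod.lessThan_Suc_shift) simp
    also have "(\<Prod>i<m. b (?e q (2 * Suc i)) (?e q (2 * Suc i + 1))) = pfprod m ?d q"
      unfolding pfprod_def
    proof (rule prod.cong[OF refl])
      fix i assume "i \<in> {..<m}"
      then show "b (?e q (2 * Suc i)) (?e q (2 * Suc i + 1)) = ?d (q (2 * i)) (q (2 * i + 1))"
        using e[of "2 * i"] e[of "2 * i + 1"] by simp
    qed
    finally have "pfprod (Suc m) b (?e q) = b 0 1 * pfprod m ?d q" by (simp only: e01)
    moreover have "sign (?e q) = sign q" using inj q by (intro sign_map_permutation) auto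
    ultimately show "?f (?e q) = b 0 1 * (real_of_int (sign q) * pfprod m ?d q)" by simp
  qed
  also have "\<dots> = b 0 1 * pfsum m ?d" by (simp add: pfsum_def sum_distrib_left)
  finally have "pfsum (Suc m) b = real (2 * Suc m) * (b 0 1 * pfsum m ?d)"
    using pfsum_fix_0[OF b, of "Suc m"] by simp
  moreover have "2 ^ Suc m * fact (Suc m) = (2 * real (Suc m)) * (2 ^ m * fact m)" by simp
  moreover have "real (2 * Suc m) = 2 * real (Suc m)" by simp
  ultimately have "pfn (Suc m) b = (2 * real (Suc m)) * (b 0 1 * pfsum m ?d) / ((2 * real (Suc m)) * (2 ^ m * fact m))"
    unfolding pfn_def by (simp only:)
  also have "\<dots> = b 0 1 * pfn m ?d"
    by (subst mult_divide_mult_cancel_left) (simp_all add: pfn_def del: of_nat_Suc)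
  finally show ?thesis .
qed

lemma skew_red: "skew b \<Longrightarrow> skew (red b)"
  unfolding skew_def
proof (intro allI)
  fix i j assume b: "\<forall>i j. b j i = - b i j"
  have "b (j + 2) (i + 2) = - b (i + 2) (j + 2)" using b by blast
  then show "red b j i = - red b i j" by (simp add: red_def diff_divide_distrib algebra_simps)
qed

text \<open>Rows and columns \<open>2, 3, \<dots>\<close> are cleared against the invertible upper left block one after
  the other; \<open>bb R\<close> is the matrix once those with index below \<open>R\<close> have been treated.\<close>

lemma pfn_red:
  assumes b: "skew b" and t: "b 0 1 \<noteq> 0"
  shows "pfn (Suc m) b = b 0 1 * pfn m (red b)"
proof -
  \<comment> \<open>The coefficients solve the system that clears the entries \<open>(0, r)\<close>
    and \<open>(1, r)\<close> when \<open>\<alpha> r\<close> times column 0 and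
    \<open>\<beta> r\<close> times column 1 are added to column \<open>r\<close>.\<close>
  define \<alpha> where "\<alpha> r = b 1 r / b 0 1" for r
  define \<beta> where "\<beta> r = - b 0 r / b 0 1" for r
  define on where "on R r = (if 2 \<le> r \<and> r < R then 1 else 0 :: real)" for R r :: nat
  \<comment> \<open>A closed form for the simultaneous row and column operations; the last summand
    arises where a treated row meets a treated column.\<close>
  define bb where "bb R i j = b i j
     + on R i * (\<alpha> i * b 0 j + \<beta> i * b 1 j) + on R j * (\<alpha> j * b i 0 + \<beta> j * b i 1)
     + on R i * on R j * ((\<alpha> i * \<beta> j - \<beta> i * \<alpha> j) * b 0 1)" for R i j
  have step: "pfsum (Suc m) (bb (Suc R)) = pfsum (Suc m) (bb R)" if R: "2 \<le> R" "R < 2 * Suc m" for R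
  proof (rule pfsum_row_operation[of R _ 0 1 _ _ "\<alpha> R" "\<beta> R"])
    have on01: "on Q 0 = 0" "on Q 1 = 0" for Q by (simp_all add: on_def)
    have onR: "on (Suc R) R = 1" "on R R = 0" using R by (simp_all add: on_def)
    have on: "on (Suc R) i = on R i" if "i \<noteq> R" for i using that by (auto simp: on_def)
    show "bb (Suc R) i j = bb R i j" if "i \<noteq> R" "j \<noteq> R" for i j
      using that by (simp add: bb_def on)
    have d: "b 0 0 = 0" "b 1 1 = 0" "b 1 0 = - b 0 1" using b skewD[OF b, of 0 1] by (auto simp: skew_diag)
    show "bb (Suc R) R j = bb R R j + \<alpha> R * bb R 0 j + \<beta> R * bb R 1 j" if "j \<noteq> R" for j
      by (simp only: bb_def on[OF that] onR on01 d) (simp add: algebra_simps)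
    show "bb (Suc R) i R = bb R i R + \<alpha> R * bb R i 0 + \<beta> R * bb R i 1" if "i \<noteq> R" for i
      by (simp only: bb_def on[OF that] onR on01 d) (simp add: algebra_simps)
  qed (use R in auto)
  have all: "pfsum (Suc m) (bb (2 + k)) = pfsum (Suc m) b" if "k \<le> 2 * m" for k
    using that
  proof (induction k)
    case 0
    have "bb 2 = b" by (simp add: bb_def on_def fun_eq_iff)
    then show ?case by simp
  next
    case (Suc k)
    then show ?case using step[of "2 + k"] by simp
  qed
  define B where "B = bb (2 + 2 * m)"
  have skB: "skew B"
    unfolding skew_def
  proof (intro allI)
    fix i j
    show "B j i = - B i j"
      using skewD[OF b, of i j] skewD[OF b, of 0 j] skewD[OF b, of 1 j] skewD[OF b, of 0 i] skewD[OF b, of 1 i]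
      by (simp add: B_def bb_def algebra_simps)
  qed
  have B: "B (i + 2) (j + 2) = red b i j" if "i < 2 * m" "j < 2 * m" for i j
  proof -
    have "on (2 + 2 * m) (i + 2) = 1" "on (2 + 2 * m) (j + 2) = 1" using that by (simp_all add: on_def)
    then have "B (i + 2) (j + 2) = b (i + 2) (j + 2)
        + (\<alpha> (i + 2) * b 0 (j + 2) + \<beta> (i + 2) * b 1 (j + 2)) - (\<alpha> (j + 2) * b 0 (i + 2) + \<beta> (j + 2) * b 1 (i + 2))
        + ((\<alpha> (i + 2) * \<beta> (j + 2) - \<beta> (i + 2) * \<alpha> (j + 2)) * b 0 1)"
      using skewD[OF b, of 0 "i + 2"] skewD[OF b, of 1 "i + 2"] by (simp add: B_def bb_def)
    also have "\<dots> = red b i j"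
    proof -
      have ab: "\<alpha> r * b 0 1 = b 1 r" "\<beta> r * b 0 1 = - b 0 r" for r
        using t by (simp_all add: \<alpha>_def \<beta>_def)
      define x where "x = \<alpha> (i + 2)"
      define y where "y = \<beta> (i + 2)"
      define x' where "x' = \<alpha> (j + 2)"
      define y' where "y' = \<beta> (j + 2)"
      have bs: "b 1 (i + 2) = x * b 0 1" "b 0 (i + 2) = - (y * b 0 1)" "b 1 (j + 2) = x' * b 0 1" "b 0 (j + 2) = - (y' * b 0 1)"
        unfolding x_def y_def x'_def y'_def ab by simp_all
      have "(b 0 (i + 2) * b 1 (j + 2) - b 0 (j + 2) * b 1 (i + 2)) = (x * y' - y * x') * b 0 1 * b 0 1"
        unfolding bs by (simp add: algebra_simps)
      then have "red b i j = b (i + 2) (j + 2) - (x * y' - y * x') * b 0 1"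
        using t by (simp add: red_def)
      then show ?thesis
        unfolding x_def[symmetric] y_def[symmetric] x'_def[symmetric] y'_def[symmetric] bs
        by (simp add: algebra_simps)
    qed
    finally show ?thesis .
  qed
  have B0: "B 0 j = 0" if "2 \<le> j" "j < 2 * Suc m" for j
  proof -
    have "on (2 + 2 * m) 0 = 0" "on (2 + 2 * m) j = 1" using that by (simp_all add: on_def)
    then show ?thesis using t skew_diag[OF b, of 0] by (simp add: B_def bb_def \<beta>_def)
  qed
  have B01: "B 0 1 = b 0 1" by (simp add: B_def bb_def on_def)
  have "pfn (Suc m) b = pfn (Suc m) B" using all[of "2 * m"] by (simp add: pfn_def B_def)
  also have "\<dots> = b 0 1 * pfn m (\<lambda>i j. B (i + 2) (j + 2))"
    unfolding B01[symmetric] using skB B0 by (rule pfn_block)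
  also have "pfn m (\<lambda>i j. B (i + 2) (j + 2)) = pfn m (red b)"
  proof -
    have "pfsum m (\<lambda>i j. B (i + 2) (j + 2)) = pfsum m (red b)" by (rule pfsum_cong) (rule B)
    then show ?thesis by (simp only: pfn_def)
  qed
  finally show ?thesis .
qed

lemma pfn_0 [simp]: "pfn 0 b = 1"
  by (simp add: pfn_def pfsum_def pfprod_def)

lemma pfn_1: "skew b \<Longrightarrow> pfn 1 b = b 0 1"
  using pfn_block[of b 0] by simp

lemma skew_red_pow: "skew b \<Longrightarrow> skew ((red ^^ j) b)"
  by (induction j) (auto intro: skew_red)

text \<open>By \<open>pfn_red\<close> the product of all pivots is the larger pfaffian. Writing the
  fractional part of the last pivot as its value minus its floor leaves that floor times the product
  of the other pivots, the pfaffian of the leading block with two rows fewer.\<close>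

lemma chain_trace_eq:
  assumes "skew b" "chain_ok k b"
  shows "chain_trace k b = pfn (Suc k) b - of_int \<lfloor>(red ^^ k) b 0 1\<rfloor> * pfn k b"
  using assms
proof (induction k arbitrary: b)
  case 0
  then show ?case using pfn_1[of b] by (simp add: frac_def)
next
  case (Suc k)
  then have t: "b 0 1 \<noteq> 0" by auto
  have "chain_trace (Suc k) b = b 0 1 * (pfn (Suc k) (red b) - of_int \<lfloor>(red ^^ k) (red b) 0 1\<rfloor> * pfn k (red b))"
    using Suc.IH[OF skew_red[OF Suc.prems(1)]] Suc.prems(2) by simp
  also have "\<dots> = pfn (Suc (Suc k)) b - of_int \<lfloor>(red ^^ k) (red b) 0 1\<rfloor> * pfn (Suc k) b"
    unfolding pfn_red[OF Suc.prems(1) t] by (simp add: algebra_simps)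
  finally show ?case by (simp add: funpow_swap1)
qed

lemma chain_ok_iff:
  "chain_ok k b \<longleftrightarrow> (\<forall>j<k. 0 < (red ^^ j) b 0 1 \<and> (red ^^ j) b 0 1 < 1) \<and> (red ^^ k) b 0 1 \<notin> \<int>"
  by (induction k arbitrary: b) (auto simp: less_Suc_eq_0_disj funpow_swap1)

section \<open>Matrices, submatrices and monomials\<close>

lemma pf_mat: "pf (Matrix.mat (2 * m) (2 * m) (\<lambda>(i, j). b i j)) = pfn m b"
proof -
  have "(\<Prod>i<m. Matrix.mat (2 * m) (2 * m) (\<lambda>(i, j). b i j) $$ (p (2 * i), p (2 * i + 1))) = pfprod m b p"
    if p: "p permutes {..<2 * m}" for p
    unfolding pfprod_def
  proof (rule prod.cong[OF refl])
    fix i assume "i \<in> {..<m}"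
    then have "p (2 * i) < 2 * m" "p (2 * i + 1) < 2 * m"
      using permutes_in_image[OF p, of "2 * i"] permutes_in_image[OF p, of "2 * i + 1"] by auto
    then show "Matrix.mat (2 * m) (2 * m) (\<lambda>(i, j). b i j) $$ (p (2 * i), p (2 * i + 1)) = b (p (2 * i)) (p (2 * i + 1))"
      by simp
  qed
  then have "(\<Sum>p | p permutes {..<2 * m}. real_of_int (sign p) * (\<Prod>i<m. Matrix.mat (2 * m) (2 * m) (\<lambda>(i, j). b i j) $$ (p (2 * i), p (2 * i + 1)))) = pfsum m b"
    unfolding pfsum_def by (intro sum.cong) auto
  then show ?thesis by (simp add: pf_def pfn_def)
qed

lemma upper_left_block_mat:
  assumes "2 \<le> n"
  shows "upper_left_block (Matrix.mat n n (\<lambda>(i, j). b i j)) = Matrix.mat (2 * 1) (2 * 1) (\<lambda>(i, j). b i j)"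
  using assms by (intro eq_matI) (auto simp: upper_left_block_def split_block_def Let_def)

lemma pf_upper_left_block:
  assumes "skew b" "2 \<le> n"
  shows "pf (upper_left_block (Matrix.mat n n (\<lambda>(i, j). b i j))) = b 0 1"
  unfolding upper_left_block_mat[OF assms(2)] pf_mat using pfn_1[OF assms(1)] .

text \<open>No elimination is carried out: the exhibited inverse shows that the block is a unit,
  hence \<open>mat_inverse\<close> returns some inverse, and uniqueness identifies it.\<close>

lemma mat_inverse_skew_2:
  assumes t: "t \<noteq> (0 :: real)"
  shows "mat_inverse (Matrix.mat 2 2 (\<lambda>(i, j). if i = j then 0 else if i = 0 then t else - t))
    = Some (Matrix.mat 2 2 (\<lambda>(i, j). if i = j then 0 else if i = 0 then - (1 / t) else 1 / t))"
    (is "mat_inverse ?B = Some ?D")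
proof -
  have B: "?B \<in> carrier_mat 2 2" and D: "?D \<in> carrier_mat 2 2" by simp_all
  have two: "{0..<2} = {0, 1 :: nat}" by auto
  have BD: "?B * ?D = 1\<^sub>m 2" and DB: "?D * ?B = 1\<^sub>m 2"
    using t by (intro eq_matI; auto simp: scalar_prod_def two less_2_cases_iff)+
  have "?B \<in> Units (ring_mat TYPE(real) 2 ())"
    using B D BD DB by (auto simp: Units_def ring_mat_def)
  then obtain D' where D': "mat_inverse ?B = Some D'"
    using mat_inverse(1)[OF B, where b = "()"] by (cases "mat_inverse ?B") auto
  then have "D' * ?B = 1\<^sub>m 2" and D'c: "D' \<in> carrier_mat 2 2" using mat_inverse(2)[OF B D'] by auto
  have "D' = D' * (?B * ?D)" using D'c by (simp add: BD)
  also have "\<dots> = (D' * ?B) * ?D" by (rule assoc_mult_mat[OF D'c B D, symmetric])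
  also have "\<dots> = ?D" using \<open>D' * ?B = 1\<^sub>m 2\<close> D by simp
  finally show ?thesis using D' by simp
qed

lemma F_mat:
  assumes b: "skew b" and t: "b 0 1 \<noteq> 0" and n: "2 \<le> n"
  shows "F (Matrix.mat n n (\<lambda>(i, j). b i j)) = Matrix.mat (n - 2) (n - 2) (\<lambda>(i, j). red b i j)"
proof -
  let ?M = "Matrix.mat n n (\<lambda>(i, j). b i j)"
  let ?D = "Matrix.mat 2 2 (\<lambda>(i, j). if i = j then 0 else if i = 0 then - (1 / b 0 1) else 1 / b 0 1)"
  let ?B12 = "Matrix.mat 2 (n - 2) (\<lambda>(i, j). b i (j + 2))"
  let ?B21 = "Matrix.mat (n - 2) 2 (\<lambda>(i, j). b (i + 2) j)"
  let ?B22 = "Matrix.mat (n - 2) (n - 2) (\<lambda>(i, j). b (i + 2) (j + 2))"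
  let ?B11 = "Matrix.mat 2 2 (\<lambda>(i, j). if i = j then 0 else if i = 0 then b 0 1 else - b 0 1)"
  have two: "{0..<2} = {0, 1 :: nat}" by auto
  have 10: "b 1 0 = - b 0 1" using b by (rule skewD)
  have split: "split_block ?M 2 2 = (?B11, ?B12, ?B21, ?B22)"
    unfolding split_block_def Let_def prod.inject
    using n skew_diag[OF b] 10 by (intro conjI eq_matI) (auto simp: less_2_cases_iff)
  have "F ?M = ?B22 - ?B21 * ?D * ?B12"
    unfolding F_def split using mat_inverse_skew_2[OF t] by simp
  also have "\<dots> = Matrix.mat (n - 2) (n - 2) (\<lambda>(i, j). red b i j)"
  proof (rule eq_matI)
    fix i j assume "i < dim_row (Matrix.mat (n - 2) (n - 2) (\<lambda>(i, j). red b i j))"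
      "j < dim_col (Matrix.mat (n - 2) (n - 2) (\<lambda>(i, j). red b i j))"
    then have ij: "i < n - 2" "j < n - 2" by simp_all
    have i0: "b (i + 2) 0 = - b 0 (i + 2)" and i1: "b (i + 2) 1 = - b 1 (i + 2)" using b by (auto intro: skewD)
    have P: "?B21 * ?D = Matrix.mat (n - 2) 2 (\<lambda>(i, j). if j = 0 then b (i + 2) 1 / b 0 1 else - (b (i + 2) 0 / b 0 1))"
      by (intro eq_matI) (auto simp: scalar_prod_def two less_2_cases_iff)
    have "(?B21 * ?D * ?B12) $$ (i, j) = b (i + 2) 1 / b 0 1 * b 0 (j + 2) - b (i + 2) 0 / b 0 1 * b 1 (j + 2)"
      unfolding P using ij by (simp add: scalar_prod_def two)
    then have "(?B22 - ?B21 * ?D * ?B12) $$ (i, j)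
        = b (i + 2) (j + 2) - (b (i + 2) 1 / b 0 1 * b 0 (j + 2) - b (i + 2) 0 / b 0 1 * b 1 (j + 2))"
      using ij by simp
    also have "\<dots> = red b i j"
      unfolding i0 i1 by (simp add: red_def diff_divide_distrib mult.commute)
    finally show "(?B22 - ?B21 * ?D * ?B12) $$ (i, j) = Matrix.mat (n - 2) (n - 2) (\<lambda>(i, j). red b i j) $$ (i, j)"
      using ij by simp
  qed simp_all
  finally show ?thesis .
qed

lemma F_pow_mat:
  assumes "skew b" "\<And>i. i < j \<Longrightarrow> (red ^^ i) b 0 1 \<noteq> 0" "2 * j \<le> n"
  shows "(F ^^ j) (Matrix.mat n n (\<lambda>(i, k). b i k)) = Matrix.mat (n - 2 * j) (n - 2 * j) (\<lambda>(i, k). (red ^^ j) b i k)"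
  using assms(2,3)
proof (induction j)
  case (Suc j)
  have "(F ^^ Suc j) (Matrix.mat n n (\<lambda>(i, k). b i k)) = F (Matrix.mat (n - 2 * j) (n - 2 * j) (\<lambda>(i, k). (red ^^ j) b i k))"
    using Suc by simp
  also have "\<dots> = Matrix.mat (n - 2 * j - 2) (n - 2 * j - 2) (\<lambda>(i, k). red ((red ^^ j) b) i k)"
    using Suc.prems by (intro F_mat skew_red_pow assms(1)) auto
  finally show ?case by (simp add: numeral_eq_Suc)
qed simp

text \<open>The \<open>j\<close>-th block has the \<open>j\<close>-th pivot as its pfaffian once all
  earlier pivots are known to be nonzero; the bounds are therefore obtained by strong induction on
  \<open>j\<close>.\<close>

lemma chain_ok_of_F:
  assumes b: "skew b"
    and pos: "\<And>j. j + 2 \<le> m \<Longrightarrow> pf (upper_left_block ((F ^^ j) (Matrix.mat (2 * m) (2 * m) (\<lambda>(i, j). b i j)))) \<in> {0<..<1}"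
    and last: "pf (upper_left_block ((F ^^ (m - 1)) (Matrix.mat (2 * m) (2 * m) (\<lambda>(i, j). b i j)))) \<notin> \<int>"
    and m: "0 < m"
  shows "chain_ok (m - 1) b"
proof -
  let ?B = "Matrix.mat (2 * m) (2 * m) (\<lambda>(i, j). b i j)"
  have pf: "pf (upper_left_block ((F ^^ j) ?B)) = (red ^^ j) b 0 1"
    if "j < m" "\<And>i. i < j \<Longrightarrow> (red ^^ i) b 0 1 \<noteq> 0" for j
  proof -
    have "(F ^^ j) ?B = Matrix.mat (2 * m - 2 * j) (2 * m - 2 * j) (\<lambda>(i, k). (red ^^ j) b i k)"
      using that by (intro F_pow_mat b) auto
    then show ?thesis using pf_upper_left_block[OF skew_red_pow[OF b], of "2 * m - 2 * j" j] that(1) by simp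
  qed
  have in01: "0 < (red ^^ j) b 0 1 \<and> (red ^^ j) b 0 1 < 1" if "j < m - 1" for j
    using that
  proof (induction j rule: less_induct)
    case (less j)
    have "(red ^^ i) b 0 1 \<noteq> 0" if "i < j" for i using less.IH[OF that] less.prems that by auto
    then have "pf (upper_left_block ((F ^^ j) ?B)) = (red ^^ j) b 0 1" using less.prems by (intro pf) auto
    then show ?case using pos[of j] less.prems by auto
  qed
  have "(red ^^ (m - 1)) b 0 1 \<notin> \<int>"
    using last pf[of "m - 1"] in01 m by fastforce
  then show ?thesis unfolding chain_ok_iff using in01 by blast
qed

text \<open>\<open>pick\<close> is determined by the number of smaller elements, and in a strictly
  increasing list exactly the first \<open>i\<close> entries lie below \<open>I ! i\<close>.\<close>

lemma pick_set_nth: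
  assumes I: "sorted_wrt (<) I" and i: "i < length I"
  shows "pick (set I) i = I ! i"
proof -
  have lt: "I ! a < I ! b \<longleftrightarrow> a < b" if "a < length I" "b < length I" for a b
    using sorted_wrt_nth_less[OF I] that by (metis linorder_neqE_nat order_less_asym)
  have "{a \<in> set I. a < I ! i} = (!) I ` {..<i}"
    using lt i by (auto simp: in_set_conv_nth image_iff) (metis order_less_trans)+
  moreover have "inj_on ((!) I) {..<i}"
  proof (rule inj_onI)
    fix a b assume "a \<in> {..<i}" "b \<in> {..<i}" "I ! a = I ! b"
    then show "a = b" using lt[of a b] lt[of b a] i by auto
  qed
  ultimately have "card {a \<in> set I. a < I ! i} = i" by (simp add: card_image)
  then show ?thesis using pick_card_in_set[of "I ! i" "set I"] i by simp
qed

lemma index_submatrix_eq: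
  assumes \<Theta>: "\<Theta> \<in> carrier_mat n n" and I: "sorted_wrt (<) I" "set I \<subseteq> {..<n}"
  shows "index_submatrix \<Theta> I = Matrix.mat (length I) (length I) (\<lambda>(i, j). \<Theta> $$ (I ! i, I ! j))"
proof -
  have "distinct I" using I(1) by (simp add: strict_sorted_iff)
  moreover have "{i. i < n \<and> i \<in> set I} = set I" using I(2) by auto
  ultimately have "card {i. i < n \<and> i \<in> set I} = length I" by (simp add: distinct_card)
  then show ?thesis
    unfolding index_submatrix_def submatrix_def using \<Theta>
    by (intro eq_matI) (auto simp: pick_set_nth[OF I(1)])
qed

section \<open>From ordered monomials to arbitrary words\<close>

context cstar_algebra
begin

lemma unitary_inv: "unitary A x \<Longrightarrow> inv x = adj A x"
  by (intro monoid.inv_unique'[OF monoid_A, symmetric]) simp_all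

lemma int_pow_eq_upow:
  assumes "unitary A x"
  shows "x [^] (k::int) = upow A x k"
proof (cases "0 \<le> k")
  case True
  then show ?thesis by (simp add: upow_def)
next
  case False
  have "x [^] k = inv (x [^] nat (- k))" using False by (simp add: int_pow_def2 del: pow_nat)
  also have "\<dots> = adj A (x [^] nat (- k))" by (rule unitary_inv[OF unitary_pow[OF assms]])
  also have "\<dots> = upow A x k" using False assms by (simp add: upow_def adj_pow del: pow_nat)
  finally show ?thesis .
qed

text \<open>The ordered monomial along an arbitrary list of generators, so that reordering can be
  proved by induction on the list.\<close>

definition omono :: "(nat \<Rightarrow> 'a) \<Rightarrow> nat list \<Rightarrow> (nat \<Rightarrow> int) \<Rightarrow> 'a" where
  "omono u js k = foldr (\<lambda>j x. upow A (u j) (k j) \<otimes> x) js \<one>"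

lemma omono_simps [simp]:
  "omono u [] k = \<one>" "omono u (j # js) k = upow A (u j) (k j) \<otimes> omono u js k"
  by (simp_all add: omono_def)

lemma unitary_omono: "(\<And>j. j \<in> set js \<Longrightarrow> unitary A (u j)) \<Longrightarrow> unitary A (omono u js k)"
  by (induction js) (auto intro!: unitary_mult)

lemma omono_cong: "(\<And>j. j \<in> set js \<Longrightarrow> k j = k' j) \<Longrightarrow> omono u js k = omono u js k'"
  by (induction js) auto

text \<open>The letter travels to the right, collecting a phase at each foreign generator, until it
  reaches the power of its own generator and is absorbed there.\<close>

lemma letter_omono:
  assumes js: "distinct js" "fst l \<in> set js" "\<And>j. j \<in> set js \<Longrightarrow> unitary A (u j)"
    and comm: "\<And>i. i \<in> set js \<Longrightarrow> \<exists>t. u (fst l) \<otimes> u i = ex t \<odot> (u i \<otimes> u (fst l))"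
  defines "k' k \<equiv> (\<lambda>i. (if fst l = i then if snd l then 1 else -1 else 0) + k i)"
  shows "\<exists>c. cmod c = 1 \<and> letter A u l \<otimes> omono u js k = c \<odot> omono u js (k' k)"
  using js comm
proof (induction js)
  case (Cons i js)
  have un: "unitary A (u i)" "unitary A (u (fst l))" "unitary A (omono u js k)" "unitary A (omono u js (k' k))" "unitary A (letter A u l)"
    using Cons.prems by (auto intro!: unitary_omono unitary_letter)
  show ?case
  proof (cases "i = fst l")
    case True
    have "omono u js k = omono u js (k' k)"
      using Cons.prems(1) True by (intro omono_cong) (auto simp: k'_def)
    moreover have "letter A u l \<otimes> upow A (u i) (k i) = upow A (u i) (k' k i)"
    proof -
      have "upow A (u i) (- 1) = adj A (u i)" using adj_upow[OF un(1), of 1] un(1) by simp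
      then have "letter A u l = upow A (u i) (if snd l then 1 else - 1)"
        using True un(1) by (simp add: letter_def)
      then show ?thesis using True un(1) by (simp add: k'_def upow_add)
    qed
    ultimately show ?thesis
      using un by (intro exI[of _ 1]) (simp flip: m_assoc)
  next
    case False
    then have "\<exists>c. cmod c = 1 \<and> letter A u l \<otimes> omono u js k = c \<odot> omono u js (k' k)"
      using Cons by (intro Cons.IH) auto
    then obtain c where c: "cmod c = 1" "letter A u l \<otimes> omono u js k = c \<odot> omono u js (k' k)" by blast
    obtain t where t: "u (fst l) \<otimes> u i = ex t \<odot> (u i \<otimes> u (fst l))" using Cons.prems(4)[of i] by auto
    have "\<exists>s. letter A u l \<otimes> u i = ex s \<odot> (u i \<otimes> letter A u l)"
      using t commute_adj[OF un(2) unitary_carrier[OF un(1)] t] by (cases "snd l") (auto simp: letter_def)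
    then obtain s where s: "letter A u l \<otimes> u i = ex s \<odot> (u i \<otimes> letter A u l)" by blast
    have "letter A u l \<otimes> upow A (u i) (k i) = ex (of_int (k i) * s) \<odot> (upow A (u i) (k i) \<otimes> letter A u l)"
      using un s by (intro upow_commute) auto
    then have "letter A u l \<otimes> omono u (i # js) k
        = ex (of_int (k i) * s) \<odot> (upow A (u i) (k i) \<otimes> (letter A u l \<otimes> omono u js k))"
      using un by (simp add: smult_mult flip: m_assoc)
    also have "\<dots> = (ex (of_int (k i) * s) * c) \<odot> (upow A (u i) (k i) \<otimes> omono u js (k' k))"
      unfolding c(2) using un by (simp add: smult_mult)
    also have "upow A (u i) (k i) \<otimes> omono u js (k' k) = omono u (i # js) (k' k)"
      using False by (simp add: k'_def)
    finally show ?thesis using c(1) by (intro exI[of _ "ex (of_int (k i) * s) * c"]) (simp add: norm_mult)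
  qed
qed simp

lemma wprod_eq_omono:
  assumes js: "distinct js" "\<And>j. j \<in> set js \<Longrightarrow> unitary A (u j)"
    and comm: "\<And>i j. i \<in> set js \<Longrightarrow> j \<in> set js \<Longrightarrow> \<exists>t. u j \<otimes> u i = ex t \<odot> (u i \<otimes> u j)"
    and ws: "fst ` set ws \<subseteq> set js"
  shows "\<exists>c. cmod c = 1 \<and> wprod A u ws = c \<odot> omono u js (wdeg ws)"
  using ws
proof (induction ws)
  case Nil
  have "omono u js (\<lambda>_. 0) = \<one>" using js(2) by (induction js) auto
  then show ?case by (intro exI[of _ 1]) simp
next
  case (Cons l ws)
  then obtain c where c: "cmod c = 1" "wprod A u ws = c \<odot> omono u js (wdeg ws)" by auto
  have "\<exists>c. cmod c = 1 \<and> letter A u l \<otimes> omono u js (wdeg ws)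
      = c \<odot> omono u js (\<lambda>i. (if fst l = i then if snd l then 1 else -1 else 0) + wdeg ws i)"
    using Cons.prems by (intro letter_omono js comm) auto
  then obtain c' where c': "cmod c' = 1" "letter A u l \<otimes> omono u js (wdeg ws) = c' \<odot> omono u js (wdeg (l # ws))"
    by (auto simp: wdeg_Cons[abs_def])
  have "unitary A (letter A u l)" "unitary A (omono u js k)" for k
    using Cons.prems js by (auto intro!: unitary_letter unitary_omono)
  then show ?case using c' c(1) by (intro exI[of _ "c * c'"]) (simp add: c(2) smult_mult norm_mult)
qed

end

lemma nct_of_nc_torus:
  assumes A: "cstar_algebra A" and rel: "nc_torus_relations n \<Theta> A u" and can: "canonical_trace n A u \<tau>"
  shows "nct n (\<lambda>i j. \<Theta> $$ (i, j)) A u \<tau>"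
  unfolding nct_def
proof (intro conjI allI impI)
  interpret cstar_algebra A by fact
  show "cstar_algebra A" by fact
  show tr: "tracial_state A \<tau>" using can by (simp add: canonical_trace_def)
  show un: "unitary A (u j)" if "j < n" for j using rel that by (simp add: nc_torus_relations_def)
  have ex: "exp (2 * complex_of_real pi * \<i> * complex_of_real x) = ex x" for x
    by (simp add: ex_def cis_conv_exp mult_ac)
  show comm: "u k \<otimes>\<^bsub>A\<^esub> u j = ex (\<Theta> $$ (j, k)) \<odot>\<^bsub>A\<^esub> (u j \<otimes>\<^bsub>A\<^esub> u k)" if "j < n" "k < n" for j k
    using rel that unfolding nc_torus_relations_def ex by blast
  fix ws i assume ws: "fst ` set ws \<subseteq> {..<n}" "wdeg ws i \<noteq> 0"
  \<comment> \<open>A generator of nonzero degree occurs in the word, so \<open>i < n\<close>, as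
    the condition in \<open>canonical_trace\<close> asks.\<close>
  have "\<exists>l\<in>set ws. fst l = i"
  proof (rule ccontr)
    assume "\<not> ?thesis"
    then have "wdeg ws i = 0" by (induction ws) (auto simp: wdeg_Cons)
    then show False using ws(2) by simp
  qed
  then have i: "i < n" using ws(1) by auto
  have "\<exists>c. cmod c = 1 \<and> wprod A u ws = c \<odot>\<^bsub>A\<^esub> omono u [0..<n] (wdeg ws)"
  proof (rule wprod_eq_omono)
    show "unitary A (u j)" if "j \<in> set [0..<n]" for j using un that by simp
    show "\<exists>t. u j \<otimes>\<^bsub>A\<^esub> u i = ex t \<odot>\<^bsub>A\<^esub> (u i \<otimes>\<^bsub>A\<^esub> u j)"
      if "i \<in> set [0..<n]" "j \<in> set [0..<n]" for i j
      by (rule exI, rule comm) (use that in simp_all)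
    show "fst ` set ws \<subseteq> set [0..<n]" using ws(1) by (simp add: lessThan_atLeast0)
  qed simp
  then obtain c where c: "wprod A u ws = c \<odot>\<^bsub>A\<^esub> omono u [0..<n] (wdeg ws)" by blast
  have "nc_monomial n A u (wdeg ws) = omono u [0..<n] (wdeg ws)"
    unfolding nc_monomial_def omono_def using un by (intro foldr_cong) (auto simp: int_pow_eq_upow)
  moreover have "\<tau> (nc_monomial n A u (wdeg ws)) = 0"
    using can i ws(2) unfolding canonical_trace_def by blast
  moreover have "omono u [0..<n] (wdeg ws) \<in> carrier A"
    using un by (intro unitary_carrier unitary_omono) auto
  moreover have "\<tau> (c \<odot>\<^bsub>A\<^esub> x) = c * \<tau> x" if "x \<in> carrier A" for x
    using tr that unfolding tracial_state_def by blast
  ultimately show "\<tau> (wprod A u ws) = 0"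
    unfolding c by (simp only: mult_zero_right)
qed

lemma nct_cong:
  assumes nct: "nct n \<Theta> A u \<tau>" and eq: "\<And>j k. j < n \<Longrightarrow> k < n \<Longrightarrow> \<Theta> j k = \<Theta>' j k"
  shows "nct n \<Theta>' A u \<tau>"
  unfolding nct_def
proof (intro conjI allI impI)
  show "u k \<otimes>\<^bsub>A\<^esub> u j = ex (\<Theta>' j k) \<odot>\<^bsub>A\<^esub> (u j \<otimes>\<^bsub>A\<^esub> u k)" if "j < n" "k < n" for j k
    using nctD(4)[OF nct that] unfolding eq[OF that] .
qed (rule nctD[OF nct]; assumption?)+

text \<open>Algebra and trace stay the same, so the projection for \<open>I\<close> is found in
  \<open>A\<close> itself. Distinctness of \<open>I\<close> preserves degrees under
  relabelling.\<close>

lemma nct_subsystem: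
  assumes nct: "nct n \<Theta> A u \<tau>" and I: "distinct I" "set I \<subseteq> {..<n}"
  shows "nct (length I) (\<lambda>i j. \<Theta> (I ! i) (I ! j)) A (\<lambda>i. u (I ! i)) \<tau>"
  unfolding nct_def
proof (intro conjI allI impI)
  have In: "I ! j < n" if "j < length I" for j using I(2) nth_mem[OF that] by auto
  show "cstar_algebra A" "tracial_state A \<tau>" by (rule nctD[OF nct])+
  show "unitary A (u (I ! j))" if "j < length I" for j using nctD(3)[OF nct In[OF that]] .
  show "u (I ! k) \<otimes>\<^bsub>A\<^esub> u (I ! j) = ex (\<Theta> (I ! j) (I ! k)) \<odot>\<^bsub>A\<^esub> (u (I ! j) \<otimes>\<^bsub>A\<^esub> u (I ! k))"
    if "j < length I" "k < length I" for j k using nctD(4)[OF nct In[OF that(1)] In[OF that(2)]] .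
  fix ws i assume ws: "fst ` set ws \<subseteq> {..<length I}" "wdeg ws i \<noteq> 0"
  define ws' where "ws' = map (map_prod ((!) I) id) ws"
  have i: "i < length I"
  proof (rule ccontr)
    assume "\<not> ?thesis"
    then have "wdeg ws i = 0" using ws(1) by (induction ws) (auto simp: wdeg_Cons)
    then show False using ws(2) by simp
  qed
  have "wdeg ws' (I ! i) = wdeg ws i"
    unfolding ws'_def using ws(1) i I(1) by (induction ws) (auto simp: wdeg_Cons nth_eq_iff_index_eq)
  moreover have "wprod A u ws' = wprod A (\<lambda>i. u (I ! i)) ws"
    unfolding ws'_def by (induction ws) (auto simp: letter_def)
  moreover have "fst ` set ws' \<subseteq> {..<n}"
    unfolding ws'_def using ws(1) In by auto
  ultimately show "\<tau> (wprod A (\<lambda>i. u (I ! i)) ws) = 0"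
    using nctD(5)[OF nct, of ws' "I ! i"] ws(2) by simp
qed

theorem theorem3p16:
  fixes n :: nat and \<Theta> :: "real mat"
    and A :: "'a cstar" and u :: "nat \<Rightarrow> 'a" and \<tau> :: "'a \<Rightarrow> complex"
  assumes "n \<ge> 2"
    and "\<Theta> \<in> carrier_mat n n"
    and "transpose_mat \<Theta> = - \<Theta>"
    and "universal_nc_torus n \<Theta> A u"
    and "canonical_trace n A u \<tau>"
    and "\<And>I m. \<lbrakk>I \<in> even_multi_indices n; length I = 2 * m\<rbrakk> \<Longrightarrow>
           (\<forall>j. j + 2 \<le> m \<longrightarrow>
              pf (upper_left_block ((F ^^ j) (index_submatrix \<Theta> I))) \<in> {0<..<1}) \<and>
           pf (upper_left_block ((F ^^ (m - 1)) (index_submatrix \<Theta> I))) \<notin> \<int>"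
  shows "\<forall>I\<in>even_multi_indices n. \<exists>P (k :: nat list \<Rightarrow> int) (k0 :: int).
           projection A P \<and>
           \<tau> P = complex_of_real
             (pf (index_submatrix \<Theta> I)
              + (\<Sum>s | even s \<and> 0 < s \<and> s < length I.
                   pf (index_submatrix \<Theta> (take s I)) * of_int (k (take s I)))
              + of_int k0)"
proof
  fix I assume Iev: "I \<in> even_multi_indices n"
  then have I: "sorted_wrt (<) I" "set I \<subseteq> {..<n}" "even (length I)" "2 \<le> length I"
    by (auto simp: even_multi_indices_def)
  obtain m where len: "length I = 2 * Suc m"
    using I(3,4) by (metis dvdE mult_0_right not0_implies_Suc not_numeral_le_zero)
  \<comment> \<open>The leading blocks of \<open>b\<close> are the submatrices of the initial
    segments of \<open>I\<close>; extension by zero makes \<open>b\<close> skew at all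
    indices.\<close>
  define b where "b i j = (if i < length I \<and> j < length I then \<Theta> $$ (I ! i, I ! j) else 0)" for i j
  have b: "skew b"
    unfolding skew_def
  proof (intro allI)
    fix i j
    show "b j i = - b i j"
    proof (cases "i < length I \<and> j < length I")
      case True
      then have "I ! i < n" "I ! j < n" using I(2) nth_mem by blast+
      then have "\<Theta> $$ (I ! j, I ! i) = - \<Theta> $$ (I ! i, I ! j)"
        using arg_cong[OF assms(3), of "\<lambda>M. M $$ (I ! i, I ! j)"] assms(2) by simp
      then show ?thesis using True by (simp add: b_def)
    qed (auto simp: b_def)
  qed
  have sub: "index_submatrix \<Theta> (take s I) = Matrix.mat s s (\<lambda>(i, j). b i j)" if "s \<le> length I" for s
  proof -
    have "index_submatrix \<Theta> (take s I) = Matrix.mat (length (take s I)) (length (take s I)) (\<lambda>(i, j). \<Theta> $$ (take s I ! i, take s I ! j))"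
      using I(1,2) set_take_subset[of s I] by (intro index_submatrix_eq[OF assms(2)] sorted_wrt_take) auto
    also have "\<dots> = Matrix.mat s s (\<lambda>(i, j). b i j)"
      using that by (intro eq_matI) (auto simp: b_def)
    finally show ?thesis .
  qed
  have pf: "pf (index_submatrix \<Theta> (take (2 * r) I)) = pfn r b" if "r \<le> Suc m" for r
    using sub[of "2 * r"] that len pf_mat[of r b] by simp
  have subI: "index_submatrix \<Theta> I = Matrix.mat (2 * Suc m) (2 * Suc m) (\<lambda>(i, j). b i j)"
    using sub[of "length I"] len by simp
  have ok: "chain_ok m b"
    using chain_ok_of_F[OF b, of "Suc m"] assms(6)[OF Iev len] unfolding subI by auto
  have "nct (length I) (\<lambda>i j. \<Theta> $$ (I ! i, I ! j)) A (\<lambda>i. u (I ! i)) \<tau>"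
  proof (rule nct_subsystem[of n "\<lambda>i j. \<Theta> $$ (i, j)"])
    have "cstar_algebra A" "nc_torus_relations n \<Theta> A u"
      using assms(4) unfolding universal_nc_torus_def by blast+
    then show "nct n (\<lambda>i j. \<Theta> $$ (i, j)) A u \<tau>" using assms(5) by (rule nct_of_nc_torus)
    show "distinct I" using I(1) by (simp add: strict_sorted_iff)
  qed (rule I)
  then have "nct (length I) b A (\<lambda>i. u (I ! i)) \<tau>"
    by (rule nct_cong) (simp add: b_def)
  then have "nct (2 * m + 2) b A (\<lambda>i. u (I ! i)) \<tau>"
    using len by simp
  then obtain P where P: "projection A P" "\<tau> P = of_real (chain_trace m b)"
    using exists_projection[OF _ ok] by blast
  \<comment> \<open>The integer part of the last pivot. By \<open>chain_trace_eq\<close> it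
    multiplies the pfaffian of the longest proper initial segment, so \<open>k\<close> is supported
    on lists of that length. For \<open>m = 0\<close> this segment is empty with pfaffian 1, and
    \<open>- c\<close> becomes \<open>k0\<close>.\<close>
  define c where "c = \<lfloor>(red ^^ m) b 0 1\<rfloor>"
  define k where "k J = (if length J = 2 * m then - c else 0)" for J :: "nat list"
  define k0 where "k0 = (if m = 0 then - c else 0)"
  let ?S = "{s. even s \<and> 0 < s \<and> s < length I}"
  have summand: "pf (index_submatrix \<Theta> (take s I)) * of_int (k (take s I)) = (if s = 2 * m then - (of_int c * pfn m b) else 0)"
    if "s \<in> ?S" for s
    using that pf[of m] by (auto simp: k_def min_def)
  have "(\<Sum>s\<in>?S. pf (index_submatrix \<Theta> (take s I)) * of_int (k (take s I)))
      = (\<Sum>s\<in>?S. if s = 2 * m then - (of_int c * pfn m b) else 0)"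
    by (rule sum.cong[OF refl summand])
  also have "\<dots> = (if 2 * m \<in> ?S then - (of_int c * pfn m b) else 0)"
    by (rule sum.delta) simp
  finally have "(\<Sum>s\<in>?S. pf (index_submatrix \<Theta> (take s I)) * of_int (k (take s I))) + of_int k0 = - (of_int c * pfn m b)"
    using len by (auto simp: k0_def)
  moreover have "chain_trace m b = pf (index_submatrix \<Theta> I) - of_int c * pfn m b"
    using chain_trace_eq[OF b ok] pf[of "Suc m"] len by (simp add: c_def)
  ultimately have "chain_trace m b = pf (index_submatrix \<Theta> I)
      + (\<Sum>s\<in>?S. pf (index_submatrix \<Theta> (take s I)) * of_int (k (take s I))) + of_int k0"
    by linarith
  then have "\<tau> P = complex_of_real (pf (index_submatrix \<Theta> I)
      + (\<Sum>s\<in>?S. pf (index_submatrix \<Theta> (take s I)) * of_int (k (take s I))) + of_int k0)"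
    using P(2) by (simp only:)
  then show "\<exists>P (k :: nat list \<Rightarrow> int) (k0 :: int). projection A P \<and>
       \<tau> P = complex_of_real (pf (index_submatrix \<Theta> I)
         + (\<Sum>s\<in>?S. pf (index_submatrix \<Theta> (take s I)) * of_int (k (take s I))) + of_int k0)"
    using P(1) by (intro exI[of _ P] exI[of _ k] exI[of _ k0] conjI)
qed

end
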